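(* Let $c\in\mathbb{C}$ and let $n, m$ be integers with $1\leq m\leq n$. Let $f(z)$ be a nonconstant entire function of finite order such that $\Delta_c^n f(z)\not\equiv 0$, and let $a(z), b(z)\in S(f)$ with $b(z)\not\equiv 0$ be such that $b(z)$ is a periodic entire function with period $c$ and $\Delta_c^m a(z)\equiv 0$. If $f(z)-a(z)$, $\Delta_c^n f(z)-b(z)$ and $\Delta_c^{n+1} f(z)-b(z)$ share $0$ CM, then $$\Delta_c f(z)\equiv f(z)+b(z)+\Delta_c a(z)-a(z).$$
   Context: Difference operators: for a meromorphic function $f$ in $\mathbb{C}$, $\Delta_c f(z)=f(z+c)-f(z)$ and $\Delta_c^n f(z)=\Delta_c^{n-1}(\Delta_c f(z))$ for $n\geq 2$. Let $T(r,f)$ be the Nevanlinna characteristic of $f$; finite order means $\rho(f)=\limsup_{r\to\infty}\frac{\log^+ T(r,f)}{\log r}<\infty$. $S(r,f)$ denotes any quantity that is $o(T(r,f))$ as $r\to\infty$ outside a possible exceptional set of finite logarithmic measure; a meromorphic function $\varphi$ is a small function of $f$ if $T(r,\varphi)=S(r,f)$, and $S(f)$ is the family of all small functions of $f$. Periodic with period $c$ means $b(z+c)\equiv b(z)$. Functions share $0$ CM if they all have the same zeros, counting multiplicities. *)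

theory Defs
  imports "HOL-Complex_Analysis.Complex_Analysis" "HOL-Library.Landau_Symbols"
    "HOL-Library.Extended_Nat"
begin

text \<open>
  A meromorphic function on the plane is a function \<open>f :: complex \<Rightarrow> complex\<close> with
  \<open>f meromorphic_on UNIV\<close>. Its values on a discrete set (e.g. at its poles) are irrelevant, so an
  identity \<open>f \<equiv> g\<close> of meromorphic functions reads \<open>\<forall>\<^sub>\<approx>z\<in>UNIV. f z = g z\<close> (equality off a set
  without limit points). All notions below are insensitive to such changes of values.
\<close>

definition fwd_diff :: "complex \<Rightarrow> (complex \<Rightarrow> complex) \<Rightarrow> complex \<Rightarrow> complex" where
  "fwd_diff c f = (\<lambda>z. f (z + c) - f z)"

definition log_plus :: "real \<Rightarrow> real" where
  "log_plus x = ln (max 1 x)"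

definition proximity :: "(complex \<Rightarrow> complex) \<Rightarrow> real \<Rightarrow> real" where
  "proximity f r =
     1 / (2 * pi) * integral {0..2 * pi} (\<lambda>\<theta>. log_plus (norm (f (complex_of_real r * cis \<theta>))))"

definition pole_count :: "(complex \<Rightarrow> complex) \<Rightarrow> real \<Rightarrow> nat" where
  "pole_count f r = (\<Sum>z | z \<in> cball 0 r \<and> is_pole f z. nat (- zorder f z))"

definition pole_counting :: "(complex \<Rightarrow> complex) \<Rightarrow> real \<Rightarrow> real" where
  "pole_counting f r =
     integral {0..r} (\<lambda>t. (real (pole_count f t) - real (pole_count f 0)) / t)
     + real (pole_count f 0) * ln r"

definition nevanlinna_T :: "(complex \<Rightarrow> complex) \<Rightarrow> real \<Rightarrow> real" where
  "nevanlinna_T f r = proximity f r + pole_counting f r"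

definition nevanlinna_order :: "(complex \<Rightarrow> complex) \<Rightarrow> ereal" where
  "nevanlinna_order f = Limsup at_top (\<lambda>r. ereal (log_plus (nevanlinna_T f r) / ln r))"

definition finite_log_measure :: "real set \<Rightarrow> bool" where
  "finite_log_measure E \<longleftrightarrow>
     E \<in> sets lebesgue \<and> E \<subseteq> {1..} \<and> (\<integral>\<^sup>+ t\<in>E. ennreal (1 / t) \<partial>lebesgue) < \<infinity>"

text \<open>\<open>is_S g f\<close> renders \<open>g(r) = S(r, f)\<close>.\<close>

definition is_S :: "(real \<Rightarrow> real) \<Rightarrow> (complex \<Rightarrow> complex) \<Rightarrow> bool" where
  "is_S g f \<longleftrightarrow>
     (\<exists>E. finite_log_measure E \<and> g \<in> o[inf at_top (principal (- E))](nevanlinna_T f))"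

definition small_functions :: "(complex \<Rightarrow> complex) \<Rightarrow> (complex \<Rightarrow> complex) set" where
  "small_functions f = {\<phi>. \<phi> meromorphic_on UNIV \<and> is_S (nevanlinna_T \<phi>) f}"

text \<open>
  Multiplicity of \<open>z\<close> as a zero of the meromorphic function \<open>g\<close>. It is \<open>0\<close> if \<open>z\<close> is not a
  zero: at a pole \<open>zorder g z\<close> is negative and truncated by \<open>nat\<close>. The first case is separate
  because \<open>zorder\<close> is unspecified for a function that vanishes identically near \<open>z\<close>.
\<close>

definition zero_mult :: "(complex \<Rightarrow> complex) \<Rightarrow> complex \<Rightarrow> enat" where
  "zero_mult g z = (if \<forall>\<^sub>F w in at z. g w = 0 then \<infinity> else enat (nat (zorder g z)))"

definition share_zero_CM :: "(complex \<Rightarrow> complex) set \<Rightarrow> bool" where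
  "share_zero_CM G \<longleftrightarrow> (\<forall>g\<in>G. \<forall>h\<in>G. \<forall>z. zero_mult g z = zero_mult h z)"

end

theory Submission
  imports Defs "HOL-Computational_Algebra.Fundamental_Theorem_Algebra" "HOL-Real_Asymp.Real_Asymp"
begin

text \<open>
  Put \<open>G = fwd_diff c ^^ n f - b\<close>. The sharing hypothesis yields entire functions \<open>U\<close> and \<open>W\<close>, the
  latter without zeros, such that \<open>G = U * (f - a)\<close> and \<open>fwd_diff c ^^ (n + 1) f - b = W * G\<close>; the
  claim is that \<open>U = W = 1\<close>. As \<open>f\<close> has finite order, there are arbitrarily large radii at which the
  logarithm of its maximum modulus does not grow by more than a constant factor when the radius is
  multiplied by \<open>A\<close>; all growth is measured along such radii, and \<open>W = exp P\<close> with a polynomial \<open>P\<close>.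

  Suppose \<open>W \<noteq> 1\<close>. By the difference analogue of the lemma on the logarithmic derivative, applied to
  \<open>F = G / U\<close>, the entire function \<open>(W - 1) * U = (fwd_diff c ^^ (n + 1) F - fwd_diff c ^^ n F) / F\<close> is
  small compared with \<open>f\<close>. It vanishes at the zeros of \<open>exp P - 1\<close>, whose number forces \<open>W\<close>, and hence
  \<open>U\<close>, to be small. Then \<open>fwd_diff c ^^ n F = G + b\<close> is a linear relation between \<open>G\<close> and \<open>b\<close> with
  small coefficients. They must vanish since otherwise \<open>f\<close> would be small, and the resulting recurrence
  along \<open>z + k * c\<close> has no solution in which \<open>W (z + k * c)\<close> is the exponential of a polynomial in \<open>k\<close>,
  other than \<open>W = 1\<close>.

  For \<open>W = 1\<close> the function \<open>g = G + b\<close> satisfies \<open>g (z + c) = 2 * g z\<close>, so that \<open>U (z + k * c)\<close>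
  tends to \<open>1\<close>. From this \<open>U\<close> has no zeros, is the exponential of a polynomial, and equals \<open>1\<close>.
\<close>

section \<open>Quotients of holomorphic functions\<close>

text \<open>Two obstacles shape the estimates. First, \<open>a\<close> may have poles and is small
  only on average and off an exceptional set of radii. In the growth estimates it is therefore never
  bounded pointwise: it occurs multiplied by an entire function that cancels its poles, and the
  Poisson formula turns the mean of \<open>log_plus\<close> on one circle into a bound for the
  product. Exceptional radii are avoided because no interval from \<open>x\<close> to
  \<open>2 * x\<close> with \<open>x\<close> large consists of them. Second, quotients must be
  bounded near zeros of the denominator. These are split off as linear factors of modulus at least 1
  on an outer circle, so that a division costs constant factors in radius and exponent and no
  minimum modulus estimate is needed. Clearing the poles of \<open>a\<close> takes up to a constant
  times \<open>\<Lambda> i\<close> linear factors and loses a logarithm of the radius; hence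
  \<open>U\<close> is first bounded only by
  \<open>exp (\<Lambda> i * sqrt (sqrt (\<rho> i)))\<close>. The estimate for difference quotients
  gains \<open>sqrt (\<rho> i)\<close>, which outweighs this loss.\<close>

lemma max_modulus_cball:
  assumes "h holomorphic_on S" "cball z0 R \<subseteq> S" "R > 0"
    and "\<And>z. dist z0 z = R \<Longrightarrow> norm (h z) \<le> B" and "z \<in> cball z0 R"
  shows "norm (h z) \<le> B"
proof (rule maximum_modulus_frontier[of h "cball z0 R"])
  show "h holomorphic_on interior (cball z0 R)"
    using assms(1,2) holomorphic_on_subset interior_subset by blast
  show "continuous_on (closure (cball z0 R)) h"
    using assms(1,2) by (simp add: holomorphic_on_imp_continuous_on holomorphic_on_subset)
qed (use assms in \<open>auto simp: frontier_cball\<close>)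

lemma norm_divide_pos: "r > 0 \<Longrightarrow> norm (x / complex_of_real r) = norm x / r"
  by (simp add: norm_divide)

text \<open>The local factor at the zero and the quotient by \<open>(z - p) ^ n\<close> agree where
  both are defined and are glued together. The case \<open>m = 0\<close> covers a point
  \<open>p\<close> that is not a zero.\<close>

lemma factor_zero_at:
  fixes h :: "complex \<Rightarrow> complex"
  assumes "h holomorphic_on S" "open S" "connected S" "p \<in> S" "z0 \<in> S" "h z0 \<noteq> 0"
  obtains m g where "g holomorphic_on S" "g p \<noteq> 0" "\<And>z. z \<in> S \<Longrightarrow> h z = (z - p) ^ m * g z"
proof (cases "h p = 0")
  case False
  then show ?thesis using that[of h 0] assms by simp
next
  case True
  have "\<not> h constant_on S"
    using True assms(4-6) unfolding constant_on_def by metis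
  then obtain g r n where g: "0 < n" "0 < r" "ball p r \<subseteq> S" "g holomorphic_on ball p r"
    "\<And>w. w \<in> ball p r \<Longrightarrow> h w = (w - p) ^ n * g w" "\<And>w. w \<in> ball p r \<Longrightarrow> g w \<noteq> 0"
    using holomorphic_factor_zero_nonconstant[OF assms(1-4) True] by metis
  define G where "G = (\<lambda>z. if z \<in> ball p r then g z else h z / (z - p) ^ n)"
  have eq: "G z = h z / (z - p) ^ n" if "z \<noteq> p" for z
    using that g by (auto simp: G_def)
  have "G analytic_on {z}" if "z \<in> S" for z
  proof (cases "z = p")
    case True
    have "G holomorphic_on ball p r"
      using g(4) by (rule holomorphic_transform) (auto simp: G_def)
    then show ?thesis using True g(2) by (meson analytic_at centre_in_ball open_ball)
  next
    case False
    have "(\<lambda>z. h z / (z - p) ^ n) holomorphic_on S - {p}"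
      by (intro holomorphic_intros holomorphic_on_subset[OF assms(1)]) auto
    then have "G holomorphic_on S - {p}"
      by (rule holomorphic_transform) (use eq in auto)
    then show ?thesis using False that assms(2) by (meson analytic_at open_delete insertE Diff_iff singletonD)
  qed
  then have "G holomorphic_on S"
    by (meson analytic_imp_holomorphic analytic_on_analytic_at)
  moreover have "G p \<noteq> 0" using g by (auto simp: G_def)
  moreover have "h z = (z - p) ^ n * G z" if "z \<in> S" for z
    using that eq[of z] True g by (cases "z = p") auto
  ultimately show ?thesis using that by blast
qed

text \<open>Zeros are removed one point at a time with full multiplicity, so the number of distinct
  zeros in \<open>K\<close> drops. The point \<open>z0\<close>, where \<open>h\<close> does not
  vanish, keeps every intermediate quotient from being identically zero.\<close>

lemma factor_zeros:
  fixes h :: "complex \<Rightarrow> complex"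
  assumes "h holomorphic_on S" "open S" "connected S" "compact K" "K \<subseteq> S" "z0 \<in> S" "h z0 \<noteq> 0"
  obtains ps k where "set ps \<subseteq> K" "k holomorphic_on S" "\<And>z. z \<in> K \<Longrightarrow> k z \<noteq> 0"
    "\<And>z. z \<in> S \<Longrightarrow> h z = (\<Prod>p\<leftarrow>ps. z - p) * k z"
proof -
  have fin: "finite {z\<in>K. h z = 0}" if "h holomorphic_on S" "h z0 \<noteq> 0" for h
  proof (cases "h constant_on S")
    case True
    then have "h z \<noteq> 0" if "z \<in> K" for z
      using \<open>h z0 \<noteq> 0\<close> that assms(5,6) unfolding constant_on_def by (metis subsetD)
    then have "{z\<in>K. h z = 0} = {}" by blast
    then show ?thesis by (metis finite.emptyI)
  next
    case False
    then show ?thesis using holomorphic_compact_finite_zeros[OF that(1) assms(2-5)] by blast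
  qed
  have "\<exists>ps k. set ps \<subseteq> K \<and> k holomorphic_on S \<and> (\<forall>z\<in>K. k z \<noteq> 0) \<and>
     (\<forall>z\<in>S. h z = (\<Prod>p\<leftarrow>ps. z - p) * k z)" using assms(1,7)
  proof (induction "card {z\<in>K. h z = 0}" arbitrary: h rule: less_induct)
    case less
    show ?case
    proof (cases "{z\<in>K. h z = 0} = {}")
      case True
      then show ?thesis by (intro exI[of _ "[]"] exI[of _ h]) (use less in auto)
    next
      case False
      then obtain p where p: "p \<in> K" "h p = 0" by auto
      then have "p \<in> S" using assms by auto
      from factor_zero_at[OF less(2) assms(2,3) this assms(6) less(3)]
      obtain m g where g: "g holomorphic_on S" "g p \<noteq> 0" "\<And>z. z \<in> S \<Longrightarrow> h z = (z - p) ^ m * g z"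
        by blast
      have gz0: "g z0 \<noteq> 0" using g(3)[OF assms(6)] less(3) by auto
      have "{z\<in>K. g z = 0} \<subset> {z\<in>K. h z = 0}"
        using g p assms(5) by auto
      then have "card {z\<in>K. g z = 0} < card {z\<in>K. h z = 0}"
        using fin[OF less(2,3)] by (rule psubset_card_mono[rotated])
      from less(1)[OF this g(1) gz0] obtain ps k where
        pk: "set ps \<subseteq> K" "k holomorphic_on S" "\<forall>z\<in>K. k z \<noteq> 0"
          "\<forall>z\<in>S. g z = (\<Prod>p\<leftarrow>ps. z - p) * k z" by blast
      show ?thesis
        by (intro exI[of _ "replicate m p @ ps"] exI[of _ k])
          (use pk p g(3) in \<open>auto simp: prod_list_replicate\<close>)
    qed
  qed
  then show ?thesis using that by blast
qed

text \<open>Schwarz lemma for \<open>g / (2 * A - g)\<close> with \<open>g = l - l z0\<close>,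
  rescaled to the unit disc: the map \<open>w / (2 * A - w)\<close> sends the half-plane
  \<open>Re w < A\<close> into the unit disc and fixes 0. The strict hypothesis at the centre yields
  \<open>A > 0\<close>.\<close>

lemma borel_caratheodory:
  fixes l :: "complex \<Rightarrow> complex"
  assumes "l holomorphic_on ball z0 r" "r > 0"
    and lt: "\<And>z. z \<in> ball z0 r \<Longrightarrow> Re (l z) < A + Re (l z0)"
    and "dist z0 z \<le> s" "s < r"
  shows "norm (l z - l z0) \<le> 2 * A * s / (r - s)"
proof -
  have "A > 0" using lt[of z0] \<open>r > 0\<close> by simp
  define g where "g = (\<lambda>w. l (z0 + of_real r * w) - l z0)"
  define f where "f = (\<lambda>w. g w / (of_real (2 * A) - g w))"
  have inball: "z0 + of_real r * w \<in> ball z0 r" if "w \<in> ball 0 1" for w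
    using that \<open>r > 0\<close> by (simp add: dist_norm norm_mult)
  have g: "g holomorphic_on ball 0 1" unfolding g_def
    by (intro holomorphic_intros holomorphic_on_compose_gen[OF _ assms(1), unfolded o_def])
      (use inball in auto)
  have Reg: "Re (g w) < A" if "w \<in> ball 0 1" for w
    using lt[OF inball[OF that]] by (simp add: g_def)
  have nz: "of_real (2 * A) - g w \<noteq> 0" if "w \<in> ball 0 1" for w
  proof
    assume "of_real (2 * A) - g w = 0"
    then have "Re (g w) = 2 * A" by (metis Re_complex_of_real right_minus_eq)
    then show False using Reg[OF that] \<open>A > 0\<close> by simp
  qed
  have f: "f holomorphic_on ball 0 1" unfolding f_def
    by (intro holomorphic_intros g nz)
  have lt1: "norm (f w) < 1" if "norm w < 1" for w
  proof -
    have w: "w \<in> ball 0 1" using that by simp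
    \<comment> \<open>The identity behind this is
      \<open>|2 * A - g|^2 - |g|^2 = 4 * A * (A - Re g)\<close>.\<close>
    have "A * Re (g w) < A * A" using Reg[OF w] \<open>A > 0\<close> by simp
    then have "(norm (g w))\<^sup>2 < (norm (of_real (2 * A) - g w))\<^sup>2"
      unfolding cmod_power2 by (simp add: power2_eq_square algebra_simps)
    then have "norm (g w) < norm (of_real (2 * A) - g w)"
      by (rule power2_less_imp_less) simp
    then show ?thesis using nz[OF w] by (simp add: f_def norm_divide)
  qed
  define w where "w = (z - z0) / of_real r"
  have wz: "z = z0 + of_real r * w" using \<open>r > 0\<close> by (simp add: w_def)
  have nw: "norm w \<le> s / r"
    using assms(4) \<open>r > 0\<close> by (simp add: w_def norm_divide dist_norm norm_minus_commute divide_right_mono)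
  have "s / r < 1" using assms by simp
  then have w1: "norm w < 1" using nw by linarith
  have "norm (f w) \<le> norm w"
    by (rule Schwarz_Lemma(1)[OF f _ lt1 w1]) (simp_all add: f_def g_def)
  then have "norm (f w) \<le> s / r" using nw by linarith
  moreover have "norm (f w) = norm (g w) / norm (of_real (2 * A) - g w)"
    by (simp add: f_def norm_divide)
  moreover have "norm (of_real (2 * A) - g w) > 0" using nz[of w] w1 by simp
  ultimately have "norm (g w) \<le> s / r * norm (of_real (2 * A) - g w)"
    by (simp add: pos_divide_le_eq)
  also have "\<dots> \<le> s / r * (2 * A + norm (g w))"
  proof (rule mult_left_mono)
    show "norm (of_real (2 * A) - g w) \<le> 2 * A + norm (g w)"
      using norm_triangle_ineq4[of "of_real (2 * A)" "g w"] \<open>A > 0\<close> by simp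
    show "0 \<le> s / r" using nw norm_ge_zero[of w] by linarith
  qed
  finally have "norm (g w) * r \<le> s * (2 * A + norm (g w))"
    using \<open>r > 0\<close> by (simp add: field_simps)
  then have "norm (g w) * (r - s) \<le> 2 * A * s" by (simp add: algebra_simps)
  then have "norm (g w) \<le> 2 * A * s / (r - s)" using assms(5) by (simp add: pos_le_divide_eq)
  then show ?thesis by (simp add: g_def wz)
qed

lemma norm_normalised_prod_ge:
  assumes "norm z = R" "set ps \<subseteq> cball 0 (R / 4)" "R > 0"
  shows "norm (\<Prod>p\<leftarrow>ps. (z - p) / complex_of_real (3 * R / 4)) \<ge> 1"
  using assms(2)
proof (induction ps)
  case (Cons p ps)
  have "norm (z - p) \<ge> 3 * R / 4"
    using norm_triangle_ineq2[of z p] assms(1) Cons.prems by auto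
  then have "1 \<le> norm ((z - p) / of_real (3 * R / 4))"
    using \<open>R > 0\<close> by (subst norm_divide_pos) (auto simp: field_simps)
  moreover have "1 \<le> norm (\<Prod>p\<leftarrow>ps. (z - p) / of_real (3 * R / 4))" using Cons by auto
  ultimately have "1 * 1 \<le> norm ((z - p) / of_real (3 * R / 4)) * norm (\<Prod>p\<leftarrow>ps. (z - p) / of_real (3 * R / 4))"
    by (intro mult_mono) auto
  then show ?case by (simp only: list.map prod_list.Cons norm_mult mult_1_left)
qed simp

text \<open>Normalised by \<open>3 * R / 4\<close>, every linear factor is at least \<open>1\<close> in modulus on the
  circle of radius \<open>R\<close> and at most \<open>1 / 2\<close> at \<open>z0\<close>, which bounds the number of zeros.\<close>

lemma zeros_structure:
  fixes h :: "complex \<Rightarrow> complex"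
  assumes "h holomorphic_on S" "open S" "connected S" "cball 0 R \<subseteq> S" "R > 0" "B > 0"
    and hB: "\<And>z. norm z \<le> R \<Longrightarrow> norm (h z) \<le> exp B"
    and z0: "norm z0 \<le> R / 16" "norm (h z0) \<ge> exp (- B)"
  obtains ps k where "set ps \<subseteq> cball 0 (R / 4)" "real (length ps) \<le> 3 * B"
    "k holomorphic_on S" "\<And>z. z \<in> cball 0 (R / 4) \<Longrightarrow> k z \<noteq> 0"
    "\<And>z. z \<in> S \<Longrightarrow> h z = (\<Prod>p\<leftarrow>ps. (z - p) / of_real (3 * R / 4)) * k z"
    "\<And>z. norm z \<le> R / 16 \<Longrightarrow> norm (k z) \<ge> exp (- 20 * B)"
    "\<And>z t. norm z \<le> R / 32 \<Longrightarrow> norm (z + t) \<le> R / 32 \<Longrightarrow>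
       norm (k (z + t)) \<le> exp (600 * B * norm t / R) * norm (k z)"
proof -
  have z0S: "z0 \<in> S" using z0 assms(4,5) by (auto simp: subset_iff)
  have hz0: "h z0 \<noteq> 0" using z0(2) by auto
  have "cball 0 (R / 4) \<subseteq> S" using assms(4,5) by (auto simp: subset_iff)
  from factor_zeros[OF assms(1-3) compact_cball this z0S hz0] obtain ps k0 where
    ps: "set ps \<subseteq> cball 0 (R / 4)" and k0: "k0 holomorphic_on S"
    and nz0: "\<And>z. z \<in> cball 0 (R / 4) \<Longrightarrow> k0 z \<noteq> 0"
    and hk0: "\<And>z. z \<in> S \<Longrightarrow> h z = (\<Prod>p\<leftarrow>ps. z - p) * k0 z" by blast
  define k where "k = (\<lambda>z. of_real (3 * R / 4) ^ length ps * k0 z)"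
  have k: "k holomorphic_on S" unfolding k_def by (intro holomorphic_intros k0)
  have nz: "k z \<noteq> 0" if "z \<in> cball 0 (R / 4)" for z
    using nz0[OF that] \<open>R > 0\<close> by (simp add: k_def)
  have prod_eq: "(\<Prod>p\<leftarrow>ps. (z - p) / of_real (3 * R / 4)) = (\<Prod>p\<leftarrow>ps. z - p) / of_real (3 * R / 4) ^ length ps"
    for z by (induction ps) (auto simp: field_simps)
  have hk: "h z = (\<Prod>p\<leftarrow>ps. (z - p) / of_real (3 * R / 4)) * k z" if "z \<in> S" for z
    unfolding prod_eq hk0[OF that] k_def using \<open>R > 0\<close> by simp
  note prod_ge = norm_normalised_prod_ge[OF _ ps \<open>R > 0\<close>]
  \<comment> \<open>\<open>|z0 - p| <= R / 16 + R / 4 = 5 * R / 16\<close>, which is less than half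
    of \<open>3 * R / 4\<close>.\<close>
  have prod_le: "norm (\<Prod>p\<leftarrow>ps. (z0 - p) / of_real (3 * R / 4)) \<le> (1 / 2) ^ length ps"
    using ps
  proof (induction ps)
    case (Cons p ps)
    have "norm (z0 - p) \<le> R / 16 + R / 4"
      using norm_triangle_ineq4[of z0 p] z0 Cons.prems by auto
    then have "norm ((z0 - p) / of_real (3 * R / 4)) \<le> 1 / 2"
      using \<open>R > 0\<close> by (subst norm_divide_pos) (auto simp: field_simps)
    moreover have "norm (\<Prod>p\<leftarrow>ps. (z0 - p) / of_real (3 * R / 4)) \<le> (1 / 2) ^ length ps" using Cons by auto
    ultimately have "norm ((z0 - p) / of_real (3 * R / 4)) * norm (\<Prod>p\<leftarrow>ps. (z0 - p) / of_real (3 * R / 4))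
        \<le> 1 / 2 * (1 / 2) ^ length ps" by (intro mult_mono) auto
    then show ?case by (simp only: list.map prod_list.Cons norm_mult list.size add_0_right power_Suc add_Suc_right plus_1_eq_Suc Suc_eq_plus1[symmetric])
  qed simp
  \<comment> \<open>On the outer circle \<open>|k| <= |h|\<close>, because the product of the
    normalised factors has modulus at least 1 there; the maximum principle carries the bound
    inside.\<close>
  have kle: "norm (k z) \<le> exp B" if "norm z \<le> R" for z
  proof (rule max_modulus_cball[OF k assms(4,5)])
    fix w :: complex assume "dist 0 w = R"
    then have w: "norm w = R" by simp
    then have "w \<in> S" using assms(4) by auto
    have "norm (k w) \<le> norm (\<Prod>p\<leftarrow>ps. (w - p) / of_real (3 * R / 4)) * norm (k w)"
      using mult_right_mono[OF prod_ge[OF w] norm_ge_zero[of "k w"]] by simp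
    also have "\<dots> = norm (h w)" unfolding hk[OF \<open>w \<in> S\<close>] by (simp add: norm_mult)
    also have "\<dots> \<le> exp B" using hB w by simp
    finally show "norm (k w) \<le> exp B" .
  qed (use that in simp)
  have "exp (- B) \<le> norm (\<Prod>p\<leftarrow>ps. (z0 - p) / of_real (3 * R / 4)) * norm (k z0)"
    using z0(2) unfolding hk[OF z0S] by (simp add: norm_mult)
  also have "\<dots> \<le> (1 / 2) ^ length ps * norm (k z0)"
    by (intro mult_right_mono prod_le) simp
  finally have kz0': "exp (- B) \<le> (1 / 2) ^ length ps * norm (k z0)" .
  have "(1 / 2 :: real) ^ length ps * norm (k z0) \<le> 1 * norm (k z0)"
    by (intro mult_right_mono power_le_one) auto
  then have kz0: "exp (- B) \<le> norm (k z0)" using kz0' by linarith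
  \<comment> \<open>The two bounds at \<open>z0\<close> give
    \<open>length ps * ln 2 <= 2 * B\<close>, and \<open>ln 2 >= 2 / 3\<close> produces the constant
    3.\<close>
  have len: "real (length ps) \<le> 3 * B"
  proof -
    have "exp (- B) \<le> (1 / 2) ^ length ps * exp B"
    proof -
      have "norm (k z0) \<le> exp B" using z0(1) \<open>R > 0\<close> by (intro kle) simp
      then have "(1 / 2) ^ length ps * norm (k z0) \<le> (1 / 2) ^ length ps * exp B"
        by (intro mult_left_mono) auto
      then show ?thesis using kz0' by linarith
    qed
    then have "2 ^ length ps \<le> exp B * exp B"
      by (simp add: exp_minus field_simps power_divide)
    then have "ln (2 ^ length ps) \<le> ln (exp B * exp B)" by (subst ln_le_cancel_iff) auto
    then have "real (length ps) * ln 2 \<le> 2 * B" by (simp add: ln_realpow ln_mult)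
    moreover have "ln 2 \<ge> (2 / 3 :: real)" by (rule ln2_ge_two_thirds)
    then have "real (length ps) * (2 / 3) \<le> real (length ps) * ln 2" by (intro mult_left_mono) auto
    ultimately show ?thesis by simp
  qed
  \<comment> \<open>A lower bound is known only at \<open>z0\<close>, so the logarithm of
    \<open>k\<close> is studied on a disc around \<open>z0\<close>; the radius is
    \<open>R / 4 - R / 16\<close>.\<close>
  have sub: "ball z0 (3 * R / 16) \<subseteq> cball 0 (R / 4)"
  proof
    fix w assume "w \<in> ball z0 (3 * R / 16)"
    then have "norm (w - z0) < 3 * R / 16" by (simp add: dist_norm norm_minus_commute)
    then show "w \<in> cball 0 (R / 4)" using norm_triangle_ineq[of "w - z0" z0] z0 by simp
  qed
  have "k holomorphic_on ball z0 (3 * R / 16)"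
    using k sub \<open>cball 0 (R / 4) \<subseteq> S\<close> holomorphic_on_subset by blast
  moreover have "contractible (ball z0 (3 * R / 16))"
    by (rule convex_imp_contractible[OF convex_ball])
  moreover have "k z \<noteq> 0" if "z \<in> ball z0 (3 * R / 16)" for z
    using nz sub that by blast
  ultimately obtain l where l: "l holomorphic_on ball z0 (3 * R / 16)"
    and kl: "\<And>z. z \<in> ball z0 (3 * R / 16) \<Longrightarrow> k z = exp (l z)"
    using contractible_imp_holomorphic_log[of k "ball z0 (3 * R / 16)"] by (auto simp only:)
  have z0in: "z0 \<in> ball z0 (3 * R / 16)" using \<open>R > 0\<close> by simp
  have Re_l0: "Re (l z0) \<ge> - B"
    using kz0 unfolding kl[OF z0in] by simp
  have Re_l: "Re (l z) \<le> B" if "z \<in> ball z0 (3 * R / 16)" for z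
  proof -
    have "norm z \<le> R" using sub that \<open>R > 0\<close> by force
    then show ?thesis using kle[of z] unfolding kl[OF that] by simp
  qed
  \<comment> \<open>\<open>Re (l z) - Re (l z0)\<close> is at most \<open>2 * B\<close>; taking
    \<open>3 * B\<close> makes the inequality strict. The gap between the radii is
    \<open>R / 16\<close>, whence \<open>2 * (3 * B) * 2 = 12 * B\<close>.\<close>
  have bc: "norm (l z - l z0) \<le> 12 * B" if "dist z0 z \<le> R / 8" for z
  proof -
    have "norm (l z - l z0) \<le> 2 * (3 * B) * (R / 8) / (3 * R / 16 - R / 8)"
    proof (rule borel_caratheodory[OF l])
      show "Re (l w) < 3 * B + Re (l z0)" if "w \<in> ball z0 (3 * R / 16)" for w
        using Re_l[OF that] Re_l0 \<open>B > 0\<close> by linarith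
    qed (use that \<open>R > 0\<close> in auto)
    also have "\<dots> = 12 * B" using \<open>R > 0\<close> by (simp add: field_simps)
    finally show ?thesis .
  qed
  have near: "dist z0 z \<le> R / 8" if "norm z \<le> R / 16" for z
    using norm_triangle_ineq4[of z0 z] z0 that by (simp add: dist_norm)
  have kge: "norm (k z) \<ge> exp (- 20 * B)" if "norm z \<le> R / 16" for z
  proof -
    have "z \<in> ball z0 (3 * R / 16)" using near[OF that] \<open>R > 0\<close> by simp
    have "\<bar>Re (l z - l z0)\<bar> \<le> 12 * B" using bc[OF near[OF that]] abs_Re_le_cmod order_trans by blast
    then have "Re (l z) \<ge> - 20 * B" using Re_l0 \<open>B > 0\<close> by simp
    then show ?thesis unfolding kl[OF \<open>z \<in> _\<close>] by simp
  qed
  have kdiff: "norm (k (z + t)) \<le> exp (600 * B * norm t / R) * norm (k z)"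
    if z: "norm z \<le> R / 32" "norm (z + t) \<le> R / 32" for z t
  proof -
    have in16: "x \<in> ball z0 (3 * R / 16)" if "norm x \<le> R / 16" for x
      using near[OF that] \<open>R > 0\<close> by simp
    \<comment> \<open>Cauchy's estimate on a disc of radius \<open>R / 32\<close> turns
      \<open>12 * B\<close> into \<open>384 * B / R\<close>, rounded up to 600.\<close>
    have der: "norm (deriv l x) \<le> 600 * B / R" if x: "x \<in> cball 0 (R / 32)" for x
    proof -
      have sub2: "cball x (R / 32) \<subseteq> cball 0 (R / 16)"
      proof
        fix y assume "y \<in> cball x (R / 32)"
        then have "norm (y - x) \<le> R / 32" by (simp add: dist_norm norm_minus_commute)
        then show "y \<in> cball 0 (R / 16)" using x norm_triangle_ineq[of "y - x" x] by simp
      qed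
      define g where "g = (\<lambda>y. l y - l z0)"
      have lg: "l holomorphic_on cball x (R / 32)"
        by (rule holomorphic_on_subset[OF l]) (use sub2 in16 in auto)
      have "norm ((deriv ^^ 1) g x) \<le> fact 1 * (12 * B) / (R / 32) ^ 1"
      proof (rule Cauchy_inequality)
        show "g holomorphic_on ball x (R / 32)" unfolding g_def
          by (intro holomorphic_intros holomorphic_on_subset[OF lg]) auto
        show "continuous_on (cball x (R / 32)) g" unfolding g_def
          by (intro continuous_intros holomorphic_on_imp_continuous_on lg)
        show "norm (g y) \<le> 12 * B" if "norm (x - y) = R / 32" for y
          unfolding g_def using that sub2 by (intro bc near) (auto simp: dist_norm)
      qed (use \<open>R > 0\<close> in auto)
      moreover have "deriv g x = deriv l x"
      proof (rule DERIV_imp_deriv)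
        have "norm x \<le> R / 16" using x \<open>R > 0\<close> by simp
        then show "(g has_field_derivative deriv l x) (at x)" unfolding g_def
          using holomorphic_derivI[OF l open_ball in16] by (auto intro!: derivative_eq_intros)
      qed
      ultimately have "norm (deriv l x) \<le> 384 * B / R" by simp
      also have "\<dots> \<le> 600 * B / R" using \<open>B > 0\<close> \<open>R > 0\<close> by (intro divide_right_mono) auto
      finally show ?thesis .
    qed
    have "norm (l (z + t) - l z) \<le> 600 * B / R * norm ((z + t) - z)"
    proof (rule field_differentiable_bound[where S = "cball 0 (R / 32)"])
      fix x :: complex assume "x \<in> cball 0 (R / 32)"
      then have "norm x \<le> R / 16" using \<open>R > 0\<close> by simp
      from holomorphic_derivI[OF l open_ball in16[OF this]]
      show "(l has_field_derivative deriv l x) (at x within cball 0 (R / 32))" .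
    qed (use der z in auto)
    moreover have "Re (l (z + t)) - Re (l z) \<le> norm (l (z + t) - l z)"
      using complex_Re_le_cmod[of "l (z + t) - l z"] by simp
    ultimately have "Re (l (z + t)) \<le> 600 * B * norm t / R + Re (l z)" by simp
    moreover have "z \<in> ball z0 (3 * R / 16)" "z + t \<in> ball z0 (3 * R / 16)"
      by (rule in16, use z \<open>R > 0\<close> in linarith)+
    ultimately show ?thesis by (simp add: kl flip: exp_add)
  qed
  show ?thesis using that[OF ps len k nz hk kge kdiff] .
qed

text \<open>The function estimated is \<open>Q * k\<close>, where \<open>k\<close> is the zero-free
  part of \<open>h2\<close>: on the outer circle \<open>|Q * k| <= |h1|\<close>, as the linear
  factors have modulus at least 1 there. Zeros of \<open>h2\<close> inside therefore do no harm. The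
  constant is 21 = 1 + 20, with 20 from the lower bound for \<open>k\<close>.\<close>

lemma quotient_bound:
  fixes Q :: "complex \<Rightarrow> complex"
  assumes "h1 holomorphic_on S" "h2 holomorphic_on S" "Q holomorphic_on S"
    and "open S" "connected S" "cball 0 R \<subseteq> S" "R > 0" "B > 0"
    and h1B: "\<And>z. norm z \<le> R \<Longrightarrow> norm (h1 z) \<le> exp B"
    and h2B: "\<And>z. norm z \<le> R \<Longrightarrow> norm (h2 z) \<le> exp B"
    and z0: "norm z0 \<le> R / 16" "norm (h2 z0) \<ge> exp (- B)"
    and eq: "\<And>z. z \<in> S \<Longrightarrow> h1 z = Q z * h2 z"
    and z: "norm z \<le> R / 16"
  shows "norm (Q z) \<le> exp (21 * B)"
proof -
  obtain ps k where ps: "set ps \<subseteq> cball 0 (R / 4)"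
    and k: "k holomorphic_on S"
    and hk: "\<And>z. z \<in> S \<Longrightarrow> h2 z = (\<Prod>p\<leftarrow>ps. (z - p) / of_real (3 * R / 4)) * k z"
    and kge: "\<And>z. norm z \<le> R / 16 \<Longrightarrow> norm (k z) \<ge> exp (- 20 * B)"
    using zeros_structure[OF assms(2,4-8) h2B z0] by metis
  note prod_ge = norm_normalised_prod_ge[OF _ ps \<open>R > 0\<close>]
  have "norm (Q z * k z) \<le> exp B"
  proof (rule max_modulus_cball[of "\<lambda>z. Q z * k z", OF _ assms(6,7)])
    show "(\<lambda>z. Q z * k z) holomorphic_on S" by (intro holomorphic_intros assms k)
    fix w :: complex assume "dist 0 w = R"
    then have w: "norm w = R" by simp
    then have "w \<in> S" using assms(6) by auto
    have "norm (Q w * k w) \<le> norm (\<Prod>p\<leftarrow>ps. (w - p) / of_real (3 * R / 4)) * norm (Q w * k w)"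
      using mult_right_mono[OF prod_ge[OF w] norm_ge_zero[of "Q w * k w"]] by simp
    also have "\<dots> = norm (h1 w)" unfolding eq[OF \<open>w \<in> S\<close>] hk[OF \<open>w \<in> S\<close>] by (simp add: norm_mult)
    also have "\<dots> \<le> exp B" using h1B w by simp
    finally show "norm (Q w * k w) \<le> exp B" .
  qed (use z \<open>R > 0\<close> in simp)
  moreover have "norm (Q z) * exp (- 20 * B) \<le> norm (Q z) * norm (k z)"
    by (intro mult_left_mono kge z) simp
  ultimately have "norm (Q z) * exp (- 20 * B) \<le> exp B" by (simp add: norm_mult)
  then have "norm (Q z) \<le> exp B * exp (20 * B)" by (simp add: exp_minus field_simps)
  then show ?thesis by (simp flip: exp_add)
qed

section \<open>Poisson integrals and the proximity function\<close>

text \<open>Cauchy's formula for \<open>l u * (R^2 - |z|^2) / (R^2 - cnj z * u)\<close>, which takes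
  the value \<open>l z\<close> at \<open>u = z\<close>. On the circle the denominator equals
  \<open>u * cnj (u - z)\<close>, and this produces the Poisson kernel.\<close>

lemma poisson_integral:
  fixes l :: "complex \<Rightarrow> complex"
  assumes l: "l holomorphic_on cball 0 R" and z: "norm z < R"
  shows "((\<lambda>\<theta>. l (of_real R * cis \<theta>) * of_real ((R\<^sup>2 - (norm z)\<^sup>2) / (norm (of_real R * cis \<theta> - z))\<^sup>2))
           has_integral 2 * pi * l z) {0..2 * pi}"
proof -
  have "R > 0" using z norm_ge_zero[of z] by linarith
  define c where "c = (\<lambda>u. (of_real R)\<^sup>2 - cnj z * u)"
  have c0: "c u \<noteq> 0" if "norm u \<le> R" for u
  proof
    assume "c u = 0"
    then have "norm ((of_real R :: complex)\<^sup>2) = norm (cnj z * u)" by (simp add: c_def)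
    then have "R\<^sup>2 = norm z * norm u" by (simp add: norm_mult norm_power)
    moreover have "norm z * norm u \<le> norm z * R" using that by (intro mult_left_mono) auto
    moreover have "norm z * R < R * R" using z \<open>R > 0\<close> by simp
    ultimately show False by (simp add: power2_eq_square)
  qed
  define g where "g = (\<lambda>u. l u * of_real (R\<^sup>2 - (norm z)\<^sup>2) / c u)"
  have g: "g holomorphic_on cball 0 R"
    unfolding g_def c_def by (intro holomorphic_intros l) (use c0 in \<open>auto simp: c_def\<close>)
  have cz: "c z = of_real (R\<^sup>2 - (norm z)\<^sup>2)"
    unfolding c_def by (simp add: mult.commute[of "cnj z"] flip: complex_norm_square)
  have gz: "g z = l z" using c0[of z] z unfolding g_def cz by simp
  have "((\<lambda>u. g u / (u - z)) has_contour_integral (2 * of_real pi * \<i> * g z)) (circlepath 0 R)"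
    by (rule Cauchy_integral_circlepath)
      (use g z in \<open>auto intro: holomorphic_on_imp_continuous_on holomorphic_on_subset\<close>)
  then have "((\<lambda>t. g (0 + of_real R * cis t) / (0 + of_real R * cis t - z) * of_real R * \<i> * cis t) has_integral
       (2 * of_real pi * \<i> * g z)) {0..2 * pi}"
    unfolding circlepath_def by (subst (asm) has_contour_integral_part_circlepath_iff) auto
  then have "((\<lambda>t. - \<i> * (g (0 + of_real R * cis t) / (0 + of_real R * cis t - z) * of_real R * \<i> * cis t)) has_integral
       - \<i> * (2 * of_real pi * \<i> * g z)) {0..2 * pi}"
    by (rule has_integral_mult_right)
  moreover have "- \<i> * (2 * of_real pi * \<i> * g z) = 2 * pi * l z" by (simp add: gz)
  moreover have "- \<i> * (g (0 + of_real R * cis t) / (0 + of_real R * cis t - z) * of_real R * \<i> * cis t)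
      = l (of_real R * cis t) * of_real ((R\<^sup>2 - (norm z)\<^sup>2) / (norm (of_real R * cis t - z))\<^sup>2)" for t
  proof -
    define u where "u = of_real R * cis t"
    have nu: "norm u = R" using \<open>R > 0\<close> by (simp add: u_def norm_mult)
    have uz: "u - z \<noteq> 0" using nu z by auto
    have u0: "u \<noteq> 0" using nu \<open>R > 0\<close> by auto
    have "c u = u * cnj (u - z)"
      unfolding c_def using complex_norm_square[of u] nu by (simp add: algebra_simps)
    moreover have "of_real ((norm (u - z))\<^sup>2) = (u - z) * cnj (u - z)"
      by (rule complex_norm_square)
    moreover have "- \<i> * (x / (u * v) / w * \<i> * u) = x / (w * v)"
      if "v \<noteq> 0" "w \<noteq> 0" for x v w
      using that u0 by (simp add: field_simps)
    ultimately have "- \<i> * (g u / (u - z) * \<i> * u) =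
       l u * of_real ((R\<^sup>2 - (norm z)\<^sup>2)) / of_real ((norm (u - z))\<^sup>2)"
      unfolding g_def using uz by (metis complex_cnj_zero_iff)
    then show ?thesis by (simp add: u_def mult_ac)
  qed
  ultimately show ?thesis by (simp only:)
qed

text \<open>\<open>|R^2 - cnj p * z|^2 = (R * |z - p|)^2 + (R^2 - |p|^2) * (R^2 - |z|^2)\<close>. So
  replacing \<open>z - p\<close> by \<open>(R^2 - cnj p * z) / R\<close> keeps the modulus on the
  circle and does not lower it inside, while removing a zero \<open>p\<close> of the open
  disc.\<close>

lemma blaschke_factor:
  assumes "norm p \<le> R" "norm z \<le> R"
  shows "R * norm (z - p) \<le> norm ((of_real R)\<^sup>2 - cnj p * z)"
    and "norm z = R \<Longrightarrow> R * norm (z - p) = norm ((of_real R)\<^sup>2 - cnj p * z)"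
proof -
  have R0: "R \<ge> 0" using assms norm_ge_zero order_trans by blast
  have eq: "(norm ((of_real R)\<^sup>2 - cnj p * z))\<^sup>2 =
     (R * norm (z - p))\<^sup>2 + (R\<^sup>2 - (norm p)\<^sup>2) * (R\<^sup>2 - (norm z)\<^sup>2)"
    unfolding power_mult_distrib cmod_power2
    by (simp add: power2_eq_square algebra_simps)
  have "(norm p)\<^sup>2 \<le> R\<^sup>2" "(norm z)\<^sup>2 \<le> R\<^sup>2" using assms by (auto intro: power_mono)
  then have "(R * norm (z - p))\<^sup>2 \<le> (norm ((of_real R)\<^sup>2 - cnj p * z))\<^sup>2"
    unfolding eq by simp
  then show "R * norm (z - p) \<le> norm ((of_real R)\<^sup>2 - cnj p * z)"
    by (rule power2_le_imp_le) simp
  show "R * norm (z - p) = norm ((of_real R)\<^sup>2 - cnj p * z)" if "norm z = R"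
  proof (rule power2_eq_imp_eq)
    show "(R * norm (z - p))\<^sup>2 = (norm ((of_real R)\<^sup>2 - cnj p * z))\<^sup>2"
      unfolding eq that by simp
  qed (use R0 in simp_all)
qed

lemma log_plus_nonneg [simp]: "log_plus x \<ge> 0"
  by (simp add: log_plus_def)

lemma ln_le_log_plus: "x > 0 \<Longrightarrow> ln x \<le> log_plus x"
  by (simp add: log_plus_def)

lemma le_exp_log_plus: "x \<le> exp (log_plus x)"
  by (simp add: log_plus_def)

lemma log_plus_le: "0 \<le> B \<Longrightarrow> x \<le> exp B \<Longrightarrow> log_plus x \<le> B"
  unfolding log_plus_def
  by (metis exp_ge_zero ln_exp ln_mono max.boundedI max.strict_coboundedI1 one_le_exp_iff zero_less_one)

lemma continuous_on_log_plus [continuous_intros]: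
  "continuous_on A f \<Longrightarrow> continuous_on A (\<lambda>x. log_plus (f x))"
  unfolding log_plus_def by (intro continuous_intros) auto

lemma log_plus_circle_integrable:
  assumes "continuous_on (sphere 0 r) f" "r \<ge> 0"
  shows "(\<lambda>\<theta>. log_plus (norm (f (complex_of_real r * cis \<theta>)))) integrable_on {0..2 * pi}"
proof (rule integrable_continuous_real)
  have "continuous_on {0..2 * pi} (\<lambda>\<theta>. f (complex_of_real r * cis \<theta>))"
    by (rule continuous_on_compose2[OF assms(1)])
      (use assms(2) in \<open>auto intro!: continuous_intros simp: norm_mult\<close>)
  then show "continuous_on {0..2 * pi} (\<lambda>\<theta>. log_plus (norm (f (complex_of_real r * cis \<theta>))))"
    by (intro continuous_intros)
qed

text \<open>The bridge from circle means to pointwise bounds. Exchanging the zeros for Blaschke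
  factors turns \<open>h\<close> into a zero-free \<open>k = exp l\<close> with the same modulus on
  the circle and at least the same inside. The Poisson formula represents \<open>Re l\<close>, and
  as its kernel is nonnegative and at most 3, \<open>ln |h|\<close> may be replaced by
  \<open>3 * log_plus |h|\<close> under the integral.\<close>

lemma norm_le_exp_proximity:
  fixes h :: "complex \<Rightarrow> complex"
  assumes h: "h holomorphic_on S" "open S" "connected S" "cball 0 R \<subseteq> S" "R > 0"
    and nz: "\<And>z. norm z = R \<Longrightarrow> h z \<noteq> 0" and z: "norm z \<le> R / 2"
  shows "norm (h z) \<le> exp (3 * proximity h R)"
proof -
  have RS: "of_real R \<in> S" "h (of_real R) \<noteq> 0" using assms(4,5) nz by auto
  from factor_zeros[OF h(1-3) compact_cball assms(4) RS] obtain ps k0 where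
    ps: "set ps \<subseteq> cball 0 R" and k0: "k0 holomorphic_on S"
    and nz0: "\<And>z. z \<in> cball 0 R \<Longrightarrow> k0 z \<noteq> 0"
    and hk0: "\<And>z. z \<in> S \<Longrightarrow> h z = (\<Prod>p\<leftarrow>ps. z - p) * k0 z" by blast
  have plt: "norm p < R" if "p \<in> set ps" for p
  proof (rule ccontr)
    assume "\<not> norm p < R"
    then have "norm p = R" using ps that by force
    moreover have "h p = 0"
      using that hk0[of p] ps assms(4) by (auto simp: prod_list_zero_iff)
    ultimately show False using nz by blast
  qed
  define k where "k = (\<lambda>w. k0 w * (\<Prod>p\<leftarrow>ps. ((of_real R)\<^sup>2 - cnj p * w) / of_real R))"
  have c0: "((of_real R)\<^sup>2 - cnj p * u) / of_real R \<noteq> 0" if "norm u \<le> R" "p \<in> set ps" for u p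
  proof
    assume "((of_real R)\<^sup>2 - cnj p * u) / of_real R = 0"
    then have "norm ((of_real R :: complex)\<^sup>2) = norm (cnj p * u)" using \<open>R > 0\<close> by simp
    then have "R\<^sup>2 = norm p * norm u" by (simp add: norm_mult norm_power)
    moreover have "norm p * norm u \<le> norm p * R" using that by (intro mult_left_mono) auto
    moreover have "norm p * R < R * R" using plt[OF that(2)] \<open>R > 0\<close> by simp
    ultimately show False by (simp add: power2_eq_square)
  qed
  have "k holomorphic_on cball 0 R"
    unfolding k_def
  proof (intro holomorphic_intros)
    show "k0 holomorphic_on cball 0 R" using k0 assms(4) holomorphic_on_subset by blast
    show "(\<lambda>w. \<Prod>p\<leftarrow>ps. ((of_real R)\<^sup>2 - cnj p * w) / of_real R) holomorphic_on cball 0 R"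
      by (induction ps) (use \<open>R > 0\<close> in \<open>auto intro!: holomorphic_intros\<close>)
  qed
  moreover have "k w \<noteq> 0" if "w \<in> cball 0 R" for w
    using nz0[OF that] that c0[of w] by (force simp: k_def prod_list_zero_iff)
  ultimately obtain l where l: "l holomorphic_on cball 0 R"
    and kl: "\<And>w. w \<in> cball 0 R \<Longrightarrow> k w = exp (l w)"
    using contractible_imp_holomorphic_log[of k "cball 0 R", OF _ convex_imp_contractible[OF convex_cball]]
    by (auto simp only:)
  have cong: "norm (\<Prod>p\<leftarrow>qs. w - p) = norm (\<Prod>p\<leftarrow>qs. ((of_real R)\<^sup>2 - cnj p * w) / of_real R)"
    if "norm w = R" "set qs \<subseteq> set ps" for w qs
    using that(2)
  proof (induction qs)
    case (Cons p qs)
    have "norm (w - p) = norm (((of_real R)\<^sup>2 - cnj p * w) / of_real R)"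
      using blaschke_factor(2)[of p R w] plt[of p] Cons.prems that(1) \<open>R > 0\<close>
      by (auto simp: norm_divide_pos field_simps)
    moreover have "norm (\<Prod>p\<leftarrow>qs. w - p) = norm (\<Prod>p\<leftarrow>qs. ((of_real R)\<^sup>2 - cnj p * w) / of_real R)"
      using Cons by auto
    ultimately show ?case by (simp only: list.map prod_list.Cons norm_mult)
  qed simp
  have bnd: "norm (\<Prod>p\<leftarrow>qs. w - p) \<le> norm (\<Prod>p\<leftarrow>qs. ((of_real R)\<^sup>2 - cnj p * w) / of_real R)"
    if "norm w \<le> R" "set qs \<subseteq> set ps" for w qs
    using that(2)
  proof (induction qs)
    case (Cons p qs)
    have "norm (w - p) \<le> norm (((of_real R)\<^sup>2 - cnj p * w) / of_real R)"
      using blaschke_factor(1)[of p R w] plt[of p] Cons.prems that(1) \<open>R > 0\<close>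
      by (auto simp: norm_divide_pos field_simps)
    then have "norm (w - p) * norm (\<Prod>p\<leftarrow>qs. w - p) \<le>
        norm (((of_real R)\<^sup>2 - cnj p * w) / of_real R) * norm (\<Prod>p\<leftarrow>qs. ((of_real R)\<^sup>2 - cnj p * w) / of_real R)"
      using Cons by (intro mult_mono) auto
    then show ?case by (simp only: list.map prod_list.Cons norm_mult)
  qed simp
  have zR: "norm z < R" using z \<open>R > 0\<close> by simp
  define P where "P = (\<lambda>\<theta>. (R\<^sup>2 - (norm z)\<^sup>2) / (norm (of_real R * cis \<theta> - z))\<^sup>2)"
  \<comment> \<open>The kernel is at most \<open>(R + |z|) / (R - |z|)\<close>, which is 3 for
    \<open>|z| = R / 2\<close>.\<close>
  have P: "0 \<le> P \<theta>" "P \<theta> \<le> 3" for \<theta>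
  proof -
    have z2: "(norm z)\<^sup>2 \<le> R\<^sup>2" using zR by (intro power_mono) auto
    then show "0 \<le> P \<theta>" by (simp add: P_def)
    have "norm (of_real R * cis \<theta> - z) \<ge> R - norm z"
      using norm_triangle_ineq2[of "of_real R * cis \<theta>" z] \<open>R > 0\<close> by (simp add: norm_mult)
    then have "(R - norm z)\<^sup>2 \<le> (norm (of_real R * cis \<theta> - z))\<^sup>2"
      using zR by (intro power_mono) auto
    then have "P \<theta> \<le> (R\<^sup>2 - (norm z)\<^sup>2) / (R - norm z)\<^sup>2"
      unfolding P_def using z2 zR by (intro divide_left_mono mult_pos_pos) (auto intro: less_le_trans[of _ "(R - norm z)\<^sup>2"])
    also have "\<dots> = (R + norm z) / (R - norm z)"
      using zR unfolding power2_eq_square square_diff_square_factored by simp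
    also have "\<dots> \<le> 3" using z zR by (subst pos_divide_le_eq) auto
    finally show "P \<theta> \<le> 3" .
  qed
  have "((\<lambda>\<theta>. l (of_real R * cis \<theta>) * of_real (P \<theta>)) has_integral 2 * pi * l z) {0..2 * pi}"
    unfolding P_def by (rule poisson_integral[OF l zR])
  then have int1: "((\<lambda>\<theta>. Re (l (of_real R * cis \<theta>)) * P \<theta>) has_integral 2 * pi * Re (l z)) {0..2 * pi}"
    by (auto dest: has_integral_Re)
  have "sphere 0 R \<subseteq> S" using assms(4) sphere_cball by blast
  then have "continuous_on (sphere 0 R) h"
    by (intro holomorphic_on_imp_continuous_on holomorphic_on_subset[OF h(1)])
  then have "(\<lambda>\<theta>. log_plus (norm (h (complex_of_real R * cis \<theta>)))) integrable_on {0..2 * pi}"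
    using \<open>R > 0\<close> by (intro log_plus_circle_integrable) auto
  from integrable_integral[OF this]
  have "((\<lambda>\<theta>. log_plus (norm (h (of_real R * cis \<theta>)))) has_integral 2 * pi * proximity h R) {0..2 * pi}"
    unfolding proximity_def by simp
  then have int2: "((\<lambda>\<theta>. 3 * log_plus (norm (h (of_real R * cis \<theta>)))) has_integral 3 * (2 * pi * proximity h R)) {0..2 * pi}"
    by (rule has_integral_mult_right)
  have "2 * pi * Re (l z) \<le> 3 * (2 * pi * proximity h R)"
  proof (rule has_integral_le[OF int1 int2])
    fix \<theta> :: real
    define u where "u = of_real R * cis \<theta>"
    have nu: "norm u = R" using \<open>R > 0\<close> by (simp add: u_def norm_mult)
    have uS: "u \<in> S" using nu assms(4) by auto
    have "norm (k u) = norm (h u)"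
      unfolding k_def hk0[OF uS] norm_mult using cong[OF nu order_refl] by simp
    then have "norm (h u) = exp (Re (l u))" using kl[of u] nu by simp
    then have "Re (l u) \<le> log_plus (norm (h u))"
      using ln_le_log_plus[of "norm (h u)"] by simp
    then have "Re (l u) * P \<theta> \<le> log_plus (norm (h u)) * P \<theta>" using P by (intro mult_right_mono)
    also have "\<dots> \<le> log_plus (norm (h u)) * 3" using P by (intro mult_left_mono) auto
    finally show "Re (l (of_real R * cis \<theta>)) * P \<theta> \<le> 3 * log_plus (norm (h (of_real R * cis \<theta>)))"
      by (simp add: u_def mult.commute)
  qed
  then have "Re (l z) \<le> 3 * proximity h R" by simp
  moreover have "norm (h z) \<le> norm (k z)"
  proof -
    have "z \<in> S" using zR assms(4) by auto
    then show ?thesis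
      unfolding k_def hk0[OF \<open>z \<in> S\<close>] norm_mult using bnd[of z ps] zR
      by (subst mult.commute) (auto intro!: mult_left_mono)
  qed
  moreover have "norm (k z) = exp (Re (l z))" using kl[of z] zR by simp
  ultimately show ?thesis using order_trans by force
qed

lemma proximity_nonneg: "proximity f r \<ge> 0"
proof -
  \<comment> \<open>A non-integrable integrand has \<open>integral\<close> 0 by convention.\<close>
  have "integral {0..2 * pi} (\<lambda>\<theta>. log_plus (norm (f (complex_of_real r * cis \<theta>)))) \<ge> 0"
    by (cases "(\<lambda>\<theta>. log_plus (norm (f (complex_of_real r * cis \<theta>)))) integrable_on {0..2 * pi}")
      (auto intro: integral_nonneg simp: not_integrable_integral)
  then show ?thesis by (simp add: proximity_def)
qed

lemma proximity_le:
  assumes "\<And>z. norm z = r \<Longrightarrow> norm (f z) \<le> exp B" "B \<ge> 0" "r \<ge> 0"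
  shows "proximity f r \<le> B"
proof (cases "(\<lambda>\<theta>. log_plus (norm (f (complex_of_real r * cis \<theta>)))) integrable_on {0..2 * pi}")
  case True
  have "integral {0..2 * pi} (\<lambda>\<theta>. log_plus (norm (f (complex_of_real r * cis \<theta>)))) \<le> integral {0..2 * pi} (\<lambda>_. B)"
    using assms by (intro integral_le True) (auto intro!: log_plus_le simp: norm_mult)
  then show ?thesis by (simp add: proximity_def field_simps)
qed (use assms(2) in \<open>simp add: proximity_def not_integrable_integral\<close>)

lemma proximity_mult_le:
  assumes "\<And>z. norm z = r \<Longrightarrow> norm (f z) \<le> exp B * norm (g z)" "B \<ge> 0" "r \<ge> 0"
    and "continuous_on (sphere 0 r) f" "continuous_on (sphere 0 r) g"
  shows "proximity f r \<le> B + proximity g r"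
proof -
  have "integral {0..2 * pi} (\<lambda>\<theta>. log_plus (norm (f (complex_of_real r * cis \<theta>)))) \<le>
    integral {0..2 * pi} (\<lambda>\<theta>. B + log_plus (norm (g (complex_of_real r * cis \<theta>))))"
  proof (rule integral_le)
    show "(\<lambda>\<theta>. log_plus (norm (f (complex_of_real r * cis \<theta>)))) integrable_on {0..2 * pi}"
      by (rule log_plus_circle_integrable[OF assms(4,3)])
    show "(\<lambda>\<theta>. B + log_plus (norm (g (complex_of_real r * cis \<theta>)))) integrable_on {0..2 * pi}"
      by (intro integrable_add log_plus_circle_integrable[OF assms(5,3)]) auto
    fix \<theta> :: real
    define u where "u = of_real r * cis \<theta>"
    have nu: "norm u = r" using assms(3) by (simp add: u_def norm_mult)
    have "norm (f u) \<le> exp B * exp (log_plus (norm (g u)))"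
      using assms(1)[OF nu] le_exp_log_plus[of "norm (g u)"] by (meson mult_left_mono order_trans exp_ge_zero)
    then have "norm (f u) \<le> exp (B + log_plus (norm (g u)))" by (simp add: exp_add)
    then show "log_plus (norm (f (complex_of_real r * cis \<theta>))) \<le> B + log_plus (norm (g (complex_of_real r * cis \<theta>)))"
      unfolding u_def[symmetric] using assms(2) by (intro log_plus_le) auto
  qed
  also have "\<dots> = 2 * pi * B + integral {0..2 * pi} (\<lambda>\<theta>. log_plus (norm (g (complex_of_real r * cis \<theta>))))"
    by (subst integral_add[OF _ log_plus_circle_integrable[OF assms(5,3)]]) auto
  finally show ?thesis by (simp add: proximity_def field_simps)
qed

section \<open>The recurrence along a shift orbit\<close>

text \<open>The map sending \<open>x\<close> to \<open>(x + 1) / m\<close> contracts towards its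
  fixed point \<open>1 / (m - 1)\<close>. The bound is twice the fixed point, which eventually
  leaves room for the geometrically decaying error.\<close>

lemma eventually_contraction:
  fixes x :: "nat \<Rightarrow> real"
  assumes "\<forall>\<^sub>F k in sequentially. x (Suc k) \<le> (x k + 1) / m" and "m \<ge> 3"
  shows "\<forall>\<^sub>F k in sequentially. x k \<le> 2 / (m - 1)"
proof -
  obtain k0 where k0: "\<And>k. k \<ge> k0 \<Longrightarrow> x (Suc k) \<le> (x k + 1) / m"
    using assms(1) by (auto simp: eventually_sequentially)
  define t where "t = 1 / (m - 1)"
  have t: "t > 0" "(t + 1) / m = t" using assms(2) by (auto simp: t_def field_simps)
  have bound: "x (k0 + i) \<le> t + \<bar>x k0\<bar> * (1 / m) ^ i" for i
  proof (induction i)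
    case (Suc i)
    have "x (k0 + Suc i) \<le> (x (k0 + i) + 1) / m" using k0[of "k0 + i"] by simp
    also have "\<dots> \<le> ((t + \<bar>x k0\<bar> * (1 / m) ^ i) + 1) / m"
      using Suc assms(2) by (intro divide_right_mono) auto
    also have "\<dots> = (t + 1) / m + \<bar>x k0\<bar> * (1 / m) ^ Suc i" by (simp add: add_divide_distrib)
    finally show ?case by (simp only: t(2))
  qed (use t in simp)
  have "(\<lambda>i. \<bar>x k0\<bar> * (1 / m) ^ i) \<longlonglongrightarrow> \<bar>x k0\<bar> * 0"
    using assms(2) by (intro tendsto_mult tendsto_const LIMSEQ_realpow_zero) auto
  then have "\<forall>\<^sub>F i in sequentially. \<bar>x k0\<bar> * (1 / m) ^ i < t"
    using t by (intro order_tendstoD(2)) auto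
  then have "\<forall>\<^sub>F i in sequentially. x (i + k0) \<le> 2 / (m - 1)"
  proof eventually_elim
    case (elim i)
    then show ?case using bound[of i] by (simp add: t_def add.commute)
  qed
  then show ?thesis by (rule eventually_sequentially_seg[THEN iffD1])
qed

text \<open>In the application \<open>al j k\<close> and \<open>be j k\<close> are the coefficients of \<open>G\<close> and \<open>b\<close> in the \<open>j\<close>-th
  difference of \<open>G / U\<close> at \<open>z + k * c\<close>, where \<open>G (z + c) = (1 + W z) * G z + b z\<close>, and
  \<open>e k = W (z + k * c)\<close>.\<close>

locale difference_chain =
  fixes n :: nat and al be :: "nat \<Rightarrow> nat \<Rightarrow> complex" and e :: "nat \<Rightarrow> complex"
  assumes n: "n \<ge> 1"
    and al_Suc: "\<And>j k. j < n \<Longrightarrow> al (Suc j) k = (1 + e k) * al j (Suc k) - al j k"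
    and be_Suc: "\<And>j k. j < n \<Longrightarrow> be (Suc j) k = al j (Suc k) + be j (Suc k) - be j k"
    and be_0: "\<And>k. be 0 k = 0"
    and al_n: "\<And>k. al n k = 1" and be_n: "\<And>k. be n k = 1"
begin

text \<open>Solved for \<open>al j (Suc k)\<close>, the recurrence divides by
  \<open>1 + e k\<close>, of modulus at least \<open>m\<close>. Descending from
  \<open>al n = 1\<close>, this makes every \<open>al j\<close> with \<open>j < n\<close> eventually
  at most \<open>2 / (m - 1)\<close>. Then \<open>be\<close>, built up from 0 by differences, at
  most triples per level and stays below 1, whereas \<open>be n = 1\<close>; \<open>m\<close> is
  chosen so that \<open>3 ^ n * (2 / (m - 1)) < 1\<close>.\<close>

lemma not_eventually_large:
  assumes "\<forall>\<^sub>F k in sequentially. norm (e k) \<ge> 2 * 3 ^ n + 3"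
  shows False
proof -
  define m :: real where "m = 2 * 3 ^ n + 2"
  have m: "m \<ge> 3" "2 / (m - 1) \<le> 1" "3 ^ n * (2 / (m - 1)) < 1"
  proof -
    have 3: "3 ^ n \<ge> (1::real)" by simp
    then have m1: "m - 1 > 0" unfolding m_def by linarith
    show "m \<ge> 3" using 3 unfolding m_def by linarith
    have "2 * 3 ^ n < m - 1" by (simp add: m_def)
    then show "3 ^ n * (2 / (m - 1)) < 1" using m1 by (simp add: pos_divide_less_eq mult.commute)
    show "2 / (m - 1) \<le> 1" using m1 \<open>m \<ge> 3\<close> by simp
  qed
  have al_small: "\<forall>\<^sub>F k in sequentially. norm (al j k) \<le> 2 / (m - 1)"
    if "j < n" and ev: "\<forall>\<^sub>F k in sequentially. norm (al (Suc j) k) \<le> 1" for j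
  proof (rule eventually_contraction[OF _ m(1)])
    show "\<forall>\<^sub>F k in sequentially. norm (al j (Suc k)) \<le> (norm (al j k) + 1) / m"
      using assms ev
    proof eventually_elim
      case (elim k)
      have "norm (1 + e k) \<ge> norm (e k) - 1"
        using norm_diff_ineq[of "e k" 1] by (simp add: add.commute)
      then have "m \<le> norm (1 + e k)" using elim by (simp add: m_def)
      then have "m * norm (al j (Suc k)) \<le> norm (1 + e k) * norm (al j (Suc k))"
        by (intro mult_right_mono) auto
      also have "\<dots> = norm (al (Suc j) k + al j k)"
        using al_Suc[OF \<open>j < n\<close>, of k] by (simp flip: norm_mult)
      also have "\<dots> \<le> norm (al j k) + 1"
        using norm_triangle_ineq[of "al (Suc j) k" "al j k"] elim by simp
      finally show ?case using m by (simp add: pos_le_divide_eq mult.commute)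
    qed
  qed
  have le1: "\<forall>\<^sub>F k in sequentially. norm (al j k) \<le> 1" if "j \<le> n" for j
    using that
  proof (induction rule: inc_induct)
    case (step i)
    from \<open>i < n\<close> and step.IH have "\<forall>\<^sub>F k in sequentially. norm (al i k) \<le> 2 / (m - 1)"
      by (rule al_small)
    then show ?case by eventually_elim (use m(2) in linarith)
  qed (simp add: al_n)
  have "\<forall>\<^sub>F k in sequentially. norm (be j k) \<le> 3 ^ j * (2 / (m - 1))" if "j \<le> n" for j
    using that
  proof (induction j)
    case (Suc j)
    then have j: "j < n" by simp
    have a: "\<forall>\<^sub>F k in sequentially. norm (al j k) \<le> 2 / (m - 1)"
      using j by (intro al_small le1) auto
    have b: "\<forall>\<^sub>F k in sequentially. norm (be j k) \<le> 3 ^ j * (2 / (m - 1))"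
      using Suc by simp
    have "\<forall>\<^sub>F k in sequentially. norm (al j (Suc k)) \<le> 2 / (m - 1)"
      "\<forall>\<^sub>F k in sequentially. norm (be j (Suc k)) \<le> 3 ^ j * (2 / (m - 1))"
      by (rule eventually_sequentially_Suc[THEN iffD2, OF a])
        (rule eventually_sequentially_Suc[THEN iffD2, OF b])
    with b show ?case
    proof eventually_elim
      case (elim k)
      have "norm (be (Suc j) k) \<le> norm (al j (Suc k)) + norm (be j (Suc k)) + norm (be j k)"
        unfolding be_Suc[OF j] by (rule order_trans[OF norm_triangle_ineq4]) (auto intro: norm_triangle_ineq)
      also have "\<dots> \<le> 1 * (2 / (m - 1)) + 3 ^ j * (2 / (m - 1)) + 3 ^ j * (2 / (m - 1))"
        using elim by simp
      also have "\<dots> \<le> 3 ^ j * (2 / (m - 1)) + 3 ^ j * (2 / (m - 1)) + 3 ^ j * (2 / (m - 1))"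
        using m by (intro add_right_mono mult_right_mono) auto
      finally show ?case by simp
    qed
  qed (use m(1) in \<open>simp add: be_0\<close>)
  from this[of n] have "\<forall>\<^sub>F k in sequentially. (1::real) \<le> 3 ^ n * (2 / (m - 1))" by (simp add: be_n)
  then show False using m(3) by (auto simp: eventually_sequentially)
qed

text \<open>The same descent in \<open>j\<close>, now with \<open>|1 + e k|\<close> merely close to
  1: each level may grow slightly faster than the one above it. The midpoint \<open>\<mu>\<close> of
  1 and \<open>\<kappa>\<close> leaves room for that.\<close>

lemma al_subexponential:
  assumes "e \<longlonglongrightarrow> 0" "j \<le> n" "\<kappa> > 1"
  shows "\<exists>C>0. \<forall>\<^sub>F k in sequentially. norm (al j k) \<le> C * \<kappa> ^ k"
  using assms(2,3)
proof (induction arbitrary: \<kappa> rule: inc_induct)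
  case base
  then show ?case by (intro exI[of _ 1]) (simp add: al_n)
next
  case (step i)
  define \<mu> where "\<mu> = (1 + \<kappa>) / 2"
  have \<mu>: "1 < \<mu>" "\<mu> < \<kappa>" using step.prems by (auto simp: \<mu>_def)
  from step.IH[OF \<mu>(1)] obtain C where C: "C > 0"
    and Cev: "\<forall>\<^sub>F k in sequentially. norm (al (Suc i) k) \<le> C * \<mu> ^ k" by blast
  have "(\<lambda>k. norm (1 + e k)) \<longlonglongrightarrow> norm (1 + 0 :: complex)"
    by (intro tendsto_intros assms(1))
  moreover have "1 / \<mu> < norm (1 + 0 :: complex)" using \<mu> by simp
  ultimately have "\<forall>\<^sub>F k in sequentially. 1 / \<mu> < norm (1 + e k)" by (rule order_tendstoD(1))
  with Cev obtain k0 where k0: "\<And>k. k \<ge> k0 \<Longrightarrow> 1 / \<mu> < norm (1 + e k) \<and> norm (al (Suc i) k) \<le> C * \<mu> ^ k"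
    using eventually_conj unfolding eventually_sequentially by (smt (verit) nle_le order_trans)
  \<comment> \<open>\<open>D\<close> dominates the initial value, and its second summand closes the
    induction through \<open>\<mu> * (C + D) <= D * \<kappa>\<close>.\<close>
  define D where "D = norm (al i k0) + \<mu> * C / (\<kappa> - \<mu>)"
  have D: "D > 0" "norm (al i k0) \<le> D" "\<mu> * C / (\<kappa> - \<mu>) \<le> D" using C \<mu> by (auto simp: D_def add_nonneg_pos)
  then have D': "\<mu> * C \<le> D * (\<kappa> - \<mu>)" using \<mu> by (simp add: pos_divide_le_eq)
  have "norm (al i k) \<le> D * \<kappa> ^ k" if "k \<ge> k0" for k
    using that
  proof (induction k rule: dec_induct)
    case base
    have "D * 1 \<le> D * \<kappa> ^ k0" using D step.prems by (intro mult_left_mono) auto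
    then show ?case using D by linarith
  next
    case (step k)
    have "norm (al i (Suc k)) * (1 / \<mu>) \<le> norm (al i (Suc k)) * norm (1 + e k)"
      using k0[OF step(1)] by (intro mult_left_mono) auto
    also have "\<dots> = norm (al (Suc i) k + al i k)"
      using al_Suc[OF \<open>i < n\<close>, of k] by (simp add: mult.commute flip: norm_mult)
    also have "\<dots> \<le> C * \<mu> ^ k + D * \<kappa> ^ k"
      using norm_triangle_ineq[of "al (Suc i) k" "al i k"] k0[OF step(1)] step by linarith
    finally have "norm (al i (Suc k)) \<le> \<mu> * (C * \<mu> ^ k + D * \<kappa> ^ k)" using \<mu> by (simp add: field_simps)
    also have "\<dots> \<le> \<mu> * (C * \<kappa> ^ k + D * \<kappa> ^ k)"
      using \<mu> C by (intro mult_left_mono add_right_mono power_mono) auto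
    also have "\<dots> = (\<mu> * C + \<mu> * D) * \<kappa> ^ k" by (simp add: algebra_simps)
    also have "\<dots> \<le> (D * (\<kappa> - \<mu>) + \<mu> * D) * \<kappa> ^ k"
      using D' \<mu> by (intro mult_right_mono) auto
    finally show ?case by (simp add: algebra_simps)
  qed
  then show ?case using D(1) by (auto simp: eventually_sequentially)
qed

text \<open>The decay of \<open>e\<close> beats the growth of \<open>al\<close>, so up to null
  sequences \<open>al (Suc j)\<close> is the difference of \<open>al j\<close>, and, by induction,
  \<open>be (Suc j) k\<close> is \<open>Suc j * al j (Suc k)\<close>. For \<open>j = n - 1\<close>
  the second statement lets \<open>al (n - 1)\<close> converge to \<open>1 / n\<close>, while by the
  first its differences tend to \<open>al n = 1\<close>.\<close>

lemma not_geometric: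
  assumes e: "\<forall>\<^sub>F k in sequentially. norm (e k) \<le> C * \<theta> ^ k" and \<theta>: "0 < \<theta>" "\<theta> < 1"
  shows False
proof -
  have geo: "(\<lambda>k. K * q ^ k) \<longlonglongrightarrow> 0" if "0 \<le> q" "q < 1" for K q :: real
    using tendsto_mult[OF tendsto_const[of K] LIMSEQ_realpow_zero[OF that]] by simp
  have e0: "e \<longlonglongrightarrow> 0"
    by (rule Lim_null_comparison[OF e geo]) (use \<theta> in auto)
  have small: "(\<lambda>k. e k * al j (Suc k)) \<longlonglongrightarrow> 0" if "j < n" for j
  proof -
    \<comment> \<open>Chosen so that \<open>\<theta> * \<kappa> = sqrt \<theta> < 1\<close>.\<close>
    define \<kappa> where "\<kappa> = 1 / sqrt \<theta>"
    have sq: "sqrt \<theta> < 1" "sqrt \<theta> > 0" using \<theta> by auto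
    then have "\<kappa> > 1" by (simp add: \<kappa>_def)
    have \<kappa>\<theta>: "\<theta> * \<kappa> = sqrt \<theta>" using \<theta> by (simp add: \<kappa>_def real_div_sqrt)
    from al_subexponential[OF e0 _ \<open>\<kappa> > 1\<close>, of j] that obtain D where D: "D > 0"
      "\<forall>\<^sub>F k in sequentially. norm (al j k) \<le> D * \<kappa> ^ k" by auto
    from D(2) have "\<forall>\<^sub>F k in sequentially. norm (al j (Suc k)) \<le> D * \<kappa> ^ Suc k"
      by (rule eventually_sequentially_Suc[THEN iffD2])
    with e have "\<forall>\<^sub>F k in sequentially. norm (e k * al j (Suc k)) \<le> (C * D * \<kappa>) * sqrt \<theta> ^ k"
    proof eventually_elim
      case (elim k)
      have "norm (e k * al j (Suc k)) \<le> (C * \<theta> ^ k) * (D * \<kappa> ^ Suc k)"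
        unfolding norm_mult using elim order_trans[OF norm_ge_zero elim(1)] by (intro mult_mono) auto
      also have "\<dots> = (C * D * \<kappa>) * (\<theta> * \<kappa>) ^ k" by (simp add: power_mult_distrib)
      finally show ?case by (simp only: \<kappa>\<theta>)
    qed
    then show ?thesis by (rule Lim_null_comparison[OF _ geo]) (use sq in auto)
  qed
  have dal: "(\<lambda>k. al j (Suc k) - al j k - al (Suc j) k) \<longlonglongrightarrow> 0" if "j < n" for j
  proof -
    have "al j (Suc k) - al j k - al (Suc j) k = - (e k * al j (Suc k))" for k
      unfolding al_Suc[OF that] by (simp add: algebra_simps)
    then show ?thesis using tendsto_minus[OF small[OF that]] by simp
  qed
  have be_al: "(\<lambda>k. be (Suc j) k - of_nat (Suc j) * al j (Suc k)) \<longlonglongrightarrow> 0" if "j < n" for j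
    using that
  proof (induction j)
    case 0
    then show ?case by (simp add: be_Suc be_0)
  next
    case (Suc j)
    then have j: "j < n" and lim: "(\<lambda>k. be (Suc j) k - of_nat (Suc j) * al j (Suc k)) \<longlonglongrightarrow> 0" by auto
    have "(\<lambda>k. (be (Suc j) (Suc k) - of_nat (Suc j) * al j (Suc (Suc k)))
        - (be (Suc j) k - of_nat (Suc j) * al j (Suc k))
        + of_nat (Suc j) * (al j (Suc (Suc k)) - al j (Suc k) - al (Suc j) (Suc k))) \<longlonglongrightarrow> 0 - 0 + of_nat (Suc j) * 0"
      by (intro tendsto_add tendsto_diff tendsto_mult tendsto_const lim LIMSEQ_Suc[OF lim] LIMSEQ_Suc[OF dal[OF j]])
    moreover have "be (Suc (Suc j)) k - of_nat (Suc (Suc j)) * al (Suc j) (Suc k) =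
        (be (Suc j) (Suc k) - of_nat (Suc j) * al j (Suc (Suc k)))
        - (be (Suc j) k - of_nat (Suc j) * al j (Suc k))
        + of_nat (Suc j) * (al j (Suc (Suc k)) - al j (Suc k) - al (Suc j) (Suc k))" for k
      unfolding be_Suc[OF Suc.prems] by (simp add: algebra_simps)
    ultimately show ?case by simp
  qed
  obtain p where p: "n = Suc p" using n by (cases n) auto
  have "(\<lambda>k. of_nat n * al p (Suc k)) \<longlonglongrightarrow> 1 - 0"
    using tendsto_diff[OF tendsto_const[of 1] be_al[of p]] p be_n by simp
  then have lim: "(\<lambda>k. of_nat n * al p (Suc k)) \<longlonglongrightarrow> 1" by simp
  have "(\<lambda>k. of_nat n * al p (Suc (Suc k)) - of_nat n * al p (Suc k)
      - of_nat n * (al p (Suc (Suc k)) - al p (Suc k) - al (Suc p) (Suc k))) \<longlonglongrightarrow> 1 - 1 - of_nat n * 0"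
    by (intro tendsto_diff tendsto_mult tendsto_const lim LIMSEQ_Suc[OF lim] LIMSEQ_Suc[OF dal]) (simp add: p)
  moreover have "of_nat n * al p (Suc (Suc k)) - of_nat n * al p (Suc k)
      - of_nat n * (al p (Suc (Suc k)) - al p (Suc k) - al (Suc p) (Suc k)) = of_nat n" for k
    using al_n[of "Suc k"] by (simp add: p algebra_simps)
  ultimately have "(\<lambda>k. of_nat n :: complex) \<longlonglongrightarrow> 0" by simp
  then show False using n by (simp add: LIMSEQ_const_iff)
qed

end

definition seq_diff :: "(nat \<Rightarrow> complex) \<Rightarrow> nat \<Rightarrow> complex" where
  "seq_diff x k = x (Suc k) - x k"

lemma seq_diff_Suc: "(seq_diff ^^ Suc i) x k = (seq_diff ^^ i) x (Suc k) - (seq_diff ^^ i) x k"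
  by (simp only: funpow.simps o_apply seq_diff_def)

lemma seq_diff_lin:
  "(seq_diff ^^ i) (\<lambda>k. a * x k + b * y k) = (\<lambda>k. a * (seq_diff ^^ i) x k + b * (seq_diff ^^ i) y k)"
  by (induction i) (auto simp: seq_diff_def fun_eq_iff algebra_simps)

lemma seq_diff_zero [simp]: "(seq_diff ^^ i) (\<lambda>k. 0) = (\<lambda>k. 0)"
  by (induction i) (auto simp: seq_diff_def fun_eq_iff)

context difference_chain
begin

text \<open>For constant \<open>e = q\<close> the function \<open>G + b / q\<close> is multiplied by
  \<open>1 + q\<close> under the shift; on the coefficients this reads
  \<open>q * be j = al j - (seq_diff ^^ j) (al 0)\<close>. Level \<open>n\<close> shows that
  \<open>(seq_diff ^^ n) (al 0)\<close> is the constant \<open>1 - q\<close>. The operator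
  \<open>q + (1 + q) * seq_diff\<close> takes \<open>x j\<close> to \<open>x (Suc j)\<close> and is
  injective on sequences killed by \<open>seq_diff ^^ n\<close>. So \<open>x n = 0\<close> descends
  to \<open>x 0 = 0\<close>: the sequence \<open>al 0\<close> is constant and
  \<open>1 - q = 0\<close>.\<close>

lemma const_eq_1:
  assumes "\<And>k. e k = q" and "q \<noteq> 0"
  shows "q = 1"
proof -
  define x where "x = (\<lambda>j. seq_diff (al j))"
  have qbe: "q * be j k = al j k - (seq_diff ^^ j) (al 0) k" if "j \<le> n" for j k
    using that
  proof (induction j arbitrary: k)
    case (Suc j)
    have "q * be (Suc j) k = q * al j (Suc k) + (q * be j (Suc k) - q * be j k)"
      unfolding be_Suc[OF Suc_le_lessD[OF Suc.prems]] by (simp add: algebra_simps)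
    also have "\<dots> = al (Suc j) k - (seq_diff ^^ Suc j) (al 0) k"
    proof -
      have "(seq_diff ^^ Suc j) (al 0) k = (seq_diff ^^ j) (al 0) (Suc k) - (seq_diff ^^ j) (al 0) k"
        by (rule seq_diff_Suc)
      moreover have "q * be j i = al j i - (seq_diff ^^ j) (al 0) i" for i
        using Suc by simp
      moreover have "al (Suc j) k = (1 + q) * al j (Suc k) - al j k"
        using al_Suc[of j k] Suc.prems assms(1) by simp
      ultimately show ?thesis by (simp only:) (simp add: algebra_simps)
    qed
    finally show ?case .
  qed (simp add: be_0)
  have top: "(seq_diff ^^ n) (al 0) = (\<lambda>k. 1 - q)"
  proof
    fix k
    show "(seq_diff ^^ n) (al 0) k = 1 - q" using qbe[of n k] al_n be_n by simp
  qed
  have x_Suc: "x (Suc j) = (\<lambda>k. q * x j k + (1 + q) * seq_diff (x j) k)" if "j < n" for j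
    by (rule ext) (simp add: x_def seq_diff_def al_Suc[OF that] assms(1) algebra_simps)
  have nil: "(seq_diff ^^ n) (x j) = (\<lambda>k. 0)" if "j \<le> n" for j
    using that
  proof (induction j)
    case 0
    have "(seq_diff ^^ n) (x 0) = seq_diff ((seq_diff ^^ n) (al 0))"
      unfolding x_def by (simp flip: funpow_swap1)
    also have "\<dots> = (\<lambda>k. 0)" unfolding top by (rule ext) (simp add: seq_diff_def)
    finally show ?case .
  next
    case (Suc j)
    have "(seq_diff ^^ n) (seq_diff (x j)) = seq_diff ((seq_diff ^^ n) (x j))"
      by (simp flip: funpow_swap1)
    also have "\<dots> = (\<lambda>k. 0)" using Suc seq_diff_zero[of 1] by simp
    finally show ?case using Suc by (simp add: x_Suc seq_diff_lin)
  qed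
  have zero: "x j = (\<lambda>k. 0)" if "j \<le> n" for j
    using that
  proof (induction rule: inc_induct)
    case base
    then show ?case by (simp add: x_def seq_diff_def al_n fun_eq_iff)
  next
    case (step j)
    have eq: "q * x j k = - (1 + q) * seq_diff (x j) k" for k
    proof -
      have "q * x j k + (1 + q) * seq_diff (x j) k = 0"
        using fun_cong[OF x_Suc[OF step(2)], of k] step.IH by simp
      then show ?thesis unfolding eq_neg_iff_add_eq_0 mult_minus_left .
    qed
    \<comment> \<open>Iterating \<open>q * x j = - (1 + q) * seq_diff (x j)\<close> gains one
      difference for each factor \<open>q\<close>, until the \<open>n\<close>-th difference
      vanishes.\<close>
    have pow: "q ^ i * x j k = (- (1 + q)) ^ i * (seq_diff ^^ i) (x j) k" for i k
    proof (induction i arbitrary: k)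
      case (Suc i)
      have "q ^ Suc i * x j k = q ^ i * (- (1 + q) * seq_diff (x j) k)"
        using eq[of k] by simp
      also have "\<dots> = - (1 + q) * (q ^ i * x j (Suc k) - q ^ i * x j k)"
        by (simp add: seq_diff_def algebra_simps)
      also have "\<dots> = (- (1 + q)) ^ Suc i * ((seq_diff ^^ i) (x j) (Suc k) - (seq_diff ^^ i) (x j) k)"
        unfolding Suc by (simp add: algebra_simps)
      finally show ?case unfolding seq_diff_Suc .
    qed simp
    have "q ^ n * x j k = 0" for k using pow[of n k] nil[of j] step by simp
    then show ?case using assms(2) by auto
  qed
  obtain p where p: "n = Suc p" using n by (cases n) auto
  have "(seq_diff ^^ n) (al 0) = (seq_diff ^^ p) (x 0)"
    unfolding p x_def by (simp add: funpow_swap1)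
  then have "1 - q = 0" using top zero[of 0] by (simp add: fun_eq_iff)
  then show ?thesis by simp
qed

end

section \<open>Polynomials\<close>

lemma Re_poly_of_real:
  "\<exists>q :: real poly. \<forall>x. poly q x = Re (poly Q (complex_of_real x))"
proof (induction Q)
  case (pCons a Q)
  then obtain q where "\<forall>x. poly q x = Re (poly Q (complex_of_real x))" by blast
  then show ?case by (intro exI[of _ "pCons (Re a) q"]) simp
qed (intro exI[of _ 0], simp)

lemma Re_poly_chain:
  obtains q :: "real poly" where "\<And>k::nat. poly q (real k) = Re (poly P (z + of_nat k * c))"
proof -
  obtain q where "\<forall>x. poly q x = Re (poly (pcompose P [:z, c:]) (complex_of_real x))"
    using Re_poly_of_real by blast
  then show ?thesis using that[of q] by (simp add: poly_pcompose mult.commute)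
qed

lemma poly_at_least_linear:
  fixes q :: "real poly"
  assumes "degree q > 0" "lead_coeff q > 0"
  obtains A \<delta> where "\<delta> > 0" "\<forall>\<^sub>F k in sequentially. poly q (real k) \<ge> A + \<delta> * real k"
proof -
  obtain a p where q: "q = pCons a p" by (cases q) auto
  then have p: "p \<noteq> 0" "lead_coeff p = lead_coeff q" using assms(1) by (auto split: if_splits)
  with assms have "lead_coeff p > 0" by simp
  from poly_pinfty_gt_lc[OF this] obtain x0 where x0: "\<forall>x\<ge>x0. lead_coeff p \<le> poly p x" by blast
  have "\<forall>\<^sub>F k in sequentially. poly q (real k) \<ge> a + lead_coeff p * real k"
    using eventually_ge_at_top[of "nat \<lceil>x0\<rceil>"]
  proof eventually_elim
    case (elim k)
    then have "lead_coeff p \<le> poly p (real k)" using x0 by (simp add: nat_ceiling_le_eq)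
    then show ?case by (simp add: q mult.commute mult_left_mono)
  qed
  then show ?thesis using that \<open>lead_coeff p > 0\<close> by blast
qed

text \<open>Meant for the logarithm of \<open>|exp (poly P (z + k * c))|\<close> as a polynomial in
  \<open>k\<close>: the modulus is then constant, or grows or decays at least geometrically.\<close>

lemma real_poly_trichotomy:
  fixes q :: "real poly"
  obtains (const) a where "\<And>k::nat. poly q (real k) = a"
  | (pos) A \<delta> where "\<delta> > 0" "\<forall>\<^sub>F k in sequentially. poly q (real k) \<ge> A + \<delta> * real k"
  | (neg) A \<delta> where "\<delta> > 0" "\<forall>\<^sub>F k in sequentially. poly q (real k) \<le> A - \<delta> * real k"
proof (cases "degree q = 0")
  case True
  then obtain a where "q = [:a:]" by (rule degree_eq_zeroE)
  then show ?thesis using const[of a] by simp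
next
  case False
  then have deg: "degree q > 0" and nz: "lead_coeff q \<noteq> 0" by auto
  show ?thesis
  proof (cases "lead_coeff q > 0")
    case True
    obtain A \<delta> where "\<delta> > 0" "\<forall>\<^sub>F k in sequentially. poly q (real k) \<ge> A + \<delta> * real k"
      by (rule poly_at_least_linear[OF deg True])
    then show ?thesis by (rule pos)
  next
    case False
    then have "lead_coeff q < 0" using nz by linarith
    then have lc: "lead_coeff (- q) > 0" by simp
    have "degree (- q) > 0" using deg by simp
    obtain A \<delta> where \<delta>: "\<delta> > 0" "\<forall>\<^sub>F k in sequentially. poly (- q) (real k) \<ge> A + \<delta> * real k"
      by (rule poly_at_least_linear[OF \<open>degree (- q) > 0\<close> lc])
    from \<delta>(2) have "\<forall>\<^sub>F k in sequentially. poly q (real k) \<le> - A - \<delta> * real k"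
      by eventually_elim simp
    with \<delta>(1) show ?thesis by (rule neg)
  qed
qed

text \<open>The moduli of the roots of \<open>P - w\<close> have product
  \<open>|poly P 0 - w| / |lead_coeff P|\<close>, so they cannot all exceed
  \<open>x\<close>.\<close>

lemma poly_root_in_disc:
  fixes P :: "complex poly"
  assumes "degree P > 0" "x > 0" "norm (poly P 0 - w) \<le> norm (lead_coeff P) * x ^ degree P"
  shows "\<exists>z. norm z \<le> x \<and> poly P z = w"
proof (rule ccontr)
  assume no: "\<not> ?thesis"
  define Q where "Q = P + [:- w:]"
  have deg: "degree Q = degree P" unfolding Q_def by (rule degree_add_eq_left) (use assms(1) in simp)
  have lc: "lead_coeff Q = lead_coeff P"
    unfolding deg using assms(1) by (simp add: Q_def coeff_pCons split: nat.splits)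
  obtain root where root: "smult (lead_coeff Q) (\<Prod>i<degree Q. [:-root i, 1:]) = Q"
    by (rule complex_poly_decompose')
  have ev: "poly Q z = lead_coeff Q * (\<Prod>i<degree Q. z - root i)" for z
    by (subst root[symmetric]) (simp add: poly_prod)
  have big: "norm (root i) > x" if "i < degree Q" for i
  proof -
    have "poly Q (root i) = 0" unfolding ev using that by auto
    then have "poly P (root i) = w" by (simp add: Q_def)
    then show ?thesis using no by force
  qed
  have "0 < degree Q" using assms(1) deg by simp
  have "(\<Prod>i<degree Q. x) < (\<Prod>i<degree Q. norm (root i))"
  proof (rule prod_mono_strict[of 0])
    show "norm (root i) > 0" if "i \<in> {..<degree Q}" for i
    proof -
      have "x < norm (root i)" by (rule big) (use that in simp)
      then show ?thesis using assms(2) by linarith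
    qed
  qed (use big assms(2) \<open>0 < degree Q\<close> in \<open>auto intro: less_imp_le\<close>)
  then have "x ^ degree P < (\<Prod>i<degree Q. norm (root i))" by (simp add: deg)
  moreover have "norm (poly P 0 - w) = norm (lead_coeff P) * (\<Prod>i<degree Q. norm (root i))"
  proof -
    have "poly P 0 - w = poly Q 0" by (simp add: Q_def)
    also have "\<dots> = lead_coeff P * (\<Prod>i<degree Q. 0 - root i)" using ev[of 0] lc by simp
    finally show ?thesis by (simp add: norm_mult flip: prod_norm)
  qed
  moreover have "norm (lead_coeff P) > 0" using assms(1) by auto
  ultimately have "norm (lead_coeff P) * x ^ degree P < norm (poly P 0 - w)" by simp
  then show False using assms(3) by simp
qed

lemma norm_poly_le:
  fixes P :: "complex poly"
  obtains C where "C > 0" "\<And>z x. norm z \<le> x \<Longrightarrow> x \<ge> 1 \<Longrightarrow> norm (poly P z) \<le> C * x ^ degree P"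
proof -
  define C where "C = 1 + (\<Sum>i\<le>degree P. norm (coeff P i))"
  have "norm (poly P z) \<le> C * x ^ degree P" if "norm z \<le> x" "x \<ge> 1" for z x
  proof -
    have "norm (poly P z) \<le> (\<Sum>i\<le>degree P. norm (coeff P i * z ^ i))"
      unfolding poly_altdef by (rule norm_sum)
    also have "\<dots> \<le> (\<Sum>i\<le>degree P. norm (coeff P i) * x ^ degree P)"
    proof (rule sum_mono)
      fix i assume "i \<in> {..degree P}"
      then have "norm z ^ i \<le> x ^ degree P"
        using that by (meson atMost_iff norm_ge_zero order_trans power_increasing power_mono)
      then show "norm (coeff P i * z ^ i) \<le> norm (coeff P i) * x ^ degree P"
        by (simp add: norm_mult norm_power mult_left_mono)
    qed
    also have "\<dots> \<le> C * x ^ degree P"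
      using that by (simp add: C_def sum_distrib_right distrib_right)
    finally show ?thesis .
  qed
  moreover have "C > 0" by (simp add: C_def add_pos_nonneg sum_nonneg)
  ultimately show ?thesis using that by blast
qed

text \<open>An upper bound for \<open>Re w\<close> along an unbounded set of radii is enough:
  Borel-Caratheodory makes \<open>|w - w 0|\<close> on the half disc at most a multiple of
  \<open>r ^ K\<close>, and Cauchy's estimates for the derivatives at 0 of order above
  \<open>K\<close> tend to 0.\<close>

lemma entire_polynomial:
  fixes w :: "complex \<Rightarrow> complex"
  assumes w: "w holomorphic_on UNIV"
    and freq: "\<And>N. \<exists>r\<ge>N. \<forall>z. norm z \<le> r \<longrightarrow> Re (w z) \<le> r ^ K"
  obtains P where "w = poly P"
proof -
  have der0: "(deriv ^^ j) w 0 = 0" if "j > K" for j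
  proof (rule ccontr)
    assume ne: "(deriv ^^ j) w 0 \<noteq> 0"
    \<comment> \<open>As \<open>r ^ K >= 1\<close>, this choice lets \<open>r ^ K * A\<close> exceed
      \<open>r ^ K - Re (w 0)\<close> strictly.\<close>
    define A where "A = norm (w 0) + 2"
    have "\<exists>r>0. r * norm ((deriv ^^ j) w 0) > fact j * 2 ^ Suc j * A \<and> r \<ge> 1 \<and> (\<forall>z. norm z \<le> r \<longrightarrow> Re (w z) \<le> r ^ K)"
    proof -
      obtain r where r: "r \<ge> max 1 (fact j * 2 ^ Suc j * A / norm ((deriv ^^ j) w 0) + 1)"
        "\<forall>z. norm z \<le> r \<longrightarrow> Re (w z) \<le> r ^ K" using freq by blast
      then have "fact j * 2 ^ Suc j * A / norm ((deriv ^^ j) w 0) < r" by simp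
      then show ?thesis using r ne by (intro exI[of _ r]) (auto simp: pos_divide_less_eq)
    qed
    then obtain r where r: "r > 0" "r * norm ((deriv ^^ j) w 0) > fact j * 2 ^ Suc j * A" "r \<ge> 1"
      "\<And>z. norm z \<le> r \<Longrightarrow> Re (w z) \<le> r ^ K" by blast
    have bnd: "norm (w z - w 0) \<le> 2 * (r ^ K * A)" if "norm z \<le> r / 2" for z
    proof -
      have "norm (w z - w 0) \<le> 2 * (r ^ K * A) * (r / 2) / (r - r / 2)"
      proof (rule borel_caratheodory[of w 0 r "r ^ K * A" z "r / 2"])
        show "w holomorphic_on ball 0 r" using w holomorphic_on_subset by blast
        fix y :: complex assume "y \<in> ball 0 r"
        then have "Re (w y) \<le> r ^ K" using r(4)[of y] by simp
        moreover have "- Re (w 0) \<le> norm (w 0)" using abs_Re_le_cmod[of "w 0"] by simp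
        moreover have "norm (w 0) \<le> r ^ K * norm (w 0)" "1 \<le> r ^ K"
          using r(3) mult_right_mono[of 1 "r ^ K" "norm (w 0)"] by auto
        ultimately show "Re (w y) < r ^ K * A + Re (w 0)" by (simp add: A_def algebra_simps)
      qed (use that r in auto)
      then show ?thesis using r by simp
    qed
    have "norm ((deriv ^^ j) (\<lambda>z. w z - w 0) 0) \<le> fact j * (2 * (r ^ K * A)) / (r / 2) ^ j"
    proof (rule Cauchy_inequality)
      show "(\<lambda>z. w z - w 0) holomorphic_on ball 0 (r / 2)"
        by (intro holomorphic_intros holomorphic_on_subset[OF w]) auto
      show "continuous_on (cball 0 (r / 2)) (\<lambda>z. w z - w 0)"
        by (intro continuous_intros holomorphic_on_imp_continuous_on holomorphic_on_subset[OF w]) auto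
    qed (use r bnd in auto)
    moreover have "(deriv ^^ j) (\<lambda>z. w z - w 0) 0 = (deriv ^^ j) w 0"
      using that by (subst higher_deriv_diff[OF w]) (auto simp: higher_deriv_const)
    ultimately have "norm ((deriv ^^ j) w 0) \<le> fact j * (2 * (r ^ K * A)) / (r / 2) ^ j" by simp
    also have "\<dots> = fact j * 2 ^ Suc j * A * r ^ K / r ^ j"
      by (simp add: power_divide)
    also have "\<dots> \<le> fact j * 2 ^ Suc j * A / r"
    proof -
      have "r ^ K * r \<le> r ^ j" using r(3) that power_increasing[of "Suc K" j r] by (simp add: mult.commute)
      then have "r ^ K / r ^ j \<le> 1 / r" using r(1) by (simp add: field_simps)
      then have "fact j * 2 ^ Suc j * A * (r ^ K / r ^ j) \<le> fact j * 2 ^ Suc j * A * (1 / r)"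
        by (intro mult_left_mono) (auto simp: A_def)
      then show ?thesis by simp
    qed
    finally show False using r(1,2) by (simp add: field_simps)
  qed
  define P where "P = (\<Sum>k\<le>K. monom ((deriv ^^ k) w 0 / fact k) k)"
  have "w z = poly P z" for z
  proof -
    have "((\<lambda>n. (deriv ^^ n) w 0 / fact n * (z - 0) ^ n) sums w z)"
      by (rule holomorphic_power_series[of _ _ "norm z + 1"])
        (use w holomorphic_on_subset in auto)
    moreover have "((\<lambda>n. (deriv ^^ n) w 0 / fact n * (z - 0) ^ n) sums (\<Sum>n\<le>K. (deriv ^^ n) w 0 / fact n * (z - 0) ^ n))"
      by (rule sums_finite) (auto simp: der0)
    ultimately show ?thesis by (simp add: sums_unique2 P_def poly_sum poly_monom)
  qed
  then show ?thesis using that[of P] by auto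
qed

section \<open>Radii that keep away from finitely many given ones\<close>

text \<open>The truncated square roots form an antiderivative that is continuous across the
  singularity at \<open>r = x\<close>.\<close>

lemma has_integral_inverse_sqrt_dist:
  fixes x :: real
  assumes "a \<le> b"
  shows "((\<lambda>r. 1 / sqrt \<bar>r - x\<bar>) has_integral
    2 * (sqrt (max 0 (b - x)) - sqrt (max 0 (x - b))) - 2 * (sqrt (max 0 (a - x)) - sqrt (max 0 (x - a)))) {a..b}"
proof (rule fundamental_theorem_of_calculus_interior_strong[of "{x}"])
  show "continuous_on {a..b} (\<lambda>r. 2 * (sqrt (max 0 (r - x)) - sqrt (max 0 (x - r))))"
    by (intro continuous_intros)
  fix r assume "r \<in> {a<..<b} - {x}"
  then consider "r > x" | "r < x" by force
  then show "((\<lambda>r. 2 * (sqrt (max 0 (r - x)) - sqrt (max 0 (x - r)))) has_vector_derivative 1 / sqrt \<bar>r - x\<bar>) (at r)"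
    unfolding has_real_derivative_iff_has_vector_derivative[symmetric]
  proof cases
    case 1
    have "((\<lambda>r. 2 * sqrt (r - x)) has_real_derivative 1 / sqrt \<bar>r - x\<bar>) (at r)"
      using 1 by (auto intro!: derivative_eq_intros simp: field_simps)
    then show "((\<lambda>r. 2 * (sqrt (max 0 (r - x)) - sqrt (max 0 (x - r)))) has_real_derivative 1 / sqrt \<bar>r - x\<bar>) (at r)"
      by (rule has_field_derivative_transform_within_open[of _ _ _ "{x<..}"]) (use 1 in auto)
  next
    case 2
    have "((\<lambda>r. - 2 * sqrt (x - r)) has_real_derivative 1 / sqrt \<bar>r - x\<bar>) (at r)"
      using 2 by (auto intro!: derivative_eq_intros simp: field_simps)
    then show "((\<lambda>r. 2 * (sqrt (max 0 (r - x)) - sqrt (max 0 (x - r)))) has_real_derivative 1 / sqrt \<bar>r - x\<bar>) (at r)"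
      by (rule has_field_derivative_transform_within_open[of _ _ _ "{..<x}"]) (use 2 in auto)
  qed
qed (use assms in auto)

text \<open>Averaging: each summand has integral at most \<open>4 * sqrt \<rho>\<close> over an
  interval of length \<open>\<rho>\<close>, hence mean at most \<open>4 / sqrt \<rho>\<close>. The
  larger constant 6 makes the comparison strict, so that suitable radii remain after a countable set
  is removed.\<close>

lemma good_radius:
  fixes xs :: "real list"
  assumes "\<rho> > 0" "countable X"
  obtains r where "\<rho> \<le> r" "r \<le> 2 * \<rho>" "r \<notin> X" "r \<notin> set xs"
    "(\<Sum>x\<leftarrow>xs. 1 / sqrt \<bar>r - x\<bar>) \<le> 6 * length xs / sqrt \<rho>"
proof (cases "xs = []")
  case True
  have "uncountable {\<rho>..2 * \<rho>}" using assms(1) by (simp add: uncountable_closed_interval)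
  then have "\<not> {\<rho>..2 * \<rho>} \<subseteq> X" using assms(2) countable_subset by blast
  then obtain r where "r \<in> {\<rho>..2 * \<rho>}" "r \<notin> X" by blast
  then show ?thesis using that[of r] True by auto
next
  case False
  define I where "I = (\<lambda>x. 2 * (sqrt (max 0 (2 * \<rho> - x)) - sqrt (max 0 (x - 2 * \<rho>)))
      - 2 * (sqrt (max 0 (\<rho> - x)) - sqrt (max 0 (x - \<rho>))))"
  have I: "I x \<le> 4 * sqrt \<rho>" for x
  proof -
    consider "x \<le> \<rho>" | "\<rho> < x" "x < 2 * \<rho>" | "x \<ge> 2 * \<rho>" by linarith
    then show ?thesis
    proof cases
      case 1
      have "sqrt (\<rho> + (\<rho> - x)) \<le> sqrt \<rho> + sqrt (\<rho> - x)" using 1 assms(1) by (intro sqrt_add_le_add_sqrt) auto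
      moreover have "sqrt \<rho> \<ge> 0" using assms(1) by simp
      moreover have "I x = 2 * sqrt (\<rho> + (\<rho> - x)) - 2 * sqrt (\<rho> - x)" using 1 assms(1) by (simp add: I_def)
      ultimately show ?thesis by linarith
    next
      case 2
      have "sqrt (2 * \<rho> - x) \<le> sqrt \<rho>" "sqrt (x - \<rho>) \<le> sqrt \<rho>" using 2 by auto
      moreover have "I x = 2 * sqrt (2 * \<rho> - x) + 2 * sqrt (x - \<rho>)" using 2 by (simp add: I_def)
      ultimately show ?thesis by linarith
    next
      case 3
      have "sqrt (\<rho> + (x - 2 * \<rho>)) \<le> sqrt \<rho> + sqrt (x - 2 * \<rho>)" using 3 assms(1) by (intro sqrt_add_le_add_sqrt) auto
      moreover have "sqrt \<rho> \<ge> 0" using assms(1) by simp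
      moreover have "I x = 2 * sqrt (\<rho> + (x - 2 * \<rho>)) - 2 * sqrt (x - 2 * \<rho>)" using 3 assms(1) by (simp add: I_def)
      ultimately show ?thesis by linarith
    qed
  qed
  define \<phi> where "\<phi> = (\<lambda>r. \<Sum>x\<leftarrow>xs. 1 / sqrt \<bar>r - x\<bar>)"
  have int: "((\<lambda>r. \<Sum>x\<leftarrow>ys. 1 / sqrt \<bar>r - x\<bar>) has_integral (\<Sum>x\<leftarrow>ys. I x)) {\<rho>..2 * \<rho>}" for ys
  proof (induction ys)
    case (Cons y ys)
    have "((\<lambda>r. 1 / sqrt \<bar>r - y\<bar>) has_integral I y) {\<rho>..2 * \<rho>}"
      unfolding I_def by (rule has_integral_inverse_sqrt_dist) (use assms(1) in simp)
    from has_integral_add[OF this Cons.IH] show ?case by simp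
  qed simp
  have sumI: "(\<Sum>x\<leftarrow>ys. I x) \<le> length ys * (4 * sqrt \<rho>)" for ys
    by (induction ys) (use I in \<open>auto simp: algebra_simps intro: add_mono\<close>)
  define T where "T = 6 * length xs / sqrt \<rho>"
  define Y where "Y = X \<union> set xs"
  note goal = that
  have "countable Y" using assms(2) by (auto simp: Y_def intro: countable_finite)
  show ?thesis
  proof (rule ccontr)
    assume "\<not> thesis"
    then have big: "\<phi> r \<ge> T" if "\<rho> \<le> r" "r \<le> 2 * \<rho>" "r \<notin> Y" for r
      using goal[of r] that unfolding \<phi>_def T_def Y_def by force
    \<comment> \<open>On \<open>Y\<close>, which contains the points where a summand is
      \<open>1 / 0 = 0\<close>, no lower bound is available; altering the values on this null set
      leaves the integral unchanged.\<close>
    define \<psi> where "\<psi> = (\<lambda>r. if r \<in> Y then T else \<phi> r)"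
    have int1: "(\<psi> has_integral (\<Sum>x\<leftarrow>xs. I x)) {\<rho>..2 * \<rho>}"
    proof (rule has_integral_spike)
      show "negligible Y" using \<open>countable Y\<close> by (simp add: negligible_iff_null_sets countable_imp_null_set_lborel null_sets_completionI)
      show "(\<phi> has_integral (\<Sum>x\<leftarrow>xs. I x)) {\<rho>..2 * \<rho>}" unfolding \<phi>_def by (rule int)
    qed (auto simp: \<psi>_def)
    have int2: "((\<lambda>r. T) has_integral (2 * \<rho> - \<rho>) * T) {\<rho>..2 * \<rho>}"
      using has_integral_const_real[of T \<rho> "2 * \<rho>"] assms(1) by simp
    have "(2 * \<rho> - \<rho>) * T \<le> (\<Sum>x\<leftarrow>xs. I x)"
      by (rule has_integral_le[OF int2 int1]) (use big in \<open>auto simp: \<psi>_def\<close>)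
    also have "\<dots> \<le> length xs * (4 * sqrt \<rho>)" by (rule sumI)
    finally have "\<rho> * T \<le> length xs * (4 * sqrt \<rho>)" by simp
    moreover have "\<rho> * T = length xs * (6 * sqrt \<rho>)"
    proof -
      have "\<rho> * T = length xs * (6 * (\<rho> / sqrt \<rho>))" by (simp add: T_def)
      also have "\<rho> / sqrt \<rho> = sqrt \<rho>" using assms(1) by (intro real_div_sqrt) simp
      finally show ?thesis .
    qed
    moreover have "length xs * (4 * sqrt \<rho>) < length xs * (6 * sqrt \<rho>)"
      using False assms(1) by (intro mult_strict_left_mono) auto
    ultimately show False by linarith
  qed
qed

section \<open>The Nevanlinna characteristic\<close>

text \<open>The tails of \<open>E\<close> have logarithmic measure tending to 0, whereas the
  interval from \<open>x\<close> to \<open>2 * x\<close> has logarithmic measure at least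
  \<open>x * (1 / (2 * x)) = 1 / 2\<close>.\<close>

lemma avoid_exceptional_set:
  assumes "finite_log_measure E"
  obtains x0 where "x0 \<ge> 1"
    "\<And>x X. x \<ge> x0 \<Longrightarrow> countable X \<Longrightarrow> \<exists>r. x \<le> r \<and> r \<le> 2 * x \<and> r \<notin> E \<and> r \<notin> X"
proof -
  have E: "E \<in> sets lebesgue" and fin: "(\<integral>\<^sup>+ t\<in>E. ennreal (1 / t) \<partial>lebesgue) < \<infinity>"
    using assms by (auto simp: finite_log_measure_def)
  define g where "g = (\<lambda>t. ennreal (1 / t) * indicator E t)"
  have "(\<lambda>t. ennreal (1 / t)) \<in> borel_measurable lebesgue"
    by (rule measurable_completion) measurable
  then have g: "g \<in> borel_measurable lebesgue"
    unfolding g_def by (intro borel_measurable_times_ennreal borel_measurable_indicator E)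
  define N where "N = density lebesgue g"
  have emN: "emeasure N A = (\<integral>\<^sup>+ t. g t * indicator A t \<partial>lebesgue)" if "A \<in> sets lebesgue" for A
    unfolding N_def using g that by (rule emeasure_density)
  have finN: "emeasure N A \<noteq> \<infinity>" if "A \<in> sets lebesgue" for A
  proof -
    have "emeasure N A \<le> (\<integral>\<^sup>+ t. g t \<partial>lebesgue)"
      unfolding emN[OF that] by (intro nn_integral_mono) (auto simp: indicator_def)
    then show ?thesis using fin unfolding g_def by (simp add: less_top top.extremum_unique order_le_less_trans)
  qed
  have "(\<lambda>k. emeasure N {real k..}) \<longlonglongrightarrow> emeasure N (\<Inter>k. {real k..})"
  proof (rule Lim_emeasure_decseq)
    show "range (\<lambda>k. {real k..}) \<subseteq> sets N" by (auto simp: N_def)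
    show "decseq (\<lambda>k. {real k..})" by (auto simp: decseq_def)
    show "emeasure N {real i..} \<noteq> \<infinity>" for i by (rule finN) auto
  qed
  moreover have "(\<Inter>k. {real k..}) = {}"
  proof -
    have "\<exists>k. \<not> real k \<le> x" for x using reals_Archimedean2[of x] by (auto simp: not_le)
    then show ?thesis by auto
  qed
  ultimately have "(\<lambda>k. emeasure N {real k..}) \<longlonglongrightarrow> 0" by simp
  moreover have "ennreal 0 < ennreal (1 / 2)" by (subst ennreal_less_iff) auto
  ultimately have "\<forall>\<^sub>F k in sequentially. emeasure N {real k..} < ennreal (1 / 2)"
    unfolding ennreal_0 by (rule order_tendstoD(2))
  then obtain k where k: "emeasure N {real k..} < ennreal (1 / 2)"
    by (auto simp: eventually_sequentially)
  show thesis
  proof (rule that[of "real k + 1"])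
    fix x and X :: "real set" assume x: "x \<ge> real k + 1" and X: "countable X"
    show "\<exists>r. x \<le> r \<and> r \<le> 2 * x \<and> r \<notin> E \<and> r \<notin> X"
    proof (rule ccontr)
      assume "\<not> ?thesis"
      then have sub: "r \<in> E" if "x \<le> r" "r \<le> 2 * x" "r \<notin> X" for r using that by blast
      have X0: "X \<in> null_sets lebesgue"
        using X by (simp add: countable_imp_null_set_lborel null_sets_completionI)
      have "ennreal (1 / 2) = ennreal (1 / (2 * x)) * emeasure lebesgue {x..2 * x}"
        using x by (simp flip: ennreal_mult)
      also have "\<dots> = (\<integral>\<^sup>+ t. ennreal (1 / (2 * x)) * indicator {x..2 * x} t \<partial>lebesgue)"
        by (simp add: nn_integral_cmult_indicator)
      also have "\<dots> \<le> (\<integral>\<^sup>+ t. g t * indicator {real k..} t \<partial>lebesgue)"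
      proof (rule nn_integral_mono_AE)
        have "AE t in lebesgue. t \<notin> X" using X0 by (rule AE_not_in)
        then show "AE t in lebesgue. ennreal (1 / (2 * x)) * indicator {x..2 * x} t \<le> g t * indicator {real k..} t"
        proof eventually_elim
          case (elim t)
          show ?case
          proof (cases "t \<in> {x..2 * x}")
            case True
            then have "t \<in> E" using sub elim by auto
            moreover have "1 / (2 * x) \<le> 1 / t" using True x by (intro divide_left_mono) auto
            ultimately show ?thesis using True x by (auto simp: g_def intro: ennreal_leI)
          qed simp
        qed
      qed
      also have "\<dots> = emeasure N {real k..}" by (simp add: emN)
      finally show False using k by simp
    qed
  qed simp
qed

lemma entire_no_pole:
  assumes "f holomorphic_on UNIV"
  shows "\<not> is_pole f z"
  using assms by (simp add: analytic_at_imp_no_pole holomorphic_on_imp_analytic_at)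

lemma nevanlinna_T_entire:
  assumes "f holomorphic_on UNIV"
  shows "nevanlinna_T f r = proximity f r"
  using entire_no_pole[OF assms] by (simp add: nevanlinna_T_def pole_counting_def pole_count_def)

lemma finite_order_bound:
  assumes "nevanlinna_order f < \<infinity>"
  obtains K :: nat and x0 where "\<And>r. r \<ge> x0 \<Longrightarrow> nevanlinna_T f r \<le> r ^ K" "x0 \<ge> 1"
proof -
  obtain C :: real where C: "nevanlinna_order f < ereal C"
  proof (cases "nevanlinna_order f")
    case (real x)
    then show ?thesis using that[of "x + 1"] by simp
  next
    case MInf
    then show ?thesis using that[of 0] by simp
  qed (use assms in auto)
  then have "\<forall>\<^sub>F r in at_top. ereal (log_plus (nevanlinna_T f r) / ln r) < ereal C"
    unfolding nevanlinna_order_def by (rule Limsup_lessD)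
  then obtain x0 where x0: "\<And>r. r \<ge> x0 \<Longrightarrow> log_plus (nevanlinna_T f r) / ln r < C"
    by (auto simp: eventually_at_top_linorder)
  show ?thesis
  proof (rule that[of "max x0 2"])
    fix r assume r: "r \<ge> max x0 2"
    then have ln: "ln r > 0" by simp
    have "log_plus (nevanlinna_T f r) \<le> C * ln r" using x0[of r] r ln by (simp add: pos_divide_less_eq)
    also have "\<dots> \<le> real (nat \<lceil>C\<rceil>) * ln r"
      using ln by (intro mult_right_mono) (auto simp: real_nat_ceiling_ge)
    finally have "exp (log_plus (nevanlinna_T f r)) \<le> exp (real (nat \<lceil>C\<rceil>) * ln r)" by simp
    also have "\<dots> = r ^ nat \<lceil>C\<rceil>" using r by (simp add: exp_of_nat_mult)
    finally show "nevanlinna_T f r \<le> r ^ nat \<lceil>C\<rceil>" using le_exp_log_plus order_trans by blast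
  qed simp
qed

lemma is_S_bound:
  assumes "is_S g f"
  obtains E where "finite_log_measure E"
    "\<And>\<epsilon>. \<epsilon> > 0 \<Longrightarrow> \<exists>x0. \<forall>r\<ge>x0. r \<notin> E \<longrightarrow> \<bar>g r\<bar> \<le> \<epsilon> * \<bar>nevanlinna_T f r\<bar>"
proof -
  obtain E where E: "finite_log_measure E" "g \<in> o[inf at_top (principal (- E))](nevanlinna_T f)"
    using assms by (auto simp: is_S_def)
  have "\<exists>x0. \<forall>r\<ge>x0. r \<notin> E \<longrightarrow> \<bar>g r\<bar> \<le> \<epsilon> * \<bar>nevanlinna_T f r\<bar>" if "\<epsilon> > 0" for \<epsilon>
    using landau_o.smallD[OF E(2) that]
    by (auto simp: eventually_inf_principal eventually_at_top_linorder)
  then show ?thesis using that E(1) by blast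
qed

lemma finite_poles:
  assumes "a meromorphic_on UNIV"
  shows "finite {z \<in> cball 0 R. is_pole a z}"
proof -
  have "{z. is_pole a z} sparse_in UNIV"
    using meromorphic_on_imp_not_pole_cosparse[OF assms] by (simp add: eventually_cosparse)
  then have "{z. is_pole a z} sparse_in cball 0 R" by (rule sparse_in_subset) auto
  then have "finite (cball 0 R \<inter> {z. is_pole a z})"
    by (intro sparse_in_compact_finite) auto
  moreover have "cball 0 R \<inter> {z. is_pole a z} = {z \<in> cball 0 R. is_pole a z}" by blast
  ultimately show ?thesis by simp
qed

text \<open>A pole \<open>p\<close> off the origin is counted for \<open>t\<close> between
  \<open>|p|\<close> and \<open>R\<close>, and so contributes its multiplicity times the integral of
  \<open>1 / t\<close> over that range.\<close>

lemma pole_counting_eq: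
  assumes "a meromorphic_on UNIV" "R > 0"
  shows "pole_counting a R = (\<Sum>p | p \<in> cball 0 R \<and> is_pole a p \<and> p \<noteq> 0. real (nat (- zorder a p)) * ln (R / norm p))
    + real (pole_count a 0) * ln R"
proof -
  define S where "S = {p. p \<in> cball 0 R \<and> is_pole a p \<and> p \<noteq> 0}"
  define w where "w = (\<lambda>p. real (nat (- zorder a p)))"
  have finS: "finite S"
    by (rule finite_subset[OF _ finite_poles[OF assms(1), of R]]) (auto simp: S_def)
  have int1: "((\<lambda>t. if t \<in> {norm p..R} then w p / t else 0) has_integral w p * ln (R / norm p)) {0..R}"
    if p: "p \<in> S" for p
  proof -
    have np: "0 < norm p" "norm p \<le> R" using p by (auto simp: S_def)
    have "((\<lambda>t. w p / t) has_integral w p * ln R - w p * ln (norm p)) {norm p..R}"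
    proof (rule fundamental_theorem_of_calculus)
      fix t assume "t \<in> {norm p..R}"
      then have "t > 0" using np(1) unfolding atLeastAtMost_iff by linarith
      then have "((\<lambda>t. w p * ln t) has_real_derivative w p / t) (at t)"
        using np by (auto intro!: derivative_eq_intros)
      then show "((\<lambda>t. w p * ln t) has_vector_derivative w p / t) (at t within {norm p..R})"
        by (simp add: has_real_derivative_iff_has_vector_derivative has_vector_derivative_at_within)
    qed (use np in simp)
    moreover have "w p * ln R - w p * ln (norm p) = w p * ln (R / norm p)"
      using np assms(2) by (simp add: ln_div algebra_simps)
    ultimately show ?thesis using np by (subst has_integral_restrict) auto
  qed
  have eq: "(\<Sum>p\<in>S. if t \<in> {norm p..R} then w p / t else 0) = (real (pole_count a t) - real (pole_count a 0)) / t"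
    if t: "t \<in> {0..R}" for t
  proof -
    define A where "A = {z. z \<in> cball 0 t \<and> is_pole a z}"
    define B where "B = {z. z \<in> cball 0 (0::real) \<and> is_pole a z}"
    have finA: "finite A" unfolding A_def using finite_poles[OF assms(1)] by simp
    have BA: "B \<subseteq> A" using t by (auto simp: A_def B_def)
    have diff: "A - B = {p \<in> S. t \<in> {norm p..R}}" using t by (auto simp: A_def B_def S_def)
    have "real (pole_count a t) - real (pole_count a 0) = sum w A - sum w B"
      by (simp add: pole_count_def A_def B_def w_def)
    also have "\<dots> = sum w (A - B)" using finA BA by (simp add: sum_diff)
    also have "\<dots> = (\<Sum>p\<in>S. if t \<in> {norm p..R} then w p else 0)"
      unfolding diff using finS by (simp add: sum.inter_filter)
    finally show ?thesis unfolding sum_divide_distrib by (auto simp: sum_divide_distrib intro!: sum.cong)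
  qed
  have "((\<lambda>t. \<Sum>p\<in>S. if t \<in> {norm p..R} then w p / t else 0) has_integral (\<Sum>p\<in>S. w p * ln (R / norm p))) {0..R}"
    by (rule has_integral_sum[OF finS int1])
  then have "((\<lambda>t. (real (pole_count a t) - real (pole_count a 0)) / t) has_integral (\<Sum>p\<in>S. w p * ln (R / norm p))) {0..R}"
    by (subst has_integral_cong[OF eq[symmetric]])
  from integral_unique[OF this] show ?thesis by (simp add: pole_counting_def S_def w_def)
qed

text \<open>Per unit of multiplicity, a pole \<open>p\<close> in \<open>cball 0 r\<close>
  contributes \<open>ln (2 * r / |p|) >= ln 2\<close> at radius \<open>2 * r\<close>; for a pole at
  the origin this is \<open>ln (2 * r)\<close>, whence \<open>r >= 1\<close>.\<close>

lemma pole_count_le: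
  assumes "a meromorphic_on UNIV" "r \<ge> 1"
  shows "real (pole_count a r) * ln 2 \<le> pole_counting a (2 * r)"
proof -
  define S where "S = {p. p \<in> cball 0 (2 * r) \<and> is_pole a p \<and> p \<noteq> 0}"
  define w where "w = (\<lambda>p. real (nat (- zorder a p)))"
  define A where "A = {z. z \<in> cball 0 r \<and> is_pole a z}"
  define B where "B = {z. z \<in> cball 0 (0::real) \<and> is_pole a z}"
  have finS: "finite S"
    by (rule finite_subset[OF _ finite_poles[OF assms(1), of "2 * r"]]) (auto simp: S_def)
  have finA: "finite A" unfolding A_def using finite_poles[OF assms(1)] by simp
  have BA: "B \<subseteq> A" using assms(2) by (auto simp: A_def B_def)
  have AB: "A - B \<subseteq> S" using assms(2) by (auto simp: A_def B_def S_def)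
  have "real (pole_count a r) * ln 2 = sum w A * ln 2"
    by (simp add: pole_count_def A_def w_def)
  also have "sum w A = sum w (A - B) + sum w B" using finA BA by (simp add: sum.subset_diff)
  also have "(sum w (A - B) + sum w B) * ln 2 = (\<Sum>p\<in>A - B. w p * ln 2) + sum w B * ln 2"
    by (simp add: algebra_simps sum_distrib_left)
  also have "\<dots> \<le> (\<Sum>p\<in>S. w p * ln (2 * r / norm p)) + sum w B * ln (2 * r)"
  proof (rule add_mono)
    have "(\<Sum>p\<in>A - B. w p * ln 2) \<le> (\<Sum>p\<in>A - B. w p * ln (2 * r / norm p))"
    proof (intro sum_mono mult_left_mono)
      fix p assume "p \<in> A - B"
      then have "0 < norm p" "norm p \<le> r" by (auto simp: A_def B_def)
      moreover have "0 < 2 * r / norm p" using calculation assms(2) by (intro divide_pos_pos) auto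
      ultimately show "ln 2 \<le> ln (2 * r / norm p)" by (subst ln_le_cancel_iff) (auto simp: pos_le_divide_eq)
    qed (auto simp: w_def)
    also have "\<dots> \<le> (\<Sum>p\<in>S. w p * ln (2 * r / norm p))"
      using assms(2) by (intro sum_mono2 finS AB mult_nonneg_nonneg ln_ge_zero) (auto simp: w_def S_def pos_le_divide_eq)
    finally show "(\<Sum>p\<in>A - B. w p * ln 2) \<le> (\<Sum>p\<in>S. w p * ln (2 * r / norm p))" .
    show "sum w B * ln 2 \<le> sum w B * ln (2 * r)"
      using assms(2) by (intro mult_left_mono sum_nonneg) (auto simp: w_def)
  qed
  also have "\<dots> = pole_counting a (2 * r)"
    using assms(2) by (subst pole_counting_eq[OF assms(1)]) (auto simp: S_def w_def B_def pole_count_def)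
  finally show ?thesis .
qed

lemma pole_counting_nonneg:
  assumes "a meromorphic_on UNIV" "r \<ge> 1"
  shows "pole_counting a r \<ge> 0"
  using assms(2) by (subst pole_counting_eq[OF assms(1)])
    (auto intro!: add_nonneg_nonneg sum_nonneg mult_nonneg_nonneg ln_ge_zero simp: pos_le_divide_eq)

section \<open>Small functions and shared zeros\<close>

lemma countable_not_cosparse:
  fixes P :: "complex \<Rightarrow> bool"
  assumes "\<forall>\<^sub>\<approx>z\<in>UNIV. P z"
  shows "countable {z. \<not> P z}"
  using sparse_imp_countable[OF open_UNIV, of "{z. \<not> P z}"] assms by (simp add: eventually_cosparse)

lemma entire_meromorphic: "f holomorphic_on UNIV \<Longrightarrow> f meromorphic_on A"
  by (meson analytic_on_imp_meromorphic_on analytic_on_open meromorphic_on_subset open_UNIV subset_UNIV)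

lemma meromorphic_avoid_zero:
  assumes "f holomorphic_on S" "open S" "connected S" "z0 \<in> S" "f z0 \<noteq> 0"
  shows "\<forall>\<^sub>\<approx>z\<in>S. f z \<noteq> 0"
proof -
  have "f analytic_on S" using assms by (simp add: analytic_on_open)
  then have "f nicely_meromorphic_on S" by (rule analytic_on_imp_nicely_meromorphic_on)
  from nicely_meromorphic_imp_constant_or_avoid[OF this assms(2,3), of 0] show ?thesis
    using assms(4,5) by blast
qed

lemma countable_zeros:
  assumes "f holomorphic_on S" "open S" "connected S" "z0 \<in> S" "f z0 \<noteq> 0"
  shows "countable {z \<in> S. f z = 0}"
proof -
  have "countable (S \<inter> {z. \<not> f z \<noteq> 0})"
    by (rule sparse_imp_countable[OF assms(2)])
      (use meromorphic_avoid_zero[OF assms] in \<open>simp only: eventually_cosparse\<close>)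
  moreover have "S \<inter> {z. \<not> f z \<noteq> 0} = {z \<in> S. f z = 0}" by auto
  ultimately show ?thesis by simp
qed

lemma countable_not_analytic:
  assumes "a meromorphic_on UNIV"
  shows "countable {z. \<not> a analytic_on {z}}"
  by (rule countable_not_cosparse[OF meromorphic_on_imp_analytic_cosparse[OF assms]])

lemma continuous_on_sphere_analytic:
  assumes "\<And>z. norm z = r \<Longrightarrow> a analytic_on {z}"
  shows "continuous_on (sphere 0 r) a"
proof -
  have "isCont a z" if "z \<in> sphere 0 r" for z
    using assms[of z] that by (auto intro: analytic_at_imp_isCont)
  then show ?thesis by (rule continuous_at_imp_continuous_on[OF ballI])
qed

text \<open>Makes \<open>S(r, f)\<close> usable: for entire \<open>f\<close> the characteristic is
  at most the logarithm of any bound \<open>exp B >= 1\<close> of \<open>|f|\<close> on the circle.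
  The set \<open>X\<close> lets the circle avoid zeros and singularities, and \<open>B\<close> is
  quantified after \<open>r\<close> so that one radius serves every bound.\<close>

lemma small_proximity:
  assumes f: "f holomorphic_on UNIV" and a: "a meromorphic_on UNIV"
    and S: "is_S (nevanlinna_T a) f" and "\<epsilon> > 0"
  obtains x0 where "x0 \<ge> 1"
    "\<And>x X. x \<ge> x0 \<Longrightarrow> countable X \<Longrightarrow> \<exists>r. x \<le> r \<and> r \<le> 2 * x \<and> r \<notin> X \<and>
       (\<forall>B\<ge>0. (\<forall>z. norm z = r \<longrightarrow> norm (f z) \<le> exp B) \<longrightarrow>
         proximity a r \<le> \<epsilon> * B \<and> pole_counting a r \<le> \<epsilon> * B)"
proof -
  obtain E where E: "finite_log_measure E" and
    Eb: "\<And>\<epsilon>. \<epsilon> > 0 \<Longrightarrow> \<exists>x0. \<forall>r\<ge>x0. r \<notin> E \<longrightarrow> \<bar>nevanlinna_T a r\<bar> \<le> \<epsilon> * \<bar>nevanlinna_T f r\<bar>"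
    using is_S_bound[OF S] by blast
  obtain x1 where x1: "x1 \<ge> 1" "\<And>x X. x \<ge> x1 \<Longrightarrow> countable X \<Longrightarrow> \<exists>r. x \<le> r \<and> r \<le> 2 * x \<and> r \<notin> E \<and> r \<notin> X"
    using avoid_exceptional_set[OF E] by metis
  obtain x2 where x2: "\<And>r. r \<ge> x2 \<Longrightarrow> r \<notin> E \<Longrightarrow> \<bar>nevanlinna_T a r\<bar> \<le> \<epsilon> * \<bar>nevanlinna_T f r\<bar>"
    using Eb[OF \<open>\<epsilon> > 0\<close>] by blast
  show thesis
  proof (rule that[of "max x1 x2"])
    fix x and X :: "real set" assume x: "x \<ge> max x1 x2" "countable X"
    then obtain r where r: "x \<le> r" "r \<le> 2 * x" "r \<notin> E" "r \<notin> X" using x1(2)[of x X] by auto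
    have r1: "r \<ge> 1" using r x x1 by linarith
    show "\<exists>r. x \<le> r \<and> r \<le> 2 * x \<and> r \<notin> X \<and>
       (\<forall>B\<ge>0. (\<forall>z. norm z = r \<longrightarrow> norm (f z) \<le> exp B) \<longrightarrow>
         proximity a r \<le> \<epsilon> * B \<and> pole_counting a r \<le> \<epsilon> * B)"
    proof (intro exI[of _ r] conjI allI impI r)
      fix B :: real assume B: "B \<ge> 0" "\<forall>z. norm z = r \<longrightarrow> norm (f z) \<le> exp B"
      have Tf: "nevanlinna_T f r \<le> B" unfolding nevanlinna_T_entire[OF f]
        using B r1 by (intro proximity_le) auto
      have "nevanlinna_T f r \<ge> 0" unfolding nevanlinna_T_entire[OF f] by (rule proximity_nonneg)
      then have "nevanlinna_T a r \<le> \<epsilon> * nevanlinna_T f r" using x2[of r] r x by auto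
      also have "\<dots> \<le> \<epsilon> * B" using Tf \<open>\<epsilon> > 0\<close> by (intro mult_left_mono) auto
      finally have T: "nevanlinna_T a r \<le> \<epsilon> * B" .
      have "pole_counting a r \<ge> 0" using pole_counting_nonneg[OF a r1] .
      then show "proximity a r \<le> \<epsilon> * B" using T unfolding nevanlinna_T_def by simp
      show "pole_counting a r \<le> \<epsilon> * B" using T proximity_nonneg[of a r] unfolding nevanlinna_T_def by simp
    qed
  qed (use x1 in simp)
qed

text \<open>On a circle where \<open>Y = U * a\<close> holds pointwise, the proximity function of
  \<open>Y\<close> is at most \<open>B'\<close> plus that of \<open>a\<close>. As \<open>Y\<close>
  is entire, the Poisson bound at half the radius applies, with its factor 3.\<close>

lemma entire_product_bound:
  assumes f: "f holomorphic_on UNIV" and a: "a meromorphic_on UNIV"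
    and S: "is_S (nevanlinna_T a) f" and "\<epsilon> > 0"
    and Y: "Y holomorphic_on UNIV" and U: "U holomorphic_on UNIV"
    and eq: "countable {z. Y z \<noteq> U z * a z}"
  obtains x0 where "x0 \<ge> 1"
    "\<And>x B B' z. x \<ge> x0 \<Longrightarrow> B \<ge> 0 \<Longrightarrow> B' \<ge> 0 \<Longrightarrow> (\<And>z. norm z \<le> 2 * x \<Longrightarrow> norm (f z) \<le> exp B) \<Longrightarrow>
      (\<And>z. norm z \<le> 2 * x \<Longrightarrow> norm (U z) \<le> exp B') \<Longrightarrow> norm z \<le> x / 2 \<Longrightarrow>
      norm (Y z) \<le> exp (3 * (B' + \<epsilon> * B))"
proof -
  obtain x0 where x0: "x0 \<ge> 1"
    and ex: "\<And>x X. x \<ge> x0 \<Longrightarrow> countable X \<Longrightarrow> \<exists>r. x \<le> r \<and> r \<le> 2 * x \<and> r \<notin> X \<and>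
       (\<forall>B\<ge>0. (\<forall>z. norm z = r \<longrightarrow> norm (f z) \<le> exp B) \<longrightarrow>
         proximity a r \<le> \<epsilon> * B \<and> pole_counting a r \<le> \<epsilon> * B)"
    using small_proximity[OF f a S \<open>\<epsilon> > 0\<close>] by metis
  show thesis
  proof (rule that[OF x0])
    fix x B B' :: real and z :: complex
    assume x: "x \<ge> x0" and B: "B \<ge> 0" "B' \<ge> 0" and fB: "\<And>z. norm z \<le> 2 * x \<Longrightarrow> norm (f z) \<le> exp B"
      and UB: "\<And>z. norm z \<le> 2 * x \<Longrightarrow> norm (U z) \<le> exp B'" and z: "norm z \<le> x / 2"
    show "norm (Y z) \<le> exp (3 * (B' + \<epsilon> * B))"
    proof (cases "Y z = 0")
      case False
      define X where "X = norm ` ({z. Y z \<noteq> U z * a z} \<union> {z. \<not> a analytic_on {z}} \<union> {z \<in> UNIV. Y z = 0})"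
      have "countable X"
        unfolding X_def using eq countable_not_analytic[OF a] countable_zeros[OF Y open_UNIV connected_UNIV UNIV_I False]
        by (intro countable_image countable_Un) auto
      from ex[OF x this] obtain r where r: "x \<le> r" "r \<le> 2 * x" "r \<notin> X"
        and prox: "\<And>B. B \<ge> 0 \<Longrightarrow> (\<forall>z. norm z = r \<longrightarrow> norm (f z) \<le> exp B) \<Longrightarrow> proximity a r \<le> \<epsilon> * B" by blast
      have r1: "r \<ge> 1" using r x x0 by linarith
      have circ: "Y w = U w * a w" "a analytic_on {w}" "Y w \<noteq> 0" if "norm w = r" for w
        using r(3) that unfolding X_def by blast+
      have "proximity Y r \<le> B' + proximity a r"
      proof (rule proximity_mult_le)
        fix w :: complex assume w: "norm w = r"
        show "norm (Y w) \<le> exp B' * norm (a w)"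
          unfolding circ(1)[OF w] norm_mult using UB[of w] w r by (intro mult_right_mono) auto
      next
        show "continuous_on (sphere 0 r) Y"
          using Y by (meson holomorphic_on_imp_continuous_on holomorphic_on_subset subset_UNIV)
        show "continuous_on (sphere 0 r) a" by (rule continuous_on_sphere_analytic[OF circ(2)])
      qed (use B r1 in auto)
      also have "proximity a r \<le> \<epsilon> * B" by (rule prox) (use B fB r in auto)
      finally have "proximity Y r \<le> B' + \<epsilon> * B" by simp
      moreover have "norm (Y z) \<le> exp (3 * proximity Y r)"
        by (rule norm_le_exp_proximity[of Y UNIV]) (use Y circ(3) r1 z r in auto)
      ultimately show ?thesis by (smt (verit) exp_le_cancel_iff)
    qed simp
  qed
qed

lemma tendsto_pole_times_power:
  assumes "a meromorphic_on {p}" "is_pole a p"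
  shows "\<exists>c. (\<lambda>w. (w - p) ^ nat (- zorder a p) * a w) \<midarrow>p\<rightarrow> c"
proof -
  have "isolated_singularity_at a p" using assms(1) by (simp add: meromorphic_at_iff)
  then obtain S where S: "open S" "p \<in> S" "a holomorphic_on S - {p}"
    using analytic_imp_holomorphic isolated_singularity_at_iff_analytic_nhd by auto
  from zorder_exist_pole[OF S(3,1,2) assms(2)] obtain r where
    r: "r > 0" "zor_poly a p holomorphic_on cball p r"
    "\<And>w. w \<in> cball p r - {p} \<Longrightarrow> a w = zor_poly a p w / (w - p) ^ nat (- zorder a p)" by blast
  have "isCont (zor_poly a p) p"
    using r(1,2) by (intro continuous_on_interior[OF holomorphic_on_imp_continuous_on[OF r(2)]]) auto
  then have lim: "zor_poly a p \<midarrow>p\<rightarrow> zor_poly a p p" by (rule isContD)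
  have ev: "\<forall>\<^sub>F w in at p. zor_poly a p w = (w - p) ^ nat (- zorder a p) * a w"
  proof -
    have "\<forall>\<^sub>F w in at p. w \<in> ball p r - {p}" using r(1) by (intro eventually_at_in_open) auto
    then show ?thesis by eventually_elim (subst r(3), auto)
  qed
  show ?thesis using tendsto_cong[OF ev, THEN iffD1, OF lim] by blast
qed

text \<open>Multiplication by \<open>q\<close>, the polynomial of the poles of \<open>a\<close> in
  \<open>cball 0 (2 * x)\<close>, makes \<open>f - a\<close> usable as a denominator;
  \<open>A\<close> is \<open>q * a\<close> with its singularities removed. The lower bound for
  \<open>q\<close> serves at a base point away from the poles. The price is the term
  \<open>N * ln (4 * x)\<close> in the exponent.\<close>

lemma pole_polynomial_bound:
  assumes f: "f holomorphic_on UNIV" and a: "a meromorphic_on UNIV"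
    and S: "is_S (nevanlinna_T a) f"
  obtains x0 where "x0 \<ge> 1"
    "\<And>x B. x \<ge> x0 \<Longrightarrow> B \<ge> 0 \<Longrightarrow> (\<And>z. norm z \<le> 8 * x \<Longrightarrow> norm (f z) \<le> exp B) \<Longrightarrow>
      \<exists>q A (N::nat). q holomorphic_on UNIV \<and> A holomorphic_on ball 0 (2 * x) \<and> real N \<le> 2 * B \<and>
        (\<forall>\<delta> z. 0 \<le> \<delta> \<longrightarrow> (\<forall>p. is_pole a p \<longrightarrow> \<delta> \<le> norm (z - p)) \<longrightarrow> \<delta> ^ N \<le> norm (q z)) \<and>
        (\<forall>z. norm z \<le> 2 * x \<longrightarrow> norm (q z) \<le> (4 * x) ^ N) \<and>
        (\<forall>z. norm z < 2 * x \<longrightarrow> a analytic_on {z} \<longrightarrow> A z = q z * a z) \<and>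
        (\<forall>z. norm z \<le> x / 4 \<longrightarrow> norm (A z) \<le> exp (3 * (N * ln (4 * x) + B)))"
proof -
  obtain x0 where x0: "x0 \<ge> 1"
    and ex: "\<And>x X. x \<ge> x0 \<Longrightarrow> countable X \<Longrightarrow> \<exists>r. x \<le> r \<and> r \<le> 2 * x \<and> r \<notin> X \<and>
       (\<forall>B\<ge>0. (\<forall>z. norm z = r \<longrightarrow> norm (f z) \<le> exp B) \<longrightarrow>
         proximity a r \<le> 1 * B \<and> pole_counting a r \<le> 1 * B)"
    using small_proximity[OF f a S zero_less_one] by metis
  show thesis
  proof (rule that[of "2 * x0"])
    fix x B :: real
    assume x: "x \<ge> 2 * x0" and B: "B \<ge> 0" and fB: "\<And>z. norm z \<le> 8 * x \<Longrightarrow> norm (f z) \<le> exp B"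
    define N where "N = pole_count a (2 * x)"
    define P where "P = {z. z \<in> cball 0 (2 * x) \<and> is_pole a z}"
    have finP: "finite P" unfolding P_def using finite_poles[OF a] by simp
    define \<nu> where "\<nu> = (\<lambda>p. nat (- zorder a p))"
    define q where "q = (\<lambda>z. \<Prod>p\<in>P. (z - p) ^ \<nu> p)"
    have N: "N = (\<Sum>p\<in>P. \<nu> p)" by (simp add: N_def P_def \<nu>_def pole_count_def)
    have q: "q holomorphic_on T" for T unfolding q_def by (intro holomorphic_intros)
    have NB: "real N \<le> 2 * B"
    proof -
      \<comment> \<open>\<open>pole_count_le\<close> halves the radius, so a radius of at least
        \<open>4 * x\<close> is used to count the poles up to \<open>2 * x\<close>.\<close>
      have "4 * x \<ge> x0" using x x0 by linarith
      from ex[OF this countable_empty] obtain r where r: "4 * x \<le> r" "r \<le> 2 * (4 * x)"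
        and pc: "pole_counting a r \<le> 1 * B"
        using fB B by fastforce
      have "real N \<le> real (pole_count a (r / 2))"
        unfolding N_def pole_count_def using r finite_poles[OF a, of "r / 2"]
        by (intro of_nat_mono sum_mono2) auto
      then have "real N * ln 2 \<le> real (pole_count a (r / 2)) * ln 2" by (intro mult_right_mono) auto
      also have "\<dots> \<le> pole_counting a (2 * (r / 2))"
        using r x x0 by (intro pole_count_le[OF a]) linarith
      finally have "real N * ln 2 \<le> B" using pc by simp
      moreover have "real N * (1 / 2) \<le> real N * ln 2" using ln2_ge_two_thirds by (intro mult_left_mono) auto
      ultimately show ?thesis by simp
    qed
    define A where "A = remove_sings (\<lambda>z. q z * a z)"
    have qa: "(\<lambda>z. q z * a z) meromorphic_on UNIV"
      by (intro meromorphic_intros a entire_meromorphic q)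
    have A_ana: "A analytic_on {z}" if "norm z < 2 * x" for z
    proof -
      have iso: "isolated_singularity_at (\<lambda>z. q z * a z) z"
        using qa meromorphic_on_altdef by blast
      have a_z: "a meromorphic_on {z}" using a by (rule meromorphic_on_subset) simp
      have contq: "isCont g z" if "g holomorphic_on UNIV" for g :: "complex \<Rightarrow> complex"
        using that by (simp add: analytic_at_imp_isCont holomorphic_on_imp_analytic_at)
      have "\<exists>c. (\<lambda>z. q z * a z) \<midarrow>z\<rightarrow> c"
      proof (cases "is_pole a z")
        case False
        then obtain c where "a \<midarrow>z\<rightarrow> c" using a_z by (auto simp: meromorphic_at_iff not_essential_def)
        then show ?thesis using tendsto_mult[OF isContD[OF contq[OF q]]] by blast
      next
        case True
        then have zP: "z \<in> P" using that by (simp add: P_def)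
        define q' where "q' = (\<lambda>w. \<Prod>p\<in>P - {z}. (w - p) ^ \<nu> p)"
        have q': "q' holomorphic_on UNIV" unfolding q'_def by (intro holomorphic_intros)
        have eq: "q w * a w = q' w * ((w - z) ^ \<nu> z * a w)" for w
          unfolding q_def q'_def using prod.remove[OF finP zP, of "\<lambda>p. (w - p) ^ \<nu> p"] by (simp add: mult_ac)
        obtain c where "(\<lambda>w. (w - z) ^ \<nu> z * a w) \<midarrow>z\<rightarrow> c"
          using tendsto_pole_times_power[OF a_z True] unfolding \<nu>_def by blast
        from tendsto_mult[OF isContD[OF contq[OF q']] this] show ?thesis unfolding eq by blast
      qed
      then show ?thesis unfolding A_def using remove_sings_analytic_at[OF iso] by blast
    qed
    have A: "A holomorphic_on ball 0 (2 * x)"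
      by (rule analytic_imp_holomorphic) (subst analytic_on_analytic_at, use A_ana in auto)
    have A_eq: "A z = q z * a z" if "a analytic_on {z}" for z
      unfolding A_def
      by (intro remove_sings_at_analytic analytic_intros that)
        (simp add: holomorphic_on_imp_analytic_at[OF q[of UNIV]])
    have q_upper: "norm (q z) \<le> (4 * x) ^ N" if "norm z \<le> 2 * x" for z
    proof -
      have "norm (q z) = (\<Prod>p\<in>P. norm (z - p) ^ \<nu> p)" by (simp add: q_def norm_power flip: prod_norm)
      also have "\<dots> \<le> (\<Prod>p\<in>P. (4 * x) ^ \<nu> p)"
      proof (intro prod_mono conjI power_mono)
        fix p assume "p \<in> P"
        then show "norm (z - p) \<le> 4 * x"
          using norm_triangle_ineq4[of z p] that by (auto simp: P_def)
      qed auto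
      finally show ?thesis by (simp add: N power_sum)
    qed
    have q_lower: "\<delta> ^ N \<le> norm (q z)" if "0 \<le> \<delta>" "\<forall>p. is_pole a p \<longrightarrow> \<delta> \<le> norm (z - p)" for \<delta> z
    proof -
      have "\<delta> ^ N = (\<Prod>p\<in>P. \<delta> ^ \<nu> p)" by (simp add: N power_sum)
      also have "\<dots> \<le> (\<Prod>p\<in>P. norm (z - p) ^ \<nu> p)"
        using that by (intro prod_mono conjI power_mono) (auto simp: P_def)
      also have "\<dots> = norm (q z)" by (simp add: q_def norm_power flip: prod_norm)
      finally show ?thesis .
    qed
    have A_upper: "norm (A z) \<le> exp (3 * (N * ln (4 * x) + B))" if z: "norm z \<le> x / 4" for z
    proof (cases "A z = 0")
      case False
      have zb: "z \<in> ball 0 (2 * x)" using z x x0 by simp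
      define X where "X = norm ` ({z. \<not> a analytic_on {z}} \<union> {z \<in> ball 0 (2 * x). A z = 0})"
      have "countable X"
        unfolding X_def using countable_not_analytic[OF a] countable_zeros[OF A open_ball connected_ball zb False]
        by (intro countable_image countable_Un) auto
      \<comment> \<open>The circle is taken between \<open>x / 2\<close> and \<open>x\<close>, so
        that points with \<open>|z| <= x / 4\<close> lie within half its radius; hence the threshold
        \<open>2 * x0\<close>.\<close>
      moreover have "x / 2 \<ge> x0" using x by simp
      ultimately obtain r where r: "x / 2 \<le> r" "r \<le> 2 * (x / 2)" "r \<notin> X"
        and prox: "\<And>B. B \<ge> 0 \<Longrightarrow> (\<forall>z. norm z = r \<longrightarrow> norm (f z) \<le> exp B) \<Longrightarrow> proximity a r \<le> 1 * B"
        using ex[of "x / 2" X] by blast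
      have r0: "r > 0" using r x x0 by linarith
      have sub: "cball 0 r \<subseteq> ball 0 (2 * x)" using r r0 by auto
      have circ: "a analytic_on {w}" "A w \<noteq> 0" if "norm w = r" for w
      proof -
        have "w \<in> cball 0 r" using that by simp
        then have "w \<in> ball 0 (2 * x)" using sub by blast
        then show "a analytic_on {w}" "A w \<noteq> 0" using r(3) that unfolding X_def by blast+
      qed
      have "proximity A r \<le> N * ln (4 * x) + proximity a r"
      proof (rule proximity_mult_le)
        fix w :: complex assume w: "norm w = r"
        have "exp (N * ln (4 * x)) = (4 * x) ^ N" using x x0 by (simp add: exp_of_nat_mult)
        then show "norm (A w) \<le> exp (N * ln (4 * x)) * norm (a w)"
          unfolding A_eq[OF circ(1)[OF w]] norm_mult using q_upper[of w] w r by (intro mult_right_mono) auto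
      next
        show "continuous_on (sphere 0 r) A"
          using A sub sphere_cball by (meson holomorphic_on_imp_continuous_on holomorphic_on_subset subset_trans)
        show "continuous_on (sphere 0 r) a" by (rule continuous_on_sphere_analytic[OF circ(1)])
      qed (use r0 x x0 in auto)
      also have "proximity a r \<le> 1 * B" by (rule prox) (use B fB r x x0 in auto)
      finally have "proximity A r \<le> N * ln (4 * x) + B" by simp
      moreover have "norm (A z) \<le> exp (3 * proximity A r)"
        by (rule norm_le_exp_proximity[OF A open_ball connected_ball sub r0 circ(2)]) (use z r in auto)
      ultimately show ?thesis by (smt (verit) exp_le_cancel_iff)
    qed simp
    show "\<exists>q A (N::nat). q holomorphic_on UNIV \<and> A holomorphic_on ball 0 (2 * x) \<and> real N \<le> 2 * B \<and>
        (\<forall>\<delta> z. 0 \<le> \<delta> \<longrightarrow> (\<forall>p. is_pole a p \<longrightarrow> \<delta> \<le> norm (z - p)) \<longrightarrow> \<delta> ^ N \<le> norm (q z)) \<and>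
        (\<forall>z. norm z \<le> 2 * x \<longrightarrow> norm (q z) \<le> (4 * x) ^ N) \<and>
        (\<forall>z. norm z < 2 * x \<longrightarrow> a analytic_on {z} \<longrightarrow> A z = q z * a z) \<and>
        (\<forall>z. norm z \<le> x / 4 \<longrightarrow> norm (A z) \<le> exp (3 * (N * ln (4 * x) + B)))"
      using q A NB q_lower q_upper A_eq A_upper by blast
  qed (use x0 in simp)
qed

lemma zero_mult_avoid:
  assumes "\<forall>\<^sub>\<approx>z\<in>UNIV. h z \<noteq> 0"
  shows "zero_mult h z = enat (nat (zorder h z))"
proof -
  have "\<forall>\<^sub>F w in at z. h w \<noteq> 0" using assms by (simp add: eventually_cosparse_open_eq)
  then have "\<not> (\<forall>\<^sub>F w in at z. h w = 0)"
    using eventually_conj[of "\<lambda>w. h w \<noteq> 0" "at z" "\<lambda>w. h w = 0"] by (auto simp: eventually_False)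
  then show ?thesis by (simp add: zero_mult_def)
qed

lemma meromorphic_zero_mult_finite:
  assumes "h meromorphic_on UNIV" "zero_mult h z \<noteq> \<infinity>"
  shows "\<forall>\<^sub>\<approx>z\<in>UNIV. h z \<noteq> 0"
proof -
  have "\<not> (\<forall>\<^sub>\<approx>z\<in>UNIV. h z = 0)"
    using assms(2) by (auto simp: zero_mult_def eventually_cosparse_open_eq split: if_splits)
  then show ?thesis using meromorphic_imp_constant_or_avoid[OF assms(1) open_UNIV connected_UNIV, of 0] by blast
qed

text \<open>At the zeros of \<open>F\<close> equal multiplicities cancel. At a pole of
  \<open>F\<close> the truncation in \<open>zero_mult\<close> gives multiplicity 0, so
  \<open>G\<close> does not vanish there and \<open>G / F\<close> acquires a zero. Hence the
  quotient has no poles, and its zeros come from poles of \<open>F\<close>.\<close>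

lemma share_quotient:
  assumes F: "F meromorphic_on UNIV" "\<forall>\<^sub>\<approx>z\<in>UNIV. F z \<noteq> 0"
    and G: "G holomorphic_on UNIV" "\<forall>\<^sub>\<approx>z\<in>UNIV. G z \<noteq> 0"
    and share: "\<And>z. zero_mult F z = zero_mult G z"
  obtains U where "U holomorphic_on UNIV" "\<forall>\<^sub>\<approx>z\<in>UNIV. U z * F z = G z"
    "\<And>z. U z = 0 \<Longrightarrow> G z \<noteq> 0"
proof -
  have at: "F meromorphic_on {z}" "G meromorphic_on {z}" "G analytic_on {z}"
    "\<forall>\<^sub>F w in at z. F w \<noteq> 0" "\<forall>\<^sub>F w in at z. G w \<noteq> 0" for z
    using F G by (auto simp: eventually_cosparse_open_eq entire_meromorphic holomorphic_on_imp_analytic_at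
        intro: meromorphic_on_subset)
  have fr: "\<exists>\<^sub>F w in at z. F w \<noteq> 0" "\<exists>\<^sub>F w in at z. G w \<noteq> 0" for z
    using at(4,5)[of z] by (auto intro: eventually_frequently)
  have G0: "zorder G z \<ge> 0" for z
    using zorder_neg_imp_is_pole[OF at(2,5)] entire_no_pole[OF G(1)] by (meson not_le)
  have nat_eq: "nat (zorder F z) = nat (zorder G z)" for z
    using share[of z] by (simp add: zero_mult_avoid[OF F(2)] zero_mult_avoid[OF G(2)])
  define \<phi> where "\<phi> = (\<lambda>z. G z / F z)"
  have mero: "\<phi> meromorphic_on UNIV" unfolding \<phi>_def
    by (intro meromorphic_intros F entire_meromorphic G)
  have zo: "zorder \<phi> z = zorder G z - zorder F z" for z
    unfolding \<phi>_def by (rule zorder_divide[OF at(2) fr(2) at(1) fr(1)])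
  have no_pole: "\<not> is_pole \<phi> z" for z
  proof
    assume "is_pole \<phi> z"
    moreover have "isolated_singularity_at \<phi> z" using mero meromorphic_on_altdef by blast
    ultimately have "zorder \<phi> z < 0" using isolated_pole_imp_neg_zorder by blast
    then show False using zo[of z] G0[of z] nat_eq[of z] by linarith
  qed
  define U where "U = remove_sings \<phi>"
  have iso: "isolated_singularity_at \<phi> z" "not_essential \<phi> z" for z
    using mero by (auto simp: meromorphic_on_altdef)
  have U_ana: "U analytic_on {z}" for z
    unfolding U_def using remove_sings_analytic_at[OF iso(1)] iso(2)[of z] no_pole[of z]
    by (auto simp: not_essential_def)
  then have U: "U holomorphic_on UNIV"
    by (meson analytic_imp_holomorphic analytic_on_analytic_at)
  have UF: "\<forall>\<^sub>\<approx>z\<in>UNIV. U z * F z = G z"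
    using eventually_remove_sings_eq[OF mero] F(2)
    by eventually_elim (simp add: U_def \<phi>_def)
  have "G z \<noteq> 0" if "U z = 0" for z
  proof -
    have "\<forall>\<^sub>F w in at z. U w \<noteq> 0"
    proof -
      have "\<forall>\<^sub>F w in at z. U w * F w = G w" using UF by (simp add: eventually_cosparse_open_eq)
      with at(5)[of z] show ?thesis by eventually_elim auto
    qed
    then have "\<exists>\<^sub>F w in at z. U w \<noteq> 0" by (intro eventually_frequently) auto
    then have "zorder U z \<noteq> 0"
      using zorder_eq_0_iff[OF U_ana] that by blast
    then have "zorder \<phi> z \<noteq> 0" unfolding U_def using iso by simp
    then have "zorder G z = 0" using zo[of z] G0[of z] nat_eq[of z] by linarith
    then show ?thesis using zorder_eq_0_iff[OF at(3) fr(2)] by blast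
  qed
  then show ?thesis using that U UF by blast
qed

section \<open>Difference quotients on circles\<close>

text \<open>The exponent is \<open>2 * sqrt y\<close> rather than \<open>y\<close> because for
  \<open>y = |t| / d\<close> it leads to \<open>1 / sqrt d\<close>, whose integral over the radii is
  finite, unlike that of \<open>1 / d\<close>.\<close>

lemma one_plus_le_exp_sqrt:
  assumes "y \<ge> (0::real)"
  shows "1 + y \<le> exp (2 * sqrt y)"
proof -
  have "1 + y \<le> (1 + sqrt y)\<^sup>2" using assms by (simp add: power2_sum)
  also have "\<dots> \<le> (exp (sqrt y))\<^sup>2" using assms by (intro power_mono exp_ge_add_one_self) auto
  also have "\<dots> = exp (2 * sqrt y)" by (simp add: power2_eq_square flip: exp_add)
  finally show ?thesis .
qed

text \<open>Only distances between moduli enter, so the bound is uniform on a circle and its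
  exponent is the sum controlled by \<open>good_radius\<close>.\<close>

lemma norm_prod_shift_le:
  fixes z t :: complex
  assumes "D > 0" "\<And>p. p \<in> set ps \<Longrightarrow> norm p \<noteq> norm z"
  shows "norm (\<Prod>p\<leftarrow>ps. (z + t - p) / complex_of_real D)
    \<le> exp (2 * sqrt (norm t) * (\<Sum>p\<leftarrow>ps. 1 / sqrt \<bar>norm z - norm p\<bar>)) * norm (\<Prod>p\<leftarrow>ps. (z - p) / complex_of_real D)"
  using assms(2)
proof (induction ps)
  case (Cons p ps)
  define d where "d = \<bar>norm z - norm p\<bar>"
  have d: "d > 0" "d \<le> norm (z - p)"
    using Cons.prems[of p] norm_triangle_ineq3[of z p] by (auto simp: d_def)
  have "norm (z + t - p) \<le> norm (z - p) + norm t"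
    using norm_triangle_ineq[of "z - p" t] by (simp add: algebra_simps)
  also have "norm t = norm t / d * d" using d by simp
  also have "norm t / d * d \<le> norm t / d * norm (z - p)" using d by (intro mult_left_mono) auto
  also have "norm (z - p) + norm t / d * norm (z - p) = (1 + norm t / d) * norm (z - p)" by (simp add: algebra_simps)
  also have "\<dots> \<le> exp (2 * sqrt (norm t / d)) * norm (z - p)"
    using d by (intro mult_right_mono one_plus_le_exp_sqrt) auto
  finally have "norm (z + t - p) / D \<le> exp (2 * sqrt (norm t / d)) * norm (z - p) / D"
    using assms(1) by (intro divide_right_mono) auto
  then have 1: "norm ((z + t - p) / complex_of_real D) \<le> exp (2 * sqrt (norm t) * (1 / sqrt d)) * norm ((z - p) / complex_of_real D)"
    by (simp add: norm_divide_pos[OF assms(1)] real_sqrt_divide)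
  have 2: "norm (\<Prod>p\<leftarrow>ps. (z + t - p) / complex_of_real D)
    \<le> exp (2 * sqrt (norm t) * (\<Sum>p\<leftarrow>ps. 1 / sqrt \<bar>norm z - norm p\<bar>)) * norm (\<Prod>p\<leftarrow>ps. (z - p) / complex_of_real D)"
    using Cons by auto
  have "norm (\<Prod>p\<leftarrow>p # ps. (z + t - p) / complex_of_real D) =
      norm ((z + t - p) / complex_of_real D) * norm (\<Prod>p\<leftarrow>ps. (z + t - p) / complex_of_real D)"
    by (simp only: list.map prod_list.Cons norm_mult)
  also have "\<dots> \<le> (exp (2 * sqrt (norm t) * (1 / sqrt d)) * norm ((z - p) / complex_of_real D)) *
      (exp (2 * sqrt (norm t) * (\<Sum>p\<leftarrow>ps. 1 / sqrt \<bar>norm z - norm p\<bar>)) * norm (\<Prod>p\<leftarrow>ps. (z - p) / complex_of_real D))"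
    by (rule mult_mono[OF 1 2]) auto
  also have "\<dots> = exp (2 * sqrt (norm t) * (1 / sqrt d) + 2 * sqrt (norm t) * (\<Sum>p\<leftarrow>ps. 1 / sqrt \<bar>norm z - norm p\<bar>)) *
      (norm ((z - p) / complex_of_real D) * norm (\<Prod>p\<leftarrow>ps. (z - p) / complex_of_real D))"
    by (simp only: exp_add mult_ac)
  also have "2 * sqrt (norm t) * (1 / sqrt d) + 2 * sqrt (norm t) * (\<Sum>p\<leftarrow>ps. 1 / sqrt \<bar>norm z - norm p\<bar>) =
      2 * sqrt (norm t) * (\<Sum>p\<leftarrow>p # ps. 1 / sqrt \<bar>norm z - norm p\<bar>)"
    by (simp add: d_def algebra_simps)
  also have "norm ((z - p) / complex_of_real D) * norm (\<Prod>p\<leftarrow>ps. (z - p) / complex_of_real D) =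
      norm (\<Prod>p\<leftarrow>p # ps. (z - p) / complex_of_real D)"
    by (simp only: list.map prod_list.Cons norm_mult)
  finally show ?case .
qed simp

lemma norm_fwd_diff_le:
  assumes "\<And>k. k \<le> n \<Longrightarrow> norm (F (z + of_nat k * c)) \<le> X"
  shows "norm ((fwd_diff c ^^ n) F z) \<le> 2 ^ n * X"
  using assms
proof (induction n arbitrary: z)
  case (Suc n)
  have 1: "norm ((fwd_diff c ^^ n) F z) \<le> 2 ^ n * X" using Suc.prems by (intro Suc.IH) auto
  have 2: "norm ((fwd_diff c ^^ n) F (z + c)) \<le> 2 ^ n * X"
  proof (rule Suc.IH)
    fix k assume "k \<le> n"
    then show "norm (F (z + c + of_nat k * c)) \<le> X"
      using Suc.prems[of "Suc k"] by (simp add: algebra_simps)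
  qed
  have "(fwd_diff c ^^ Suc n) F z = (fwd_diff c ^^ n) F (z + c) - (fwd_diff c ^^ n) F z"
    by (simp add: fwd_diff_def)
  then show ?case using 1 2 norm_triangle_ineq4[of "(fwd_diff c ^^ n) F (z + c)" "(fwd_diff c ^^ n) F z"]
    by (simp only: power_Suc)
qed (use assms[of 0] in simp)

lemma shift_ratio_bound:
  fixes h :: "complex \<Rightarrow> complex"
  assumes D: "D > 0"
    and hk: "\<And>z. h z = (\<Prod>p\<leftarrow>ps. (z - p) / of_real D) * k z"
    and kb: "norm (k (z + t)) \<le> E * norm (k z)"
    and ne: "\<And>p. p \<in> set ps \<Longrightarrow> norm p \<noteq> norm z"
    and sum: "2 * sqrt (norm t) * (\<Sum>p\<leftarrow>ps. 1 / sqrt \<bar>norm z - norm p\<bar>) \<le> M"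
  shows "norm (h (z + t)) \<le> exp M * E * norm (h z)"
proof -
  have "norm (h (z + t)) = norm (\<Prod>p\<leftarrow>ps. (z + t - p) / of_real D) * norm (k (z + t))"
    by (simp only: hk norm_mult)
  also have "\<dots> \<le> (exp M * norm (\<Prod>p\<leftarrow>ps. (z - p) / of_real D)) * (E * norm (k z))"
  proof (rule mult_mono[OF _ kb])
    have "norm (\<Prod>p\<leftarrow>ps. (z + t - p) / complex_of_real D)
      \<le> exp (2 * sqrt (norm t) * (\<Sum>p\<leftarrow>ps. 1 / sqrt \<bar>norm z - norm p\<bar>)) * norm (\<Prod>p\<leftarrow>ps. (z - p) / complex_of_real D)"
      by (rule norm_prod_shift_le[OF D ne])
    also have "\<dots> \<le> exp M * norm (\<Prod>p\<leftarrow>ps. (z - p) / complex_of_real D)"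
      using sum by (intro mult_right_mono) auto
    finally show "norm (\<Prod>p\<leftarrow>ps. (z + t - p) / complex_of_real D) \<le> exp M * norm (\<Prod>p\<leftarrow>ps. (z - p) / complex_of_real D)" .
  qed auto
  also have "\<dots> = exp M * E * norm (h z)" by (simp only: hk norm_mult mult_ac)
  finally show ?thesis .
qed

text \<open>The difference analogue of the lemma on the logarithmic derivative, on a single circle.\<close>

lemma difference_quotient_circle:
  fixes G U s :: "complex \<Rightarrow> complex" and c :: complex and n :: nat
  assumes hol: "G holomorphic_on UNIV" "U holomorphic_on UNIV" "s holomorphic_on UNIV"
    and R: "R > 0" and B: "B > 0"
    and GB: "\<And>z. norm z \<le> R \<Longrightarrow> norm (G z) \<le> exp B"
    and UB: "\<And>z. norm z \<le> R \<Longrightarrow> norm (U z) \<le> exp B"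
    and z0: "norm z0 \<le> R / 16" "norm (G z0) \<ge> exp (- B)" "norm (U z0) \<ge> exp (- B)"
    and T: "T = real (n + 1) * norm c" "T \<le> R / 100"
    and sF: "\<And>z. (\<And>k. k \<le> n + 1 \<Longrightarrow> U (z + of_nat k * c) \<noteq> 0) \<Longrightarrow> G z \<noteq> 0 \<Longrightarrow>
      s z * (G z / U z) = (fwd_diff c ^^ (n + 1)) (\<lambda>z. G z / U z) z - (fwd_diff c ^^ n) (\<lambda>z. G z / U z) z"
    and z: "norm z \<le> R / 100"
  shows "norm (s z) \<le> 2 ^ (n + 2) * exp (1200 * B * T / R + 1000 * sqrt T * real (n + 3) * B / sqrt R)"
proof -
  obtain ps k where ps: "real (length ps) \<le> 3 * B"
    and Gk: "\<And>z. G z = (\<Prod>p\<leftarrow>ps. (z - p) / of_real (3 * R / 4)) * k z"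
    and knz: "\<And>z. norm z \<le> R / 16 \<Longrightarrow> norm (k z) \<ge> exp (- 20 * B)"
    and kd: "\<And>z t. norm z \<le> R / 32 \<Longrightarrow> norm (z + t) \<le> R / 32 \<Longrightarrow>
       norm (k (z + t)) \<le> exp (600 * B * norm t / R) * norm (k z)"
    using zeros_structure[OF hol(1) open_UNIV connected_UNIV subset_UNIV R B GB z0(1,2)] by (metis UNIV_I)
  obtain us l where us: "real (length us) \<le> 3 * B"
    and Ul: "\<And>z. U z = (\<Prod>p\<leftarrow>us. (z - p) / of_real (3 * R / 4)) * l z"
    and lnz: "\<And>z. norm z \<le> R / 16 \<Longrightarrow> norm (l z) \<ge> exp (- 20 * B)"
    and ld: "\<And>z t. norm z \<le> R / 32 \<Longrightarrow> norm (z + t) \<le> R / 32 \<Longrightarrow>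
       norm (l (z + t)) \<le> exp (600 * B * norm t / R) * norm (l z)"
    using zeros_structure[OF hol(2) open_UNIV connected_UNIV subset_UNIV R B UB z0(1,3)] by (metis UNIV_I)
  \<comment> \<open>\<open>ush j\<close> lists the split-off zeros of \<open>U (z + j * c)\<close>.
    One circle has to keep away from the zeros of \<open>G\<close> and from \<open>n + 2\<close>
    such lists, which explains the factor \<open>n + 3\<close>.\<close>
  define ush where "ush = (\<lambda>j::nat. map (\<lambda>u. u - of_nat j * c) us)"
  define xs where "xs = map norm ps @ concat (map (\<lambda>j. map norm (ush j)) [0..<n + 2])"
  have len_xs: "real (length xs) \<le> real (n + 3) * (3 * B)"
  proof -
    have "length xs = length ps + (n + 2) * length us"
      by (simp add: xs_def ush_def length_concat o_def sum_list_triv)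
    then have "real (length xs) = real (length ps) + real (n + 2) * real (length us)" by (simp only: of_nat_add of_nat_mult)
    also have "\<dots> \<le> 3 * B + real (n + 2) * (3 * B)" using ps us by (intro add_mono mult_left_mono) auto
    also have "\<dots> = real (n + 3) * (3 * B)" by (simp add: algebra_simps)
    finally show ?thesis .
  qed
  have "R / 100 > 0" using R by simp
  from good_radius[OF this countable_empty, of xs] obtain r where
    r: "R / 100 \<le> r" "r \<le> 2 * (R / 100)" "r \<notin> set xs"
    and sumr: "(\<Sum>x\<leftarrow>xs. 1 / sqrt \<bar>r - x\<bar>) \<le> 6 * length xs / sqrt (R / 100)"
    by metis
  define \<Sigma> where "\<Sigma> = (\<Sum>x\<leftarrow>xs. 1 / sqrt \<bar>r - x\<bar>)"
  have "\<Sigma> \<le> 6 * (real (n + 3) * (3 * B)) / sqrt (R / 100)"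
  proof -
    have "6 * real (length xs) / sqrt (R / 100) \<le> 6 * (real (n + 3) * (3 * B)) / sqrt (R / 100)"
      using R len_xs by (intro divide_right_mono mult_left_mono) auto
    then show ?thesis using sumr unfolding \<Sigma>_def by simp
  qed
  also have "\<dots> = 180 * real (n + 3) * B / sqrt R" by (simp add: real_sqrt_divide)
  finally have \<Sigma>: "\<Sigma> \<le> 180 * real (n + 3) * B / sqrt R" .
  have part: "(\<Sum>x\<leftarrow>ys. 1 / sqrt \<bar>r - x\<bar>) \<ge> 0" for ys by (induction ys) auto
  have split: "(\<Sum>x\<leftarrow>xs. 1 / sqrt \<bar>r - x\<bar>) = (\<Sum>x\<leftarrow>map norm ps. 1 / sqrt \<bar>r - x\<bar>)
     + (\<Sum>j\<leftarrow>[0..<n + 2]. \<Sum>x\<leftarrow>map norm (ush j). 1 / sqrt \<bar>r - x\<bar>)"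
  proof -
    have "(\<Sum>x\<leftarrow>concat (map g js). 1 / sqrt \<bar>r - x\<bar>) = (\<Sum>j\<leftarrow>js. \<Sum>x\<leftarrow>g j. 1 / sqrt \<bar>r - x\<bar>)"
      for g :: "nat \<Rightarrow> real list" and js by (induction js) auto
    then show ?thesis unfolding xs_def by (simp only: map_append sum_list_append)
  qed
  have \<Sigma>ps: "(\<Sum>p\<leftarrow>ps. 1 / sqrt \<bar>r - norm p\<bar>) \<le> \<Sigma>"
  proof -
    have *: "(\<Sum>j\<leftarrow>js. \<Sum>x\<leftarrow>map norm (ush j). 1 / sqrt \<bar>r - x\<bar>) \<ge> 0" for js
      by (rule sum_list_nonneg) (use part in \<open>auto simp del: map_map\<close>)
    show ?thesis unfolding \<Sigma>_def split using *[of "[0..<n + 2]"]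
      by (simp add: o_def del: upt_Suc add_2_eq_Suc')
  qed
  have \<Sigma>us: "(\<Sum>p\<leftarrow>ush j. 1 / sqrt \<bar>r - norm p\<bar>) \<le> \<Sigma>" if "j \<le> n + 1" for j
  proof -
    have "(\<Sum>x\<leftarrow>map norm (ush j). 1 / sqrt \<bar>r - x\<bar>) \<le> (\<Sum>j\<leftarrow>[0..<n + 2]. \<Sum>x\<leftarrow>map norm (ush j). 1 / sqrt \<bar>r - x\<bar>)"
    proof (rule member_le_sum_list)
      show "(\<Sum>x\<leftarrow>map norm (ush j). 1 / sqrt \<bar>r - x\<bar>) \<in> set (map (\<lambda>j. \<Sum>x\<leftarrow>map norm (ush j). 1 / sqrt \<bar>r - x\<bar>) [0..<n + 2])"
        using that by (auto simp del: upt_Suc)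
    qed (use part in \<open>auto simp del: map_map\<close>)
    then show ?thesis unfolding \<Sigma>_def split using part[of "map norm ps"]
      by (simp add: o_def del: upt_Suc add_2_eq_Suc')
  qed
  define M where "M = 2 * sqrt T * \<Sigma>"
  define E where "E = exp (600 * B * T / R)"
  have T0: "T \<ge> 0" using T(1) by simp
  have nt: "norm (of_nat j * c) \<le> T" if "j \<le> n + 1" for j
    unfolding T(1) norm_mult using that by (intro mult_right_mono) auto
  have \<Sigma>0: "\<Sigma> \<ge> 0" using part[of xs] by (simp add: \<Sigma>_def)
  have bnd: "norm (s w) \<le> 2 ^ (n + 2) * (exp M * E * (exp M * E))" if w: "norm w = r" for w
  proof -
    have wR: "norm w \<le> R / 50" using w r by simp
    \<comment> \<open>\<open>R / 50 + R / 100 = 3 * R / 100 <= R / 32\<close>, so all shifted points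
      stay where the zero-free factors are controlled.\<close>
    have wt: "norm (w + of_nat j * c) \<le> R / 32" "norm w \<le> R / 32" "norm (w + of_nat j * c) \<le> R / 16" if "j \<le> n + 1" for j
      using norm_triangle_ineq[of w "of_nat j * c"] nt[OF that] wR T(2) R by auto
    have ne: "norm p \<noteq> norm w" if "p \<in> set ps \<or> (\<exists>j\<le>n + 1. p \<in> set (ush j))" for p
    proof
      assume "norm p = norm w"
      have "p \<in> set ps \<union> (\<Union>j\<in>{0..<n + 2}. set (ush j))"
        using that less_Suc_eq_le[of _ "n + 1"] by (metis UN_iff Un_iff add_Suc_right atLeastLessThan_iff one_add_one plus_1_eq_Suc le0)
      then have "norm p \<in> norm ` (set ps \<union> (\<Union>j\<in>{0..<n + 2}. set (ush j)))" by (rule imageI)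
      then have "r \<in> norm ` (set ps \<union> (\<Union>j\<in>{0..<n + 2}. set (ush j)))"
        using \<open>norm p = norm w\<close> w by simp
      moreover have "norm ` (set ps \<union> (\<Union>j\<in>{0..<n + 2}. set (ush j))) \<subseteq> set xs"
        unfolding xs_def by (auto simp del: upt_Suc)
      ultimately show False using r(3) by blast
    qed
    have G: "norm (G (w + of_nat j * c)) \<le> exp M * E * norm (G w)" if j: "j \<le> n + 1" for j
    proof (rule shift_ratio_bound[OF _ Gk])
      have "exp (600 * B * norm (of_nat j * c) / R) \<le> E"
        unfolding E_def using B R nt[OF j] by (auto intro!: divide_right_mono mult_left_mono)
      then show "norm (k (w + of_nat j * c)) \<le> E * norm (k w)"
        using kd[OF wt(2,1)[OF j]] by (meson mult_right_mono norm_ge_zero order_trans)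
      show "2 * sqrt (norm (of_nat j * c)) * (\<Sum>p\<leftarrow>ps. 1 / sqrt \<bar>norm w - norm p\<bar>) \<le> M"
        unfolding M_def w using nt[OF j] \<Sigma>ps \<Sigma>0 part[of "map norm ps"]
        using T0 by (intro mult_mono) (auto simp: o_def)
    qed (use R ne in auto)
    have U: "norm (U w) \<le> exp M * E * norm (U (w + of_nat j * c))" if j: "j \<le> n + 1" for j
    proof -
      define h where "h = (\<lambda>z. U (z + of_nat j * c))"
      \<comment> \<open>The denominator \<open>U (w + j * c)\<close> needs a lower bound. It is
        obtained as an upper bound for shifting back by \<open>j * c\<close>, applied to
        \<open>h\<close>, whose zeros are in \<open>ush j\<close>.\<close>
      have "norm (h (w + (- (of_nat j * c)))) \<le> exp M * E * norm (h w)"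
      proof (rule shift_ratio_bound[where ps = "ush j" and k = "\<lambda>z. l (z + of_nat j * c)" and D = "3 * R / 4"])
        show "h z = (\<Prod>p\<leftarrow>ush j. (z - p) / complex_of_real (3 * R / 4)) * l (z + of_nat j * c)" for z
          unfolding h_def Ul ush_def by (simp add: o_def algebra_simps)
        have "exp (600 * B * norm (- (of_nat j * c)) / R) \<le> E"
          unfolding E_def norm_minus_cancel using B R nt[OF j] by (auto intro!: divide_right_mono mult_left_mono)
        moreover have "norm (l (w + of_nat j * c + - (of_nat j * c))) \<le>
            exp (600 * B * norm (- (of_nat j * c)) / R) * norm (l (w + of_nat j * c))"
          by (rule ld) (use wt[OF j] in auto)
        ultimately show "norm (l (w + - (of_nat j * c) + of_nat j * c)) \<le> E * norm (l (w + of_nat j * c))"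
          using mult_right_mono[of "exp (600 * B * norm (- (of_nat j * c)) / R)" E "norm (l (w + of_nat j * c))"] by simp
        show "2 * sqrt (norm (- (of_nat j * c))) * (\<Sum>p\<leftarrow>ush j. 1 / sqrt \<bar>norm w - norm p\<bar>) \<le> M"
          unfolding M_def w norm_minus_cancel using nt[OF j] \<Sigma>us[OF j] \<Sigma>0 part[of "map norm (ush j)"]
          using T0 by (intro mult_mono) (auto simp: o_def)
        show "norm p \<noteq> norm w" if "p \<in> set (ush j)" for p using ne j that by blast
      qed (use R in auto)
      then show ?thesis by (simp add: h_def)
    qed
    have Gnz: "G w \<noteq> 0"
    proof
      assume "G w = 0"
      then have "(\<Prod>p\<leftarrow>ps. (w - p) / of_real (3 * R / 4)) = 0 \<or> k w = 0" using Gk by (metis mult_eq_0_iff)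
      moreover have "k w \<noteq> 0" using knz[OF wt(3)[of 0]] knz[of w] wR R by auto
      ultimately have "w \<in> set ps" using R by (auto simp: prod_list_zero_iff)
      then show False using ne by blast
    qed
    have Unz: "U (w + of_nat j * c) \<noteq> 0" if j: "j \<le> n + 1" for j
    proof
      assume "U (w + of_nat j * c) = 0"
      then have "(\<Prod>p\<leftarrow>us. (w + of_nat j * c - p) / of_real (3 * R / 4)) = 0 \<or> l (w + of_nat j * c) = 0"
        using Ul by (metis mult_eq_0_iff)
      moreover have "l (w + of_nat j * c) \<noteq> 0" using lnz[OF wt(3)[OF j]] by auto
      ultimately have "0 \<in> (\<lambda>p. (w + of_nat j * c - p) / of_real (3 * R / 4)) ` set us"
        by (simp only: prod_list_zero_iff set_map) blast
      then obtain p where "p \<in> set us" "(w + of_nat j * c - p) / of_real (3 * R / 4) = 0" by force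
      then have "w + of_nat j * c \<in> set us" using R by (simp only: divide_eq_0_iff) auto
      then have "w \<in> set (ush j)" unfolding ush_def by force
      then show False using ne j by blast
    qed
    define F where "F = (\<lambda>z. G z / U z)"
    define X where "X = exp M * E * (exp M * E) * norm (F w)"
    have Fk: "norm (F (w + of_nat j * c)) \<le> X" if j: "j \<le> n + 1" for j
    proof -
      have "norm (U w) > 0" using Unz[of 0] by simp
      moreover have "norm (U (w + of_nat j * c)) > 0" using Unz[OF j] by simp
      moreover have "norm (G (w + of_nat j * c)) * norm (U w) \<le>
          (exp M * E * norm (G w)) * (exp M * E * norm (U (w + of_nat j * c)))"
        using G[OF j] U[OF j] by (intro mult_mono) (auto simp: E_def)
      ultimately show ?thesis unfolding X_def F_def norm_divide by (simp add: field_simps)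
    qed
    have d1: "norm ((fwd_diff c ^^ (n + 1)) F w) \<le> 2 ^ (n + 1) * X" by (rule norm_fwd_diff_le) (rule Fk)
    have d2: "norm ((fwd_diff c ^^ n) F w) \<le> 2 ^ n * X" by (rule norm_fwd_diff_le) (rule Fk, simp)
    have "X \<ge> 0" by (simp add: X_def E_def)
    then have d3: "2 ^ n * X \<le> 2 ^ (n + 1) * X" by (intro mult_right_mono) auto
    have "s w * F w = (fwd_diff c ^^ (n + 1)) F w - (fwd_diff c ^^ n) F w"
      unfolding F_def by (rule sF[OF Unz Gnz])
    then have "norm (s w * F w) \<le> norm ((fwd_diff c ^^ (n + 1)) F w) + norm ((fwd_diff c ^^ n) F w)"
      by (simp only: norm_triangle_ineq4)
    then have "norm (s w * F w) \<le> 2 ^ (n + 1) * X + 2 ^ (n + 1) * X"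
      using d1 d2 d3 by linarith
    then have "norm (s w) * norm (F w) \<le> (2 ^ (n + 2) * (exp M * E * (exp M * E))) * norm (F w)"
      by (simp add: norm_mult X_def algebra_simps)
    moreover have "norm (F w) > 0" using Gnz Unz[of 0] by (simp add: F_def)
    ultimately show ?thesis by (simp only: mult_le_cancel_right_pos)
  qed
  have r0: "r > 0" using r R by linarith
  \<comment> \<open>Since \<open>s\<close> is entire, the bound on this one circle extends to the
    disc inside, including the zeros of \<open>G\<close> and \<open>U\<close>.\<close>
  have "norm (s z) \<le> 2 ^ (n + 2) * (exp M * E * (exp M * E))"
    by (rule max_modulus_cball[of s UNIV 0 r, OF hol(3) subset_UNIV r0]) (use bnd z r in auto)
  also have "exp M * E * (exp M * E) = exp (2 * M + 1200 * B * T / R)"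
    unfolding E_def by (simp flip: exp_add)
  also have "\<dots> \<le> exp (1200 * B * T / R + 1000 * sqrt T * real (n + 3) * B / sqrt R)"
  proof -
    have "2 * M \<le> 4 * sqrt T * (180 * real (n + 3) * B / sqrt R)"
      unfolding M_def using mult_left_mono[OF \<Sigma>, of "4 * sqrt T"] T0 by simp
    also have "\<dots> \<le> 1000 * sqrt T * real (n + 3) * B / sqrt R"
    proof -
      define y where "y = sqrt T * (real (n + 3) * B / sqrt R)"
      have "0 \<le> y" using T0 B R unfolding y_def by (intro mult_nonneg_nonneg divide_nonneg_pos) auto
      have e1: "4 * sqrt T * (180 * real (n + 3) * B / sqrt R) = 720 * y" unfolding y_def by simp
      have e2: "1000 * sqrt T * real (n + 3) * B / sqrt R = 1000 * y" unfolding y_def by simp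
      show ?thesis unfolding e1 e2 using \<open>0 \<le> y\<close> by simp
    qed
    finally show ?thesis by simp
  qed
  finally show ?thesis by simp
qed

section \<open>Growth along a sequence of radii\<close>

lemma fwd_diff_Suc:
  "(fwd_diff c ^^ Suc n) f z = (fwd_diff c ^^ n) f (z + c) - (fwd_diff c ^^ n) f z"
  by (simp add: fwd_diff_def)

locale scales =
  fixes \<rho> \<Lambda> :: "nat \<Rightarrow> real"
  assumes rho: "filterlim \<rho> at_top sequentially" and Lam: "filterlim \<Lambda> at_top sequentially"
begin

text \<open>The factor \<open>\<tau>\<close> is explicit because divisions and shifts shrink the
  disc.\<close>

definition grows :: "real \<Rightarrow> (nat \<Rightarrow> real) \<Rightarrow> (complex \<Rightarrow> complex) \<Rightarrow> bool" where
  "grows \<tau> \<phi> h \<longleftrightarrow> (\<forall>\<^sub>F i in sequentially. \<forall>z. norm z \<le> \<tau> * \<rho> i \<longrightarrow> norm (h z) \<le> exp (\<phi> i))"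

text \<open>The substitute for \<open>S(r, f)\<close>: in the application
  \<open>exp (\<Lambda> i)\<close> is the maximum modulus of \<open>f\<close> on the disc of radius
  \<open>\<rho> i\<close>.\<close>

definition small :: "real \<Rightarrow> (complex \<Rightarrow> complex) \<Rightarrow> bool" where
  "small \<tau> h \<longleftrightarrow> (\<forall>\<epsilon>>0. grows \<tau> (\<lambda>i. \<epsilon> * \<Lambda> i) h)"

lemma rho_ge: "\<forall>\<^sub>F i in sequentially. X \<le> \<rho> i"
  using rho by (simp add: filterlim_at_top)

lemma Lam_ge: "\<forall>\<^sub>F i in sequentially. X \<le> \<Lambda> i"
  using Lam by (simp add: filterlim_at_top)

lemma grows_mono:
  assumes "grows \<tau> \<phi> h" "\<tau>' \<le> \<tau>" "\<forall>\<^sub>F i in sequentially. \<phi> i \<le> \<psi> i"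
  shows "grows \<tau>' \<psi> h"
  using assms(1)[unfolded grows_def] assms(3) rho_ge[of 0] unfolding grows_def
proof eventually_elim
  case (elim i)
  show ?case
  proof (intro allI impI)
    fix z :: complex assume "norm z \<le> \<tau>' * \<rho> i"
    also have "\<dots> \<le> \<tau> * \<rho> i" using assms(2) elim by (intro mult_right_mono) auto
    finally have "norm (h z) \<le> exp (\<phi> i)" using elim by blast
    also have "\<dots> \<le> exp (\<psi> i)" using elim by simp
    finally show "norm (h z) \<le> exp (\<psi> i)" .
  qed
qed

lemma small_mono: "small \<tau> h \<Longrightarrow> \<tau>' \<le> \<tau> \<Longrightarrow> small \<tau>' h"
  unfolding small_def using grows_mono[of \<tau> _ h \<tau>'] by auto

lemma eventually_small_le:
  assumes "\<epsilon> > 0"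
  shows "\<forall>\<^sub>F i in sequentially. C \<le> \<epsilon> * \<Lambda> i"
  using Lam_ge[of "C / \<epsilon>"] by eventually_elim (use assms in \<open>simp add: pos_divide_le_eq mult.commute\<close>)

lemma small_bounded:
  assumes "\<And>z. norm (h z) \<le> X"
  shows "small \<tau> h"
  unfolding small_def
proof (intro allI impI)
  fix \<epsilon> :: real assume "\<epsilon> > 0"
  from eventually_small_le[OF this, of "ln (max 1 X)"]
  show "grows \<tau> (\<lambda>i. \<epsilon> * \<Lambda> i) h" unfolding grows_def
  proof eventually_elim
    case (elim i)
    have "exp (ln (max 1 X)) = max 1 X" by (rule exp_ln) simp
    then have "X \<le> exp (ln (max 1 X))" by simp
    also have "\<dots> \<le> exp (\<epsilon> * \<Lambda> i)" using elim by (simp only: exp_le_cancel_iff)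
    finally show ?case using assms order_trans by blast
  qed
qed

lemma grows_mult:
  assumes "grows \<tau> \<phi> f" "grows \<tau> \<psi> g"
  shows "grows \<tau> (\<lambda>i. \<phi> i + \<psi> i) (\<lambda>z. f z * g z)"
  using assms[unfolded grows_def] unfolding grows_def
  by eventually_elim (auto simp: norm_mult exp_add intro!: mult_mono)

lemma grows_add:
  assumes "grows \<tau> \<phi> f" "grows \<tau> \<phi> g"
  shows "grows \<tau> (\<lambda>i. \<phi> i + 1) (\<lambda>z. f z + g z)"
  using assms[unfolded grows_def] unfolding grows_def
proof eventually_elim
  case (elim i)
  show ?case
  proof (intro allI impI)
    fix z :: complex assume z: "norm z \<le> \<tau> * \<rho> i"
    have "norm (f z + g z) \<le> exp (\<phi> i) * 2"
      using norm_triangle_ineq[of "f z" "g z"] elim z by force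
    also have "\<dots> \<le> exp (\<phi> i) * exp 1"
      using exp_ge_add_one_self[of 1] by (intro mult_left_mono) auto
    finally show "norm (f z + g z) \<le> exp (\<phi> i + 1)" by (simp add: exp_add)
  qed
qed

lemma small_mult:
  assumes "small \<tau> f" "small \<tau> g"
  shows "small \<tau> (\<lambda>z. f z * g z)"
  unfolding small_def
proof (intro allI impI)
  fix \<epsilon> :: real assume "\<epsilon> > 0"
  then have "grows \<tau> (\<lambda>i. \<epsilon> / 2 * \<Lambda> i) f" "grows \<tau> (\<lambda>i. \<epsilon> / 2 * \<Lambda> i) g"
    using assms half_gt_zero[of \<epsilon>] unfolding small_def by blast+
  from grows_mult[OF this] show "grows \<tau> (\<lambda>i. \<epsilon> * \<Lambda> i) (\<lambda>z. f z * g z)" by (simp add: field_simps)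
qed

lemma small_add:
  assumes "small \<tau> f" "small \<tau> g"
  shows "small \<tau> (\<lambda>z. f z + g z)"
  unfolding small_def
proof (intro allI impI)
  fix \<epsilon> :: real assume \<epsilon>: "\<epsilon> > 0"
  then have "grows \<tau> (\<lambda>i. \<epsilon> / 2 * \<Lambda> i) f" "grows \<tau> (\<lambda>i. \<epsilon> / 2 * \<Lambda> i) g"
    using assms half_gt_zero[of \<epsilon>] unfolding small_def by blast+
  from grows_add[OF this] show "grows \<tau> (\<lambda>i. \<epsilon> * \<Lambda> i) (\<lambda>z. f z + g z)"
  proof (rule grows_mono)
    show "\<forall>\<^sub>F i in sequentially. \<epsilon> / 2 * \<Lambda> i + 1 \<le> \<epsilon> * \<Lambda> i"
      using eventually_small_le[of "\<epsilon> / 2" 1] \<epsilon> by (auto elim!: eventually_mono)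
  qed simp
qed

lemma grows_minus: "grows \<tau> \<phi> f \<Longrightarrow> grows \<tau> \<phi> (\<lambda>z. - f z)"
  by (simp add: grows_def)

lemma small_diff:
  assumes "small \<tau> f" "small \<tau> g"
  shows "small \<tau> (\<lambda>z. f z - g z)"
  using small_add[OF assms(1), of "\<lambda>z. - g z"] assms(2) grows_minus[of \<tau> _ g] by (auto simp: small_def)

text \<open>A fixed shift is absorbed by any proportional loss of radius once
  \<open>\<rho> i\<close> is large.\<close>

lemma grows_shift:
  assumes "grows \<tau> \<phi> f" "\<tau>' < \<tau>"
  shows "grows \<tau>' \<phi> (\<lambda>z. f (z + d))"
  using assms(1)[unfolded grows_def] rho_ge[of "norm d / (\<tau> - \<tau>')"] unfolding grows_def
proof eventually_elim
  case (elim i)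
  show ?case
  proof (intro allI impI)
    fix z :: complex assume z: "norm z \<le> \<tau>' * \<rho> i"
    have "norm d \<le> (\<tau> - \<tau>') * \<rho> i" using elim(2) assms(2) by (simp add: pos_divide_le_eq mult.commute)
    then have "norm (z + d) \<le> \<tau> * \<rho> i"
      using z norm_triangle_ineq[of z d] by (simp add: algebra_simps)
    then show "norm (f (z + d)) \<le> exp (\<phi> i)" using elim by blast
  qed
qed

lemma small_shift: "small \<tau> f \<Longrightarrow> \<tau>' < \<tau> \<Longrightarrow> small \<tau>' (\<lambda>z. f (z + d))"
  unfolding small_def using grows_shift by blast

lemma small_prod:
  fixes m :: nat
  assumes "\<And>k. k < m \<Longrightarrow> small \<tau> (f k)"
  shows "small \<tau> (\<lambda>z. \<Prod>k<m. f k z)"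
  using assms
proof (induction m)
  case 0
  show ?case by (rule small_bounded[of _ 1]) simp
next
  case (Suc m)
  then show ?case using small_mult[of \<tau> "\<lambda>z. \<Prod>k<m. f k z" "f m"] by simp
qed

lemma grows_fwd_diff:
  assumes "grows \<tau> \<phi> f" "\<tau>' < \<tau>"
  shows "grows \<tau>' (\<lambda>i. \<phi> i + real n) ((fwd_diff c ^^ n) f)"
proof -
  have "grows \<tau>' (\<lambda>i. \<phi> i + real n) (\<lambda>z. (fwd_diff c ^^ n) f (z + d))" for d
  proof (induction n arbitrary: d)
    case 0
    then show ?case using grows_shift[OF assms] by simp
  next
    case (Suc n)
    have "grows \<tau>' (\<lambda>i. \<phi> i + real n + 1) (\<lambda>z. (fwd_diff c ^^ n) f (z + (d + c)) + - (fwd_diff c ^^ n) f (z + d))"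
      by (intro grows_add grows_minus Suc.IH)
    moreover have "(fwd_diff c ^^ n) f (z + (d + c)) + - (fwd_diff c ^^ n) f (z + d) = (fwd_diff c ^^ Suc n) f (z + d)" for z
      unfolding fwd_diff_Suc by (simp add: add.assoc)
    moreover have "\<phi> i + real n + 1 = \<phi> i + real (Suc n)" for i by simp
    ultimately show ?case by (simp only:)
  qed
  from this[of 0] show ?thesis by simp
qed

text \<open>The losses 16 and 21 are those of \<open>quotient_bound\<close>. A single nonzero value
  of \<open>h2\<close> provides the lower bound required there, because \<open>\<phi>\<close> tends
  to infinity.\<close>

lemma grows_div:
  assumes hol: "h1 holomorphic_on UNIV" "h2 holomorphic_on UNIV" "Q holomorphic_on UNIV"
    and gr: "grows \<tau> \<phi> h1" "grows \<tau> \<phi> h2" and \<phi>: "filterlim \<phi> at_top sequentially" and \<tau>: "\<tau> > 0"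
    and z0: "h2 z0 \<noteq> 0" and eq: "\<And>z. h1 z = Q z * h2 z"
  shows "grows (\<tau> / 16) (\<lambda>i. 21 * \<phi> i) Q"
proof -
  have "\<forall>\<^sub>F i in sequentially. max 1 (- ln (norm (h2 z0))) \<le> \<phi> i"
    using \<phi> unfolding filterlim_at_top by blast
  then show ?thesis
    using gr[unfolded grows_def] rho_ge[of 1] rho_ge[of "16 * norm z0 / \<tau>"] unfolding grows_def
  proof eventually_elim
    case (elim i)
    show ?case
    proof (intro allI impI)
      fix z :: complex assume z: "norm z \<le> \<tau> / 16 * \<rho> i"
      show "norm (Q z) \<le> exp (21 * \<phi> i)"
      proof (rule quotient_bound[OF hol open_UNIV connected_UNIV subset_UNIV])
        show "\<tau> * \<rho> i > 0" "\<phi> i > 0" using elim \<tau> by auto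
        show "norm z0 \<le> \<tau> * \<rho> i / 16" using elim(5) \<tau> by (simp add: field_simps)
        show "norm (h2 z0) \<ge> exp (- \<phi> i)"
        proof -
          have "exp (- \<phi> i) \<le> exp (ln (norm (h2 z0)))" using elim(1) by simp
          then show ?thesis using z0 by simp
        qed
        show "norm z \<le> \<tau> * \<rho> i / 16" using z by simp
      qed (use elim eq in auto)
    qed
  qed
qed

lemma small_div:
  assumes hol: "h1 holomorphic_on UNIV" "h2 holomorphic_on UNIV" "Q holomorphic_on UNIV"
    and gr: "small \<tau> h1" "small \<tau> h2" and \<tau>: "\<tau> > 0"
    and z0: "h2 z0 \<noteq> 0" and eq: "\<And>z. h1 z = Q z * h2 z"
  shows "small (\<tau> / 16) Q"
  unfolding small_def
proof (intro allI impI)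
  fix \<epsilon> :: real assume \<epsilon>: "\<epsilon> > 0"
  have "grows (\<tau> / 16) (\<lambda>i. 21 * (\<epsilon> / 21 * \<Lambda> i)) Q"
  proof (rule grows_div[OF hol _ _ _ \<tau> z0 eq])
    have "\<epsilon> / 21 > 0" using \<epsilon> by simp
    then show "grows \<tau> (\<lambda>i. \<epsilon> / 21 * \<Lambda> i) h1" "grows \<tau> (\<lambda>i. \<epsilon> / 21 * \<Lambda> i) h2"
      using gr unfolding small_def by blast+
    show "filterlim (\<lambda>i. \<epsilon> / 21 * \<Lambda> i) at_top sequentially"
      using eventually_small_le[OF \<open>\<epsilon> / 21 > 0\<close>] by (simp add: filterlim_at_top)
  qed
  then show "grows (\<tau> / 16) (\<lambda>i. \<epsilon> * \<Lambda> i) Q" by simp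
qed

text \<open>The zeros of \<open>exp (poly P z) - 1\<close> are the solutions of \<open>poly P z = 2 * pi * \<i> * k\<close>; there are
  at least about \<open>x ^ degree P\<close> of them in the disc of radius \<open>x\<close>.\<close>

lemma small_exp_poly:
  assumes hol: "s holomorphic_on UNIV" and sm: "small \<tau> s" and \<tau>: "\<tau> > 0" and z0: "s z0 \<noteq> 0"
    and zeros: "\<And>z. exp (poly P z) = 1 \<Longrightarrow> s z = 0"
  shows "small \<tau>' (\<lambda>z. exp (poly P z))"
proof (cases "degree P = 0")
  case True
  then obtain a where "P = [:a:]" by (rule degree_eq_zeroE)
  then show ?thesis by (intro small_bounded[of _ "norm (exp a)"]) simp
next
  case False
  define d where "d = degree P"
  have d: "d > 0" using False by (simp add: d_def)
  define c0 where "c0 = norm (lead_coeff P)"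
  have c0: "c0 > 0" using False by (auto simp: c0_def)
  define a0 where "a0 = norm (poly P 0)"
  obtain C where C: "C > 0" "\<And>z x. norm z \<le> x \<Longrightarrow> x \<ge> 1 \<Longrightarrow> norm (poly P z) \<le> C * x ^ d"
    using norm_poly_le[of P] unfolding d_def by metis
  \<comment> \<open>Compares the radius \<open>\<tau>' * \<rho> i\<close> with
    \<open>x = \<tau> * \<rho> i / 4\<close>; a polynomial changes only by a constant factor, which
    is why smallness of \<open>s\<close> on one disc gives the claim for every
    \<open>\<tau>'\<close>.\<close>
  define q where "q = (max 1 (4 * \<bar>\<tau>'\<bar> / \<tau>)) ^ d"
  have q: "q \<ge> 1" by (simp add: q_def)
  \<comment> \<open>In this form the count of zeros says that \<open>\<rho> i ^ d\<close> is
    \<open>o(\<Lambda> i)\<close>.\<close>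
  have key: "\<forall>\<^sub>F i in sequentially. c0 * (\<tau> * \<rho> i / 4) ^ d \<le> a0 + 2 * pi * (3 * (\<epsilon> * \<Lambda> i) + 1)"
    if \<epsilon>: "\<epsilon> > 0" for \<epsilon>
    using sm[unfolded small_def, rule_format, OF \<epsilon>, unfolded grows_def]
      eventually_small_le[OF \<epsilon>, of "max 1 (- ln (norm (s z0)))"] rho_ge[of 1] rho_ge[of "16 * norm z0 / \<tau>"]
  proof eventually_elim
    case (elim i)
    define x where "x = \<tau> * \<rho> i / 4"
    have x: "x > 0" using elim \<tau> by (simp add: x_def)
    \<comment> \<open>The number of positive integers \<open>m\<close> with
      \<open>2 * pi * m <= c0 * x ^ d - a0\<close>, the range in which
      \<open>poly_root_in_disc\<close> applies.\<close>
    define N where "N = nat \<lfloor>(c0 * x ^ d - a0) / (2 * pi)\<rfloor>"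
    obtain ps k where ps: "real (length ps) \<le> 3 * (\<epsilon> * \<Lambda> i)"
      and sk: "\<And>z. s z = (\<Prod>p\<leftarrow>ps. (z - p) / of_real (3 * (\<tau> * \<rho> i) / 4)) * k z"
      and knz: "\<And>z. z \<in> cball 0 ((\<tau> * \<rho> i) / 4) \<Longrightarrow> k z \<noteq> 0"
    proof (rule zeros_structure[OF hol open_UNIV connected_UNIV subset_UNIV])
      show "\<tau> * \<rho> i > 0" "\<epsilon> * \<Lambda> i > 0" using elim \<tau> by auto
      show "norm z0 \<le> \<tau> * \<rho> i / 16" using elim(4) \<tau> by (simp add: field_simps)
      have "exp (- (\<epsilon> * \<Lambda> i)) \<le> exp (ln (norm (s z0)))" using elim(2) by simp
      then show "norm (s z0) \<ge> exp (- (\<epsilon> * \<Lambda> i))" using z0 by simp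
    qed (use elim in auto)
    have "\<exists>z. norm z \<le> x \<and> poly P z = 2 * pi * \<i> * of_nat m" if m: "m \<in> {1..N}" for m
    proof (rule poly_root_in_disc)
      show "degree P > 0" using d by (simp add: d_def)
      have "int m \<le> \<lfloor>(c0 * x ^ d - a0) / (2 * pi)\<rfloor>" using m unfolding N_def atLeastAtMost_iff by linarith
      then have "real m \<le> real_of_int \<lfloor>(c0 * x ^ d - a0) / (2 * pi)\<rfloor>" by linarith
      also have "\<dots> \<le> (c0 * x ^ d - a0) / (2 * pi)" by simp
      finally have "2 * pi * real m \<le> c0 * x ^ d - a0" by (simp add: pos_le_divide_eq mult.commute)
      moreover have "norm (poly P 0 - 2 * pi * \<i> * of_nat m) \<le> a0 + 2 * pi * real m"
        unfolding a0_def by (rule order_trans[OF norm_triangle_ineq4]) (simp add: norm_mult)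
      ultimately show "norm (poly P 0 - 2 * pi * \<i> * of_nat m) \<le> norm (lead_coeff P) * x ^ degree P"
        by (simp add: c0_def d_def)
    qed (use x in auto)
    then obtain g where g: "\<And>m. m \<in> {1..N} \<Longrightarrow> norm (g m) \<le> x \<and> poly P (g m) = 2 * pi * \<i> * of_nat m"
      by metis
    have "inj_on g {1..N}"
    proof (rule inj_onI)
      fix m m' assume "m \<in> {1..N}" "m' \<in> {1..N}" "g m = g m'"
      then have "2 * pi * \<i> * of_nat m = 2 * pi * \<i> * of_nat m'" using g by metis
      then show "m = m'" by simp
    qed
    moreover have "g ` {1..N} \<subseteq> set ps"
    proof
      fix y assume "y \<in> g ` {1..N}"
      then obtain m where m: "m \<in> {1..N}" "y = g m" by auto
      have "exp (2 * of_real pi * \<i> * of_nat m) = 1"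
        unfolding exp_eq_1 by (auto intro!: exI[of _ "int m"])
      then have "exp (poly P y) = 1" unfolding m(2) using g[OF m(1)] by simp
      then have "s y = 0" by (rule zeros)
      moreover have "k y \<noteq> 0" using knz g[OF m(1)] m(2) by (simp add: x_def)
      ultimately have "(\<Prod>p\<leftarrow>ps. (y - p) / of_real (3 * (\<tau> * \<rho> i) / 4)) = 0" using sk by (metis mult_eq_0_iff)
      then have "0 \<in> (\<lambda>p. (y - p) / of_real (3 * (\<tau> * \<rho> i) / 4)) ` set ps"
        by (simp only: prod_list_zero_iff set_map)
      then obtain p where "p \<in> set ps" "(y - p) / of_real (3 * (\<tau> * \<rho> i) / 4) = 0" by force
      moreover have "\<tau> * \<rho> i \<noteq> 0" using elim \<tau> by auto
      ultimately show "y \<in> set ps" by (simp only: divide_eq_0_iff) auto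
    qed
    ultimately have "card {1..N} \<le> card (set ps)" by (metis card_image card_mono finite_set)
    then have "N \<le> length ps" using card_length[of ps] by simp
    then have "real N \<le> 3 * (\<epsilon> * \<Lambda> i)" using ps by linarith
    moreover have "(c0 * x ^ d - a0) / (2 * pi) \<le> real N + 1"
      unfolding N_def by linarith
    ultimately have "(c0 * x ^ d - a0) / (2 * pi) \<le> 3 * (\<epsilon> * \<Lambda> i) + 1" by linarith
    then have "c0 * x ^ d - a0 \<le> (3 * (\<epsilon> * \<Lambda> i) + 1) * (2 * pi)" by (subst (asm) pos_divide_le_eq) auto
    then show ?case by (simp add: x_def algebra_simps)
  qed
  show ?thesis unfolding small_def
  proof (intro allI impI)
    fix \<epsilon> :: real assume \<epsilon>: "\<epsilon> > 0"
    \<comment> \<open>Makes \<open>(C * q / c0) * 6 * pi * \<delta>\<close> equal to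
      \<open>\<epsilon> / 2\<close>; the constant \<open>a0 + 2 * pi\<close> uses up the other
      half.\<close>
    define \<delta> where "\<delta> = \<epsilon> * c0 / (C * q * (12 * pi))"
    have \<delta>: "\<delta> > 0" using \<epsilon> c0 C q by (simp add: \<delta>_def)
    have "\<epsilon> * c0 / (2 * C * q) > 0" using \<epsilon> c0 C q by simp
    from eventually_small_le[OF this, of "a0 + 2 * pi"] key[OF \<delta>] rho_ge[of "4 / \<tau>"]
    show "grows \<tau>' (\<lambda>i. \<epsilon> * \<Lambda> i) (\<lambda>z. exp (poly P z))" unfolding grows_def
    proof eventually_elim
      case (elim i)
      define x where "x = \<tau> * \<rho> i / 4"
      have x1: "x \<ge> 1" using elim(3) \<tau> by (simp add: x_def field_simps)
      show ?case
      proof (intro allI impI)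
        fix z :: complex assume z: "norm z \<le> \<tau>' * \<rho> i"
        define m where "m = max 1 (4 * \<bar>\<tau>'\<bar> / \<tau>)"
        have "\<rho> i = 4 * x / \<tau>" using \<tau> by (simp add: x_def)
        have "norm z \<le> \<bar>\<tau>'\<bar> * \<rho> i"
          using z elim(3) \<tau> by (smt (verit, best) divide_nonneg_pos mult_right_mono)
        also have "\<dots> = (4 * \<bar>\<tau>'\<bar> / \<tau>) * x" unfolding \<open>\<rho> i = _\<close> by simp
        also have "\<dots> \<le> m * x" using x1 by (intro mult_right_mono) (auto simp: m_def)
        finally have "norm z \<le> m * x" .
        moreover have "m * x \<ge> 1" using x1 mult_mono[of 1 m 1 x] by (simp add: m_def)
        ultimately have "norm (poly P z) \<le> C * (m * x) ^ d" by (rule C(2))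
        also have "\<dots> = C * q * x ^ d" by (simp add: q_def m_def power_mult_distrib)
        also have "\<dots> = (C * q / c0) * (c0 * x ^ d)" using c0 by simp
        also have "\<dots> \<le> (C * q / c0) * (a0 + 2 * pi * (3 * (\<delta> * \<Lambda> i) + 1))"
          using elim(2) C q c0 by (intro mult_left_mono) (auto simp: x_def)
        also have "\<dots> = (C * q / c0) * (a0 + 2 * pi) + \<epsilon> * \<Lambda> i / 2"
          using C q c0 by (simp add: \<delta>_def field_simps)
        also have "\<dots> \<le> (C * q / c0) * (\<epsilon> * c0 / (2 * C * q) * \<Lambda> i) + \<epsilon> * \<Lambda> i / 2"
          using elim(1) C q c0 by (intro add_right_mono mult_left_mono) auto
        also have "\<dots> = \<epsilon> * \<Lambda> i" using C q c0 by (simp add: field_simps)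
        finally have "norm (poly P z) \<le> \<epsilon> * \<Lambda> i" .
        then have "Re (poly P z) \<le> \<epsilon> * \<Lambda> i" using complex_Re_le_cmod order_trans by blast
        then show "norm (exp (poly P z)) \<le> exp (\<epsilon> * \<Lambda> i)" by simp
      qed
    qed
  qed
qed

text \<open>On the circle the exponent is of order \<open>\<phi> i / sqrt (\<rho> i)\<close>. So
  \<open>G\<close> and \<open>U\<close> may grow faster than \<open>f\<close>, provided that
  \<open>\<phi> i\<close> is \<open>o(\<Lambda> i * sqrt (\<rho> i))\<close>.\<close>

lemma small_difference_quotient:
  fixes G U s :: "complex \<Rightarrow> complex" and c :: complex and n :: nat
  assumes hol: "G holomorphic_on UNIV" "U holomorphic_on UNIV" "s holomorphic_on UNIV"
    and gr: "grows \<tau> \<phi> G" "grows \<tau> \<phi> U" and \<tau>: "\<tau> > 0"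
    and \<phi>: "filterlim \<phi> at_top sequentially"
    and \<phi>_small: "\<And>\<epsilon>. \<epsilon> > 0 \<Longrightarrow> \<forall>\<^sub>F i in sequentially. \<phi> i \<le> \<epsilon> * \<Lambda> i * sqrt (\<rho> i)"
    and z0: "G z0 \<noteq> 0" "U z0 \<noteq> 0"
    and sF: "\<And>z. (\<And>k. k \<le> n + 1 \<Longrightarrow> U (z + of_nat k * c) \<noteq> 0) \<Longrightarrow> G z \<noteq> 0 \<Longrightarrow>
      s z * (G z / U z) = (fwd_diff c ^^ (n + 1)) (\<lambda>z. G z / U z) z - (fwd_diff c ^^ n) (\<lambda>z. G z / U z) z"
  shows "small (\<tau> / 100) s"
  unfolding small_def
proof (intro allI impI)
  fix \<epsilon> :: real assume \<epsilon>: "\<epsilon> > 0"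
  define T where "T = real (n + 1) * norm c"
  define K where "K = 1200 * T + 1000 * sqrt T * real (n + 3) + 1"
  have T0: "T \<ge> 0" by (simp add: T_def)
  have K: "K > 0" using T0 unfolding K_def by (intro add_nonneg_pos add_nonneg_nonneg mult_nonneg_nonneg) auto
  \<comment> \<open>Solves \<open>K * \<delta> / sqrt \<tau> = \<epsilon> / 2\<close>; the other
    half of \<open>\<epsilon>\<close> absorbs the factor \<open>2 ^ (n + 2)\<close>.\<close>
  define \<delta> where "\<delta> = \<epsilon> * sqrt \<tau> / (2 * K)"
  have \<delta>: "\<delta> > 0" using \<epsilon> \<tau> K by (simp add: \<delta>_def)
  have "\<forall>\<^sub>F i in sequentially. max 1 (max (- ln (norm (G z0))) (- ln (norm (U z0)))) \<le> \<phi> i"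
    using \<phi> unfolding filterlim_at_top by blast
  then show "grows (\<tau> / 100) (\<lambda>i. \<epsilon> * \<Lambda> i) s"
    using gr[unfolded grows_def] \<phi>_small[OF \<delta>] rho_ge[of 1] rho_ge[of "16 * norm z0 / \<tau>"] rho_ge[of "100 * T / \<tau>"]
      rho_ge[of "1 / \<tau>"] eventually_small_le[OF half_gt_zero[OF \<epsilon>], of "real (n + 2) * ln 2"]
    unfolding grows_def
  proof eventually_elim
    case (elim i)
    define R where "R = \<tau> * \<rho> i"
    have R: "R > 0" "R \<ge> 1" using elim \<tau> by (auto simp: R_def field_simps)
    have B: "\<phi> i \<ge> 1" using elim by auto
    show ?case
    proof (intro allI impI)
      fix z :: complex assume z: "norm z \<le> \<tau> / 100 * \<rho> i"
      have "norm (s z) \<le> 2 ^ (n + 2) * exp (1200 * \<phi> i * T / R + 1000 * sqrt T * real (n + 3) * \<phi> i / sqrt R)"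
      proof (rule difference_quotient_circle[OF hol R(1) _ _ _ _ _ _ T_def _ sF])
        show "norm (G z) \<le> exp (\<phi> i)" "norm (U z) \<le> exp (\<phi> i)" if "norm z \<le> R" for z
          using elim that by (auto simp: R_def)
        show "norm z0 \<le> R / 16" using elim(6) \<tau> by (simp add: R_def field_simps)
        show "T \<le> R / 100" using elim(7) \<tau> by (simp add: R_def field_simps)
        have "exp (- \<phi> i) \<le> exp (ln (norm (G z0)))" "exp (- \<phi> i) \<le> exp (ln (norm (U z0)))" using elim(1) by auto
        then show "norm (G z0) \<ge> exp (- \<phi> i)" "norm (U z0) \<ge> exp (- \<phi> i)" using z0 by auto
        show "norm z \<le> R / 100" using z by (simp add: R_def)
      qed (use B in auto)
      also have "1200 * \<phi> i * T / R + 1000 * sqrt T * real (n + 3) * \<phi> i / sqrt R \<le> \<epsilon> / 2 * \<Lambda> i"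
      proof -
        have "1 * R \<le> R * R" using R by (intro mult_right_mono) auto
        then have "sqrt R \<le> sqrt (R * R)" by (simp only: real_sqrt_le_iff mult_1_left)
        then have "sqrt R \<le> R" using R by (simp add: real_sqrt_abs2)
        then have "1200 * \<phi> i * T / R \<le> 1200 * \<phi> i * T / sqrt R"
          using B T0 R by (intro divide_left_mono) auto
        then have "1200 * \<phi> i * T / R + 1000 * sqrt T * real (n + 3) * \<phi> i / sqrt R
            \<le> (1200 * T + 1000 * sqrt T * real (n + 3)) * (\<phi> i / sqrt R)"
          by (simp add: algebra_simps add_divide_distrib)
        also have "\<dots> \<le> K * (\<phi> i / sqrt R)"
          using B R by (intro mult_right_mono divide_nonneg_nonneg) (auto simp: K_def)
        also have "\<dots> \<le> K * (\<delta> * \<Lambda> i * sqrt (\<rho> i) / sqrt R)"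
          using elim(4) K R by (intro mult_left_mono divide_right_mono) auto
        also have "\<dots> = \<epsilon> / 2 * \<Lambda> i"
          using K \<tau> elim(5) by (simp add: R_def real_sqrt_mult \<delta>_def)
        finally show ?thesis .
      qed
      also have "(2::real) ^ (n + 2) * exp (\<epsilon> / 2 * \<Lambda> i) = exp (real (n + 2) * ln 2 + \<epsilon> / 2 * \<Lambda> i)"
        unfolding exp_add by (subst exp_of_nat_mult) simp
      also have "\<dots> \<le> exp (\<epsilon> * \<Lambda> i)" using elim(9) by simp
      finally show "norm (s z) \<le> exp (\<epsilon> * \<Lambda> i)" by simp
    qed
  qed
qed

end

section \<open>Entire functions and their shifts\<close>

lemma open_countable_empty:
  fixes V :: "complex set"
  assumes "open V" "countable V"
  shows "V = {}"
proof (rule ccontr)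
  assume "V \<noteq> {}"
  then obtain x e where "e > 0" "ball x e \<subseteq> V" using assms(1) by (meson ex_in_conv open_contains_ball)
  then have "countable (ball x e)" using assms(2) countable_subset by blast
  then show False using uncountable_ball[OF \<open>e > 0\<close>, of x] by blast
qed

text \<open>The set of disagreement is open, and a nonempty open set of the plane is uncountable.
  Identities that hold off a countable set are extended in this way throughout.\<close>

lemma eq_off_countable:
  fixes g h :: "complex \<Rightarrow> complex"
  assumes "continuous_on S g" "continuous_on S h" "open S" "countable {z \<in> S. g z \<noteq> h z}" "z \<in> S"
  shows "g z = h z"
proof -
  have "continuous_on S (\<lambda>z. g z - h z)" by (intro continuous_intros assms)
  then have "open (S \<inter> (\<lambda>z. g z - h z) -` (- {0}))"
    by (intro continuous_open_preimage assms(3)) auto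
  moreover have "S \<inter> (\<lambda>z. g z - h z) -` (- {0}) = {z \<in> S. g z \<noteq> h z}" by auto
  ultimately have "open {z \<in> S. g z \<noteq> h z}" by simp
  then have "{z \<in> S. g z \<noteq> h z} = {}" using assms(4) by (rule open_countable_empty)
  then show ?thesis using assms(5) by blast
qed

lemma entire_continuous: "f holomorphic_on UNIV \<Longrightarrow> continuous_on S f"
  by (meson holomorphic_on_imp_continuous_on continuous_on_subset subset_UNIV)

lemma entire_eq_off_countable:
  assumes "g holomorphic_on UNIV" "h holomorphic_on UNIV" "countable {z. g z \<noteq> h z}"
  shows "g z = h z"
  by (rule eq_off_countable[of UNIV]) (use assms entire_continuous in auto)

lemma entire_shift: "f holomorphic_on UNIV \<Longrightarrow> (\<lambda>z. f (z + d)) holomorphic_on UNIV"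
  by (rule holomorphic_on_compose_gen[of "\<lambda>z. z + d" UNIV f UNIV, unfolded o_def])
    (auto intro!: holomorphic_intros)

lemma entire_fwd_diff:
  assumes "f holomorphic_on UNIV"
  shows "(fwd_diff c ^^ n) f holomorphic_on UNIV"
proof (induction n)
  case (Suc n)
  then show ?case unfolding fwd_diff_Suc[abs_def] funpow.simps o_apply fwd_diff_def
    by (intro holomorphic_intros entire_shift) (auto simp: fwd_diff_def[symmetric])
qed (use assms in simp)

lemma entire_zero_product:
  assumes "g holomorphic_on UNIV" "h holomorphic_on UNIV" "\<And>z. g z * h z = 0" "h z0 \<noteq> 0"
  shows "g z = 0"
proof (rule entire_eq_off_countable[OF assms(1)])
  have "{z. g z \<noteq> 0} \<subseteq> {z \<in> UNIV. h z = 0}" using assms(3) by force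
  then show "countable {z. g z \<noteq> 0}"
    using countable_zeros[OF assms(2) open_UNIV connected_UNIV UNIV_I assms(4)] countable_subset by blast
qed simp

section \<open>Radii of regular growth\<close>

text \<open>If \<open>L (A * r) > D * L r\<close> held for all large \<open>r = A ^ j\<close>, then
  \<open>L (A ^ (J + i)) >= D ^ i\<close>. With \<open>D = 2 * A ^ Suc K\<close> this outgrows the
  polynomial bound \<open>L r <= r ^ Suc K\<close> by the factor \<open>2 ^ i\<close>. Hence the
  reverse inequality holds for arbitrarily large \<open>j\<close>.\<close>

lemma scales_exist:
  assumes f: "f holomorphic_on UNIV" and nc: "\<not> f constant_on UNIV"
    and prox: "\<And>r. r \<ge> x0 \<Longrightarrow> proximity f r \<le> r ^ K" and x0: "x0 \<ge> 1" and A: "A > 1"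
  obtains \<rho> \<Lambda> :: "nat \<Rightarrow> real" and D :: real and K' :: nat where
    "filterlim \<rho> at_top sequentially" "filterlim \<Lambda> at_top sequentially" "D \<ge> 1"
    "\<And>i. \<exists>z. norm z \<le> \<rho> i \<and> norm (f z) = exp (\<Lambda> i)"
    "\<And>i z. norm z \<le> A * \<rho> i \<Longrightarrow> norm (f z) \<le> exp (D * \<Lambda> i)"
    "\<And>i. \<Lambda> i \<le> \<rho> i ^ K'"
proof -
  have "\<exists>M. (\<exists>z. norm z \<le> r \<and> norm (f z) = M) \<and> (\<forall>z. norm z \<le> r \<longrightarrow> norm (f z) \<le> M)" if "r \<ge> 0" for r
  proof -
    have "continuous_on (cball 0 r) (\<lambda>z. norm (f z))"
      by (intro continuous_intros entire_continuous f)
    then obtain z where "z \<in> cball 0 r" "\<forall>w\<in>cball 0 r. norm (f w) \<le> norm (f z)"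
      using continuous_attains_sup[of "cball 0 r" "\<lambda>z. norm (f z)"] \<open>r \<ge> 0\<close> by auto
    then show ?thesis by (intro exI[of _ "norm (f z)"]) auto
  qed
  then obtain M where M: "\<And>r. r \<ge> 0 \<Longrightarrow> \<exists>z. norm z \<le> r \<and> norm (f z) = M r"
    "\<And>r z. r \<ge> 0 \<Longrightarrow> norm z \<le> r \<Longrightarrow> norm (f z) \<le> M r" by metis
  have unb: "\<exists>z. norm (f z) > X" for X
  proof (rule ccontr)
    assume "\<not> ?thesis"
    then have "bounded (range f)" by (auto simp: bounded_iff not_less)
    then show False using Liouville_theorem[OF f] nc by blast
  qed
  have mono: "M r \<le> M r'" if "0 \<le> r" "r \<le> r'" for r r'
  proof -
    from M(1)[OF that(1)] obtain z where z: "norm z \<le> r" "norm (f z) = M r" by blast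
    have "norm (f z) \<le> M r'" by (rule M(2)) (use z that in auto)
    then show ?thesis using z by simp
  qed
  have large: "\<exists>x\<ge>0. \<forall>r\<ge>x. M r > X" for X
  proof -
    obtain z where z: "norm (f z) > X" using unb by blast
    have "M r > X" if "r \<ge> norm z" for r using M(2)[of r z] that z norm_ge_zero[of z] by linarith
    then show ?thesis by (intro exI[of _ "norm z"]) auto
  qed
  define L where "L = (\<lambda>r. ln (M r))"
  obtain x1 where x1: "x1 \<ge> 0" "\<And>r. r \<ge> x1 \<Longrightarrow> M r > exp 1" using large by blast
  have L1: "L r \<ge> 1" "exp (L r) = M r" if "r \<ge> x1" for r
  proof -
    have "M r > 0" using x1(2)[OF that] exp_gt_zero[of "1::real"] by linarith
    then show "exp (L r) = M r" by (simp add: L_def)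
    then show "L r \<ge> 1" using x1(2)[OF that] by (metis exp_le_cancel_iff less_imp_le)
  qed
  have Lmono: "L r \<le> L r'" if "x1 \<le> r" "r \<le> r'" for r r'
    using mono[of r r'] L1(2)[of r] L1(2)[of r'] that x1(1) by (metis exp_le_cancel_iff order_trans)
  \<comment> \<open>The Poisson bound needs a circle without zeros of \<open>f\<close>, found
    between the radii \<open>2 * r\<close> and \<open>3 * r\<close>. The resulting constant
    \<open>3 ^ Suc K\<close> is traded for one more power of \<open>r\<close>.\<close>
  have Lbound: "L r \<le> r ^ Suc K" if r: "r \<ge> max (max x0 x1) (3 ^ Suc K)" for r
  proof -
    obtain z where z: "norm z \<le> r" "norm (f z) = M r" using M(1)[of r] r x1 by auto
    have fz: "f z \<noteq> 0" using z(2) L1(2)[of r] r by (metis exp_not_eq_zero max.bounded_iff norm_eq_zero)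
    have "countable (norm ` {w \<in> UNIV. f w = 0})"
      by (intro countable_image countable_zeros[OF f open_UNIV connected_UNIV UNIV_I fz])
    moreover have "uncountable {2 * r..3 * r}" using r x0 by (simp add: uncountable_closed_interval)
    ultimately have "\<not> {2 * r..3 * r} \<subseteq> norm ` {w \<in> UNIV. f w = 0}" using countable_subset by blast
    then obtain R where R': "R \<in> {2 * r..3 * r}" "R \<notin> norm ` {w \<in> UNIV. f w = 0}" by blast
    then have R: "2 * r \<le> R" "R \<le> 3 * r" "\<And>w. norm w = R \<Longrightarrow> f w \<noteq> 0" by auto
    have "norm (f z) \<le> exp (3 * proximity f R)"
      by (rule norm_le_exp_proximity[OF f open_UNIV connected_UNIV subset_UNIV _ R(3)]) (use R r x0 z in auto)
    then have "L r \<le> 3 * proximity f R" using z(2) L1(2)[of r] r by (metis exp_le_cancel_iff max.bounded_iff)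
    also have "\<dots> \<le> 3 * R ^ K" using prox[of R] R r x0 by auto
    also have "\<dots> \<le> 3 * (3 * r) ^ K" using R r x0 by (intro mult_left_mono power_mono) auto
    also have "\<dots> = 3 ^ Suc K * r ^ K" by (simp add: power_mult_distrib)
    also have "\<dots> \<le> r * r ^ K" using r x0 by (intro mult_right_mono) auto
    finally show ?thesis by simp
  qed
  define D where "D = 2 * A ^ Suc K"
  have A1: "A ^ Suc K \<ge> 1" using A by (intro one_le_power) simp
  have tend: "filterlim (\<lambda>j. A ^ j) at_top sequentially"
    unfolding filterlim_at_top
  proof
    fix Z :: real
    obtain N where "Z < A ^ N" using real_arch_pow[OF A] by blast
    moreover have "A ^ N \<le> A ^ j" if "j \<ge> N" for j using A that by (intro power_increasing) auto
    ultimately show "\<forall>\<^sub>F j in sequentially. Z \<le> A ^ j"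
      unfolding eventually_sequentially by (meson less_imp_le order_trans)
  qed
  have ex: "\<exists>j\<ge>j0. A ^ j \<ge> X \<and> L (A ^ Suc j) \<le> D * L (A ^ j)" for j0 X
  proof -
    obtain j1 where j1: "\<And>j. j \<ge> j1 \<Longrightarrow> A ^ j \<ge> max X (max (max x0 x1) (3 ^ Suc K))"
      using tend unfolding filterlim_at_top eventually_sequentially by blast
    define J where "J = max j0 j1"
    have "\<exists>j\<ge>J. L (A ^ Suc j) \<le> D * L (A ^ j)"
    proof (rule ccontr)
      assume no: "\<not> ?thesis"
      have lower: "L (A ^ (J + i)) \<ge> D ^ i" for i
      proof (induction i)
        case 0
        then show ?case using L1(1)[of "A ^ J"] j1[of J] by (simp add: J_def)
      next
        case (Suc i)
        have "D * D ^ i \<le> D * L (A ^ (J + i))" using Suc A1 by (intro mult_left_mono) (auto simp: D_def)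
        also have "\<dots> < L (A ^ Suc (J + i))" using no by (force simp: not_le)
        finally show ?case by simp
      qed
      have upper: "2 ^ i \<le> (A ^ J) ^ Suc K" for i
      proof -
        have "2 ^ i * (A ^ Suc K) ^ i = D ^ i" by (simp add: D_def power_mult_distrib)
        also have "\<dots> \<le> L (A ^ (J + i))" by (rule lower)
        also have "\<dots> \<le> (A ^ (J + i)) ^ Suc K" using j1[of "J + i"] by (intro Lbound) (auto simp: J_def)
        also have "\<dots> = (A ^ J) ^ Suc K * (A ^ Suc K) ^ i"
          by (simp only: power_add power_mult_distrib) (simp only: mult.commute flip: power_mult)
        finally show ?thesis
          by (rule mult_right_le_imp_le) (use A in simp)
      qed
      obtain i where "(A ^ J) ^ Suc K < 2 ^ i" using real_arch_pow[of 2] by force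
      then show False using upper[of i] by simp
    qed
    then obtain j where "j \<ge> J" "L (A ^ Suc j) \<le> D * L (A ^ j)" by blast
    then show ?thesis using j1[of j] by (intro exI[of _ j]) (auto simp: J_def)
  qed
  have "\<exists>j. A ^ j \<ge> max (real i) (max (max x0 x1) (3 ^ Suc K)) \<and> L (A ^ Suc j) \<le> D * L (A ^ j)" for i
    using ex by blast
  then obtain j where j: "\<And>i. A ^ j i \<ge> max (real i) (max (max x0 x1) (3 ^ Suc K))"
    "\<And>i. L (A ^ Suc (j i)) \<le> D * L (A ^ j i)" by metis
  define \<rho> where "\<rho> = (\<lambda>i. A ^ j i)"
  define \<Lambda> where "\<Lambda> = (\<lambda>i. L (\<rho> i))"
  have rx: "\<rho> i \<ge> x1" "\<rho> i \<ge> real i" "\<rho> i \<ge> max (max x0 x1) (3 ^ Suc K)" for i using j(1)[of i] by (auto simp: \<rho>_def)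
  show thesis
  proof (rule that[of \<rho> \<Lambda> D "Suc K"])
    show rho: "filterlim \<rho> at_top sequentially"
      by (rule filterlim_at_top_mono[OF filterlim_real_sequentially]) (use rx in auto)
    show "filterlim \<Lambda> at_top sequentially"
      unfolding filterlim_at_top
    proof
      fix Z :: real
      obtain x where x: "\<And>r. r \<ge> x \<Longrightarrow> M r > exp Z" using large by blast
      have "\<forall>\<^sub>F i in sequentially. x \<le> \<rho> i" using rho by (simp add: filterlim_at_top)
      then show "\<forall>\<^sub>F i in sequentially. Z \<le> \<Lambda> i"
      proof eventually_elim
        case (elim i)
        then have "exp Z < exp (L (\<rho> i))" using x L1(2)[OF rx(1)] by simp
        then show ?case by (simp add: \<Lambda>_def)
      qed
    qed
    show "D \<ge> 1" using A1 by (simp add: D_def)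
    fix i
    show "\<exists>z. norm z \<le> \<rho> i \<and> norm (f z) = exp (\<Lambda> i)"
      unfolding \<Lambda>_def using L1(2)[OF rx(1)] M(1)[of "\<rho> i"] rx(1)[of i] x1(1) by (metis order_trans)
    show "\<Lambda> i \<le> \<rho> i ^ Suc K" unfolding \<Lambda>_def by (rule Lbound[OF rx(3)])
    fix z :: complex assume z: "norm z \<le> A * \<rho> i"
    have Ar: "A * \<rho> i = A ^ Suc (j i)" by (simp add: \<rho>_def)
    have "\<rho> i \<ge> 0" using rx(1)[of i] x1(1) by linarith
    then have ge: "A * \<rho> i \<ge> x1" using rx(1)[of i] A mult_right_mono[of 1 A "\<rho> i"] by linarith
    have "norm (f z) \<le> M (A * \<rho> i)" using M(2)[OF _ z] ge x1(1) by linarith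
    also have "\<dots> = exp (L (A * \<rho> i))" using L1(2)[OF ge] by simp
    also have "\<dots> \<le> exp (D * \<Lambda> i)" using j(2)[of i] unfolding Ar \<Lambda>_def \<rho>_def by simp
    finally show "norm (f z) \<le> exp (D * \<Lambda> i)" .
  qed
qed

section \<open>Multipliers \<open>exp P\<close> other than 1 are impossible\<close>

text \<open>If \<open>Re P\<close> is not constant along all orbits, a generic base point makes it
  tend to plus or minus infinity at least linearly, and \<open>not_eventually_large\<close> or
  \<open>not_geometric\<close> applies. If it is constant along all orbits but \<open>P\<close> is
  not constant, a base point with \<open>Re (poly P z) > ln M\<close> makes the whole orbit large.
  There remains constant \<open>P\<close>, settled by \<open>const_eq_1\<close>. Each base point is
  sought in an open set, since it must avoid \<open>X\<close>.\<close>

lemma chain_exclude: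
  fixes P :: "complex poly" and c :: complex
  assumes ne1: "exp (poly P z1) \<noteq> 1" and X: "countable X"
    and chain: "\<And>z. z \<notin> X \<Longrightarrow> \<exists>al be. difference_chain n al be (\<lambda>k. exp (poly P (z + of_nat k * c)))"
  shows False
proof -
  have pick: "\<exists>z. z \<in> V \<and> z \<notin> X" if "open V" "V \<noteq> {}" for V
  proof (rule ccontr)
    assume "\<not> ?thesis"
    then have "V \<subseteq> X" by blast
    then have "countable V" using X by (rule countable_subset)
    then show False using open_countable_empty[OF that(1)] that(2) by simp
  qed
  have cont: "continuous_on UNIV (\<lambda>z. Re (poly P (z + of_nat k * c)))" for k
    by (intro continuous_intros)
  define M :: real where "M = 2 * 3 ^ n + 3"
  have M: "M > 0" unfolding M_def by (simp add: add_pos_pos)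
  have large: False if z: "z \<notin> X" and ev: "\<forall>\<^sub>F k in sequentially. ln M \<le> Re (poly P (z + of_nat k * c))" for z
  proof -
    obtain al be where ch: "difference_chain n al be (\<lambda>k. exp (poly P (z + of_nat k * c)))"
      using chain[OF z] by blast
    have "\<forall>\<^sub>F k in sequentially. norm (exp (poly P (z + of_nat k * c))) \<ge> 2 * 3 ^ n + 3"
      using ev
    proof eventually_elim
      case (elim k)
      have "M = exp (ln M)" using M by simp
      also have "\<dots> \<le> exp (Re (poly P (z + of_nat k * c)))" using elim by (simp only: exp_le_cancel_iff)
      finally have "M \<le> exp (Re (poly P (z + of_nat k * c)))" .
      then show ?case by (simp add: M_def)
    qed
    then show False using difference_chain.not_eventually_large[OF ch] by blast
  qed
  show False
  proof (cases "\<forall>z k. Re (poly P (z + of_nat k * c)) = Re (poly P z)")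
    case True
    show False
    proof (cases "degree P = 0")
      case True
      then obtain p where P: "P = [:p:]" by (rule degree_eq_zeroE)
      obtain z where "z \<notin> X" using pick[of UNIV] by auto
      then obtain al be where ch: "difference_chain n al be (\<lambda>k. exp (poly P (z + of_nat k * c)))"
        using chain by blast
      have "exp p = 1" by (rule difference_chain.const_eq_1[OF ch]) (simp_all add: P)
      then show False using ne1 by (simp add: P)
    next
      case False
      then have "\<not> constant (poly P)" by (simp add: constant_degree)
      define V where "V = (\<lambda>z. Re (poly P (z + of_nat 0 * c))) -` {ln M<..}"
      have "open V" unfolding V_def by (rule open_vimage[OF _ cont]) simp
      moreover have "V \<noteq> {}"
      proof -
        have "degree (P - [:of_real (ln M + 1):]) = degree P"
          using False by (metis degree_pCons_0 diff_conv_add_uminus degree_add_eq_left degree_minus gr0I)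
        then have "\<not> constant (poly (P - [:of_real (ln M + 1):]))" using False by (simp add: constant_degree)
        then obtain z where "poly (P - [:of_real (ln M + 1):]) z = 0" using fundamental_theorem_of_algebra by blast
        then have "poly P z = of_real (ln M + 1)" by simp
        then have "Re (poly P z) = ln M + 1" by (metis Re_complex_of_real)
        then have "z \<in> V" by (simp add: V_def)
        then show ?thesis by blast
      qed
      ultimately obtain z where z: "z \<in> V" "z \<notin> X" using pick by blast
      show False by (rule large[OF z(2)]) (use z(1) \<open>\<forall>z k. _\<close> in \<open>auto simp: V_def\<close>)
    qed
  next
    case False
    then obtain z2 k2 where z2: "Re (poly P (z2 + of_nat k2 * c)) \<noteq> Re (poly P z2)" by blast
    define V where "V = (\<lambda>z. Re (poly P (z + of_nat k2 * c)) - Re (poly P (z + of_nat 0 * c))) -` (- {0})"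
    have "open V" unfolding V_def by (intro open_vimage continuous_on_diff cont open_Compl closed_singleton)
    moreover have "V \<noteq> {}" using z2 by (auto simp: V_def)
    ultimately obtain z where z: "z \<in> V" "z \<notin> X" using pick by blast
    obtain q :: "real poly" where q: "\<And>k::nat. poly q (real k) = Re (poly P (z + of_nat k * c))"
      using Re_poly_chain[of P z c] by blast
    show False
    proof (cases rule: real_poly_trichotomy[of q])
      case (const a)
      have "Re (poly P (z + of_nat k2 * c)) = Re (poly P (z + of_nat 0 * c))"
        using q[of k2] q[of 0] const[of k2] const[of 0] by metis
      then show False using z(1) by (simp add: V_def)
    next
      case (pos A \<delta>)
      have "\<forall>\<^sub>F k in sequentially. (ln M - A) / \<delta> \<le> real k"
        using filterlim_real_sequentially by (simp add: filterlim_at_top)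
      with pos(2) have "\<forall>\<^sub>F k in sequentially. ln M \<le> Re (poly P (z + of_nat k * c))"
      proof eventually_elim
        case (elim k)
        have "ln M - A \<le> \<delta> * real k" using elim(2) pos(1) by (simp add: pos_divide_le_eq mult.commute)
        then show ?case using elim(1) q[of k] by simp
      qed
      then show False by (rule large[OF z(2)])
    next
      case (neg A \<delta>)
      obtain al be where ch: "difference_chain n al be (\<lambda>k. exp (poly P (z + of_nat k * c)))"
        using chain[OF z(2)] by blast
      have "\<forall>\<^sub>F k in sequentially. norm (exp (poly P (z + of_nat k * c))) \<le> exp A * exp (- \<delta>) ^ k"
        using neg(2)
      proof eventually_elim
        case (elim k)
        have "exp (Re (poly P (z + of_nat k * c))) \<le> exp (A - \<delta> * real k)" using elim q[of k] by simp
        also have "\<dots> = exp A * exp (- \<delta>) ^ k"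
          by (simp add: exp_diff exp_minus power_inverse divide_inverse mult.commute flip: exp_of_nat_mult)
        finally show ?case by simp
      qed
      then show False
        by (rule difference_chain.not_geometric[OF ch]) (use neg(1) in auto)
    qed
  qed
qed

section \<open>The case of a doubling function along an orbit\<close>

text \<open>With the weights \<open>2 ^ j\<close>, the next level contributes at most half of the
  weighted sum, so each step multiplies the sum by at most 3 / 2. Such a sequence is in fact
  polynomial in \<open>k\<close>; the cruder bound suffices because it is compared with
  \<open>2 ^ k\<close>.\<close>

lemma difference_kernel_growth:
  fixes D :: "nat \<Rightarrow> nat \<Rightarrow> complex"
  assumes D_Suc: "\<And>j k. j < n \<Longrightarrow> D (Suc j) k = D j (Suc k) - D j k" and D_n: "\<And>k. D n k = 0"
  shows "norm (D 0 k) \<le> (\<Sum>j<n. 2 ^ j * norm (D j 0)) * (3 / 2) ^ k"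
proof (cases "n = 0")
  case False
  define W where "W = (\<lambda>k. \<Sum>j<n. 2 ^ j * norm (D j k))"
  have step: "W (Suc k) \<le> 3 / 2 * W k" for k
  proof -
    have "W (Suc k) \<le> (\<Sum>j<n. 2 ^ j * norm (D j k) + 2 ^ j * norm (D (Suc j) k))"
      unfolding W_def
    proof (rule sum_mono)
      fix j assume "j \<in> {..<n}"
      then have "D j (Suc k) = D j k + D (Suc j) k" using D_Suc by simp
      then have "norm (D j (Suc k)) \<le> norm (D j k) + norm (D (Suc j) k)" using norm_triangle_ineq by simp
      then show "2 ^ j * norm (D j (Suc k)) \<le> 2 ^ j * norm (D j k) + 2 ^ j * norm (D (Suc j) k)"
        using mult_left_mono[of _ _ "2 ^ j :: real"] by (simp flip: distrib_left)
    qed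
    also have "\<dots> = W k + (\<Sum>j<n. 2 ^ j * norm (D (Suc j) k))" by (simp add: W_def sum.distrib)
    also have "(\<Sum>j<n. 2 ^ j * norm (D (Suc j) k)) \<le> 1 / 2 * W k"
    proof -
      have "(\<Sum>j<n. 2 ^ Suc j * norm (D (Suc j) k)) + 2 ^ 0 * norm (D 0 k) = (\<Sum>j<Suc n. 2 ^ j * norm (D j k))"
        by (subst sum.lessThan_Suc_shift) simp
      also have "\<dots> = W k" by (simp add: W_def D_n)
      finally have eq: "(\<Sum>j<n. 2 ^ Suc j * norm (D (Suc j) k)) + 2 ^ 0 * norm (D 0 k) = W k" .
      have "(\<Sum>j<n. 2 ^ Suc j * norm (D (Suc j) k)) \<le> W k"
        by (rule ord_le_eq_trans[OF _ eq]) simp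
      moreover have "(\<Sum>j<n. 2 ^ Suc j * norm (D (Suc j) k)) = 2 * (\<Sum>j<n. 2 ^ j * norm (D (Suc j) k))"
        by (simp add: sum_distrib_left mult.assoc)
      ultimately show ?thesis by simp
    qed
    finally show ?thesis by simp
  qed
  have "W k \<le> W 0 * (3 / 2) ^ k"
  proof (induction k)
    case (Suc k)
    then show ?case using step[of k] by simp
  qed simp
  moreover have "norm (D 0 k) \<le> W k"
    unfolding W_def using member_le_sum[of 0 "{..<n}" "\<lambda>j. 2 ^ j * norm (D j k)"] False by simp
  ultimately show ?thesis by (simp add: W_def)
qed (use D_n in simp)

lemma isCont_fwd_diff:
  assumes "\<And>k::nat. isCont h (w + of_nat k * c)"
  shows "isCont ((fwd_diff c ^^ j) h) (w + of_nat k * c)"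
proof (induction j arbitrary: k)
  case (Suc j)
  have "isCont ((fwd_diff c ^^ j) h) (w + of_nat k * c + c)" using Suc[of "Suc k"] by (simp add: algebra_simps)
  then have "isCont (\<lambda>z. (fwd_diff c ^^ j) h (z + c)) (w + of_nat k * c)"
    by (rule isCont_o2[where f = "\<lambda>z. z + c" and g = "(fwd_diff c ^^ j) h", rotated]) simp
  then have "isCont (\<lambda>z. (fwd_diff c ^^ j) h (z + c) - (fwd_diff c ^^ j) h z) (w + of_nat k * c)"
    by (intro continuous_diff Suc)
  moreover have "(fwd_diff c ^^ Suc j) h = (\<lambda>z. (fwd_diff c ^^ j) h (z + c) - (fwd_diff c ^^ j) h z)"
    by (rule ext) (rule fwd_diff_Suc)
  ultimately show ?case by (simp only:)
qed (use assms in simp)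

lemma fwd_diff_diff:
  "(fwd_diff c ^^ j) (\<lambda>z. F z - g z) z = (fwd_diff c ^^ j) F z - (fwd_diff c ^^ j) g z"
proof (induction j arbitrary: z)
  case (Suc j)
  then show ?case unfolding fwd_diff_Suc by simp
qed simp

text \<open>Along \<open>z + k * c\<close> the function \<open>g\<close> grows like \<open>2 ^ k\<close>, while \<open>G / U - g\<close> lies in the
  kernel of the \<open>n\<close>-th difference and is therefore negligible.\<close>

lemma shift_tendsto_one:
  fixes U G b g :: "complex \<Rightarrow> complex" and c :: complex
  assumes U: "U holomorphic_on UNIV" and G: "G holomorphic_on UNIV" and b: "b holomorphic_on UNIV"
    and g: "\<And>z. g z = G z + b z" and gc: "\<And>z. g (z + c) = 2 * g z" and bc: "\<And>z. b (z + c) = b z"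
    and X: "countable X" and good: "\<And>z. z \<notin> X \<Longrightarrow> U z \<noteq> 0 \<and> g z \<noteq> 0"
    and Dn: "\<And>z. (\<And>k::nat. z + of_nat k * c \<notin> X) \<Longrightarrow> (fwd_diff c ^^ n) (\<lambda>z. G z / U z) z = g z"
  obtains \<epsilon> where "\<epsilon> > 0"
    "\<And>\<eta>. \<eta> > 0 \<Longrightarrow> \<forall>\<^sub>F k in sequentially. \<forall>w\<in>cball p \<epsilon>. norm (U (w + of_nat k * c) - 1) \<le> \<eta>"
proof -
  \<comment> \<open>The radii for which some translate by \<open>k * c\<close> of the circle about
    \<open>p\<close> meets \<open>X\<close>. They are countable in number, so one radius serves all
    \<open>k\<close>.\<close>
  define Y where "Y = (\<lambda>(x, k::nat). dist p (x - of_nat k * c)) ` (X \<times> UNIV)"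
  have "countable Y" unfolding Y_def using X by (intro countable_image countable_SIGMA) auto
  moreover have "uncountable {1..2::real}" by (simp add: uncountable_closed_interval)
  ultimately have "\<not> {1..2} \<subseteq> Y" using countable_subset by blast
  then obtain \<epsilon> where "\<epsilon> \<in> {1..2}" and \<epsilon>2: "\<epsilon> \<notin> Y" by blast
  then have \<epsilon>: "1 \<le> \<epsilon>" "\<epsilon> \<notin> Y" by auto
  define S where "S = sphere p \<epsilon>"
  have SX: "w + of_nat k * c \<notin> X" if "w \<in> S" for w and k :: nat
  proof
    assume "w + of_nat k * c \<in> X"
    then have "dist p (w + of_nat k * c - of_nat k * c) \<in> Y"
      unfolding Y_def by (intro image_eqI[of _ _ "(w + of_nat k * c, k)"]) auto
    then show False using that \<epsilon> by (simp add: S_def)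
  qed
  have compS: "compact S" by (simp add: S_def)
  have gk: "g (z + of_nat k * c) = 2 ^ k * g z" for z k
  proof (induction k)
    case (Suc k)
    then show ?case using gc[of "z + of_nat k * c"] by (simp add: algebra_simps)
  qed simp
  have bk: "b (z + of_nat k * c) = b z" for z k
  proof (induction k)
    case (Suc k)
    then show ?case using bc[of "z + of_nat k * c"] by (simp add: algebra_simps)
  qed simp
  have g_hol: "g holomorphic_on UNIV"
    by (rule holomorphic_transform[of "\<lambda>z. G z + b z"]) (auto intro!: holomorphic_intros G b simp: g)
  define F where "F = (\<lambda>z. G z / U z)"
  define h where "h = (\<lambda>z. F z - g z)"
  have Dg: "(fwd_diff c ^^ j) g z = g z" for j z
  proof (induction j arbitrary: z)
    case (Suc j)
    then show ?case unfolding fwd_diff_Suc by (simp add: gc)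
  qed simp
  have Dh: "(fwd_diff c ^^ n) h (w + of_nat k * c) = 0" if "w \<in> S" for w k
  proof -
    have "(fwd_diff c ^^ n) F (w + of_nat k * c) = g (w + of_nat k * c)"
      unfolding F_def
    proof (rule Dn)
      fix l :: nat
      show "w + of_nat k * c + of_nat l * c \<notin> X" using SX[OF that, of "k + l"] by (simp add: algebra_simps)
    qed
    then show ?thesis unfolding h_def fwd_diff_diff Dg by simp
  qed
  have cont: "isCont h (w + of_nat k * c)" if "w \<in> S" for w k
    unfolding h_def F_def
    using good[OF SX[OF that, of k]] U G g_hol
    by (intro continuous_intros) (auto simp: analytic_at_imp_isCont holomorphic_on_imp_analytic_at)
  have bounded: "\<exists>C. \<forall>w\<in>S. norm (\<phi> w) \<le> C" if "continuous_on S \<phi>" for \<phi> :: "complex \<Rightarrow> complex"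
    using compact_imp_bounded[OF compact_continuous_image[OF that compS]] by (auto simp: bounded_iff)
  have "\<exists>C. \<forall>w\<in>S. norm ((fwd_diff c ^^ j) h w) \<le> C" for j
  proof (rule bounded, rule continuous_at_imp_continuous_on, rule ballI)
    fix w assume "w \<in> S"
    then have "isCont ((fwd_diff c ^^ j) h) (w + of_nat 0 * c)" by (intro isCont_fwd_diff cont)
    then show "isCont ((fwd_diff c ^^ j) h) w" by simp
  qed
  then obtain C where C: "\<And>j w. w \<in> S \<Longrightarrow> norm ((fwd_diff c ^^ j) h w) \<le> C j" by metis
  define C' where "C' = (\<Sum>j<n. 2 ^ j * C j)"
  have hk: "norm (h (w + of_nat k * c)) \<le> C' * (3 / 2) ^ k" if w: "w \<in> S" for w k
  proof -
    define Dd where "Dd = (\<lambda>j k. (fwd_diff c ^^ j) h (w + of_nat k * c))"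
    have "norm (Dd 0 k) \<le> (\<Sum>j<n. 2 ^ j * norm (Dd j 0)) * (3 / 2) ^ k"
    proof (rule difference_kernel_growth)
      show "Dd (Suc j) k = Dd j (Suc k) - Dd j k" for j k
        unfolding Dd_def fwd_diff_Suc by (simp add: algebra_simps)
      show "Dd n k = 0" for k unfolding Dd_def by (rule Dh[OF w])
    qed
    also have "\<dots> \<le> C' * (3 / 2) ^ k"
      unfolding C'_def Dd_def using C[OF w] by (intro mult_right_mono sum_mono mult_left_mono) auto
    finally show ?thesis by (simp add: Dd_def)
  qed
  obtain Bb where Bb: "\<And>w. w \<in> S \<Longrightarrow> norm (b w) \<le> Bb" using bounded[OF entire_continuous[OF b]] by blast
  have "\<exists>\<delta>>0. \<forall>w\<in>S. norm (g w) \<ge> \<delta>"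
  proof -
    have "continuous_on S (\<lambda>w. norm (g w))" by (intro continuous_intros entire_continuous g_hol)
    moreover have "p + of_real \<epsilon> \<in> S" using \<epsilon> by (simp add: S_def dist_norm)
    ultimately obtain w0 where "w0 \<in> S" "\<forall>w\<in>S. norm (g w0) \<le> norm (g w)"
      using continuous_attains_inf[OF compS] by blast
    moreover have "g w0 \<noteq> 0" using good SX[OF \<open>w0 \<in> S\<close>, of 0] by simp
    ultimately show ?thesis by (intro exI[of _ "norm (g w0)"]) auto
  qed
  then obtain \<delta> where \<delta>: "\<delta> > 0" "\<And>w. w \<in> S \<Longrightarrow> norm (g w) \<ge> \<delta>" by blast
  \<comment> \<open>\<open>(U - 1) * F = G - F = - (b + h)\<close> and
    \<open>F = 2 ^ k * g + h\<close>. Dividing by \<open>2 ^ k\<close> gives this bound for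
    \<open>|U - 1|\<close>; the ratio \<open>3 / 4\<close> is \<open>(3 / 2) / 2\<close>.\<close>
  define t where "t = (\<lambda>k. (Bb * (1 / 2) ^ k + C' * (3 / 4) ^ k) / (\<delta> - C' * (3 / 4) ^ k))"
  have lims: "(\<lambda>k. (1 / 2 :: real) ^ k) \<longlonglongrightarrow> 0" "(\<lambda>k. (3 / 4 :: real) ^ k) \<longlonglongrightarrow> 0"
    by (rule LIMSEQ_realpow_zero; simp)+
  have "t \<longlonglongrightarrow> (Bb * 0 + C' * 0) / (\<delta> - C' * 0)"
    unfolding t_def by (intro tendsto_intros lims) (use \<delta> in auto)
  then have t0: "t \<longlonglongrightarrow> 0" by simp
  have "(\<lambda>k. \<delta> - C' * (3 / 4) ^ k) \<longlonglongrightarrow> \<delta> - C' * 0" by (intro tendsto_intros lims)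
  then have pos: "\<forall>\<^sub>F k in sequentially. 0 < \<delta> - C' * (3 / 4) ^ k" using \<delta>(1) by (intro order_tendstoD(1)) auto
  have main: "\<forall>\<^sub>F k in sequentially. \<forall>w\<in>cball p \<epsilon>. norm (U (w + of_nat k * c) - 1) \<le> \<eta>" if "\<eta> > 0" for \<eta>
    using pos order_tendstoD(2)[OF t0 that]
  proof eventually_elim
    case (elim k)
    have sph: "norm (U (w + of_nat k * c) - 1) \<le> \<eta>" if w: "w \<in> S" for w
    proof -
      define z where "z = w + of_nat k * c"
      have Uz: "U z \<noteq> 0" using good SX[OF w] by (simp add: z_def)
      have Gz: "G z = 2 ^ k * g w - b w" using g[of z] gk[of w k] bk[of w k] by (simp add: z_def)
      have Fz: "F z = 2 ^ k * g w + h z" using gk[of w k] by (simp add: h_def z_def)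
      have lower: "norm (F z) \<ge> 2 ^ k * (\<delta> - C' * (3 / 4) ^ k)"
      proof -
        have "norm (F z) \<ge> norm (2 ^ k * g w) - norm (h z)"
          unfolding Fz using norm_diff_ineq[of "2 ^ k * g w" "h z"] by simp
        moreover have "norm (2 ^ k * g w) \<ge> 2 ^ k * \<delta>" using \<delta>(2)[OF w] by (simp add: norm_mult norm_power)
        moreover have "norm (h z) \<le> C' * (3 / 2) ^ k" unfolding z_def by (rule hk[OF w])
        moreover have "C' * (3 / 2) ^ k = 2 ^ k * (C' * (3 / 4) ^ k)"
          by (simp add: power_divide) (simp add: field_simps flip: power_mult_distrib)
        ultimately show ?thesis by (simp add: right_diff_distrib)
      qed
      then have Fpos: "norm (F z) > 0" using elim(1) by (meson less_le_trans mult_pos_pos zero_less_numeral zero_less_power)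
      have "U z * F z = G z" using Uz by (simp add: F_def)
      then have "(U z - 1) * F z = - (b w + h z)" unfolding left_diff_distrib using Gz Fz by simp
      then have "norm (U z - 1) * norm (F z) = norm (b w + h z)" by (metis norm_minus_cancel norm_mult)
      also have "\<dots> \<le> Bb + C' * (3 / 2) ^ k"
        using norm_triangle_ineq[of "b w" "h z"] Bb[OF w] hk[OF w, of k] by (simp add: z_def)
      also have "\<dots> = 2 ^ k * (Bb * (1 / 2) ^ k + C' * (3 / 4) ^ k)"
        by (simp add: power_divide field_simps flip: power_mult_distrib)
      also have "\<dots> = t k * (2 ^ k * (\<delta> - C' * (3 / 4) ^ k))" using elim(1) by (simp add: t_def)
      also have "\<dots> \<le> \<eta> * (2 ^ k * (\<delta> - C' * (3 / 4) ^ k))" using elim by (intro mult_right_mono) auto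
      also have "\<dots> \<le> \<eta> * norm (F z)" using lower that \<open>\<eta> > 0\<close> by (intro mult_left_mono) auto
      finally show ?thesis using Fpos by (simp add: z_def)
    qed
    show ?case
    proof
      fix w assume w: "w \<in> cball p \<epsilon>"
      \<comment> \<open>The circle was chosen to avoid the zeros of \<open>U\<close>; inside it the
        maximum principle is applied to the entire function \<open>U - 1\<close>.\<close>
      show "norm (U (w + of_nat k * c) - 1) \<le> \<eta>"
        by (rule max_modulus_cball[of "\<lambda>w. U (w + of_nat k * c) - 1" UNIV p \<epsilon>])
          (use sph w \<epsilon> in \<open>auto simp: S_def intro!: holomorphic_intros entire_shift U\<close>)
    qed
  qed
  show thesis by (rule that[of \<epsilon>]) (use main \<epsilon> in auto)
qed

section \<open>The sharing situation\<close>

lemma fwd_diff_cong: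
  assumes "\<And>k::nat. F (z + of_nat k * c) = F' (z + of_nat k * c)"
  shows "(fwd_diff c ^^ j) F z = (fwd_diff c ^^ j) F' z"
proof -
  have "(fwd_diff c ^^ j) F (z + of_nat k * c) = (fwd_diff c ^^ j) F' (z + of_nat k * c)" for k
  proof (induction j arbitrary: k)
    case (Suc j)
    have eq: "z + of_nat k * c + c = z + of_nat (Suc k) * c" by (simp add: algebra_simps)
    show ?case unfolding fwd_diff_Suc eq Suc[of k] Suc[of "Suc k"] ..
  qed (use assms in simp)
  from this[of 0] show ?thesis by simp
qed

lemma fwd_diff_zero_mono:
  assumes "\<And>k::nat. (fwd_diff c ^^ m) a (z + of_nat k * c) = 0" "m \<le> j"
  shows "(fwd_diff c ^^ j) a (z + of_nat k * c) = 0"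
  using assms(2)
proof (induction j arbitrary: k rule: dec_induct)
  case (step j)
  have eq: "z + of_nat k * c + c = z + of_nat (Suc k) * c" by (simp add: algebra_simps)
  show ?case unfolding fwd_diff_Suc eq step.IH[of k] step.IH[of "Suc k"] by simp
qed (use assms(1) in simp)

lemma continuous_on_fwd_diff:
  assumes "\<And>k. k \<le> j \<Longrightarrow> continuous_on V (\<lambda>z. h (z + of_nat k * c))"
  shows "continuous_on V ((fwd_diff c ^^ j) h)"
proof -
  have "continuous_on V (\<lambda>z. (fwd_diff c ^^ i) h (z + of_nat l * c))" if "i + l \<le> j" for i l
    using that
  proof (induction i arbitrary: l)
    case (Suc i)
    have eq: "(fwd_diff c ^^ Suc i) h (z + of_nat l * c) =
      (fwd_diff c ^^ i) h (z + of_nat (Suc l) * c) - (fwd_diff c ^^ i) h (z + of_nat l * c)" for z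
      unfolding fwd_diff_Suc by (simp add: algebra_simps)
    show ?case unfolding eq using Suc.prems by (intro continuous_on_diff Suc.IH) auto
  qed (use assms in simp)
  from this[of j 0] show ?thesis by simp
qed

lemma countable_shift_orbit:
  assumes "countable (X :: complex set)"
  shows "countable {z. \<exists>k::nat. z + of_nat k * c \<in> X}"
proof -
  have "{z. \<exists>k::nat. z + of_nat k * c \<in> X} \<subseteq> (\<lambda>(x, k). x - of_nat k * c) ` (X \<times> (UNIV :: nat set))"
    by (auto intro!: image_eqI[of _ _ "(_ + of_nat _ * c, _)"])
  moreover have "countable ((\<lambda>(x, k). x - of_nat k * c) ` (X \<times> (UNIV :: nat set)))"
    using assms by (intro countable_image countable_SIGMA) auto
  ultimately show ?thesis by (rule countable_subset)
qed

lemma ex_not_in_countable: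
  assumes "countable (X :: complex set)"
  shows "\<exists>z. z \<notin> X"
proof (rule ccontr)
  assume "\<nexists>z. z \<notin> X"
  then have "X = UNIV" by blast
  then show False using open_countable_empty[OF open_UNIV] assms by blast
qed

text \<open>Absorbs the logarithm that clearing the poles of \<open>a\<close> costs; 21 is the
  factor of \<open>quotient_bound\<close>.\<close>

lemma ln_le_fourth_root:
  fixes C1 C2 C3 :: real
  assumes "C1 > 0" "C2 > 0" "C3 > 0"
  shows "\<forall>\<^sub>F x in at_top. C1 * ln (C2 * x) + C3 \<le> sqrt (sqrt x) / 21"
  using assms by real_asymp

text \<open>Writing \<open>F = G / U\<close> and \<open>G (z + c) = (1 + W z) * G z + b z\<close>, the difference \<open>fwd_diff c ^^ j\<close>
  of \<open>F\<close> is \<open>(num_G j * G + num_b j * b) / den j\<close> with the following entire functions.\<close>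

primrec num_G :: "complex \<Rightarrow> (complex \<Rightarrow> complex) \<Rightarrow> (complex \<Rightarrow> complex) \<Rightarrow> nat \<Rightarrow> complex \<Rightarrow> complex" where
  "num_G c W U 0 = (\<lambda>z. 1)"
| "num_G c W U (Suc j) = (\<lambda>z. (1 + W z) * num_G c W U j (z + c) * U z - num_G c W U j z * U (z + of_nat (Suc j) * c))"

primrec num_b :: "complex \<Rightarrow> (complex \<Rightarrow> complex) \<Rightarrow> (complex \<Rightarrow> complex) \<Rightarrow> nat \<Rightarrow> complex \<Rightarrow> complex" where
  "num_b c W U 0 = (\<lambda>z. 0)"
| "num_b c W U (Suc j) = (\<lambda>z. U z * (num_G c W U j (z + c) + num_b c W U j (z + c)) - num_b c W U j z * U (z + of_nat (Suc j) * c))"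

definition den :: "complex \<Rightarrow> (complex \<Rightarrow> complex) \<Rightarrow> nat \<Rightarrow> complex \<Rightarrow> complex" where
  "den c U j z = (\<Prod>k<Suc j. U (z + of_nat k * c))"

lemma den_Suc: "den c U (Suc j) z = den c U j z * U (z + of_nat (Suc j) * c)"
  by (simp add: den_def)

lemma den_Suc_shift: "den c U (Suc j) z = U z * den c U j (z + c)"
  unfolding den_def by (subst prod.lessThan_Suc_shift) (simp add: algebra_simps)

lemma entire_num:
  assumes "W holomorphic_on UNIV" "U holomorphic_on UNIV"
  shows "num_G c W U j holomorphic_on UNIV" "num_b c W U j holomorphic_on UNIV" "den c U j holomorphic_on UNIV"
proof -
  show G: "num_G c W U j holomorphic_on UNIV" for j
  proof (induction j)
    case (Suc j)
    then show ?case by (auto intro!: holomorphic_intros entire_shift assms)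
  qed simp
  show "num_b c W U j holomorphic_on UNIV"
  proof (induction j)
    case (Suc j)
    then show ?case by (auto intro!: holomorphic_intros entire_shift assms G)
  qed simp
  show "den c U j holomorphic_on UNIV"
    unfolding den_def[abs_def] by (intro holomorphic_intros entire_shift assms)
qed

lemma fwd_diff_num:
  assumes shift: "\<And>z. G (z + c) = (1 + W z) * G z + b z" and bc: "\<And>z. b (z + c) = b z"
    and nz: "\<And>k. k \<le> j \<Longrightarrow> U (z + of_nat k * c) \<noteq> 0"
  shows "den c U j z * (fwd_diff c ^^ j) (\<lambda>z. G z / U z) z = num_G c W U j z * G z + num_b c W U j z * b z"
  using nz
proof (induction j arbitrary: z)
  case 0
  then show ?case using 0[of 0] by (simp add: den_def)
next
  case (Suc j)
  have 1: "den c U j z * (fwd_diff c ^^ j) (\<lambda>z. G z / U z) z = num_G c W U j z * G z + num_b c W U j z * b z"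
    using Suc.prems by (intro Suc.IH) auto
  have 2: "den c U j (z + c) * (fwd_diff c ^^ j) (\<lambda>z. G z / U z) (z + c) =
      num_G c W U j (z + c) * G (z + c) + num_b c W U j (z + c) * b (z + c)"
  proof (rule Suc.IH)
    fix k assume "k \<le> j"
    then show "U (z + c + of_nat k * c) \<noteq> 0" using Suc.prems[of "Suc k"] by (simp add: algebra_simps)
  qed
  have "den c U (Suc j) z * (fwd_diff c ^^ Suc j) (\<lambda>z. G z / U z) z =
      U z * (den c U j (z + c) * (fwd_diff c ^^ j) (\<lambda>z. G z / U z) (z + c))
      - U (z + of_nat (Suc j) * c) * (den c U j z * (fwd_diff c ^^ j) (\<lambda>z. G z / U z) z)"
    unfolding fwd_diff_Suc right_diff_distrib
    by (subst den_Suc_shift, subst den_Suc) (simp only: mult_ac)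
  also have "\<dots> = num_G c W U (Suc j) z * G z + num_b c W U (Suc j) z * b z"
    unfolding 1 2 shift bc by (simp add: algebra_simps)
  finally show ?case .
qed

text \<open>The factor \<open>A\<close> only has to be large enough to survive the successive losses of radius in the
  division lemmas.\<close>

locale entire_scales = scales \<rho> \<Lambda> for \<rho> \<Lambda> +
  fixes f :: "complex \<Rightarrow> complex" and A D :: real
  assumes A: "A = 10 ^ 10" and D: "D \<ge> 1" and f_hol: "f holomorphic_on UNIV"
    and f_attained: "\<And>i. \<exists>z. norm z \<le> \<rho> i \<and> norm (f z) = exp (\<Lambda> i)"
    and f_bound: "\<And>i z. norm z \<le> A * \<rho> i \<Longrightarrow> norm (f z) \<le> exp (D * \<Lambda> i)"
begin

lemma f_grows: "grows A (\<lambda>i. D * \<Lambda> i) f"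
  unfolding grows_def using f_bound by simp

text \<open>\<open>entire_product_bound\<close> with \<open>x = \<tau> * \<rho> i / 2\<close>, valid
  for \<open>|z| <= x / 2\<close>, hence the loss of 4 in the radius. The shares
  \<open>\<epsilon> / 6\<close> for \<open>V\<close> and
  \<open>\<epsilon>' * D = \<epsilon> / 6\<close> for \<open>a'\<close> add up to
  \<open>\<epsilon>\<close> after the factor 3.\<close>

lemma product_small:
  assumes a': "a' meromorphic_on UNIV" "is_S (nevanlinna_T a') f"
    and Y: "Y holomorphic_on UNIV" and V: "V holomorphic_on UNIV" "small \<tau> V" and \<tau>: "0 < \<tau>" "\<tau> \<le> A"
    and eq: "countable {z. Y z \<noteq> V z * a' z}"
  shows "small (\<tau> / 4) Y"
  unfolding small_def
proof (intro allI impI)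
  fix \<epsilon> :: real assume \<epsilon>: "\<epsilon> > 0"
  define \<epsilon>' where "\<epsilon>' = \<epsilon> / (6 * D)"
  have \<epsilon>': "\<epsilon>' > 0" "\<epsilon> / 6 > 0" using \<epsilon> D by (auto simp: \<epsilon>'_def)
  obtain x0 where x0: "\<And>x B B' z. x \<ge> x0 \<Longrightarrow> B \<ge> 0 \<Longrightarrow> B' \<ge> 0 \<Longrightarrow>
      (\<And>z. norm z \<le> 2 * x \<Longrightarrow> norm (f z) \<le> exp B) \<Longrightarrow>
      (\<And>z. norm z \<le> 2 * x \<Longrightarrow> norm (V z) \<le> exp B') \<Longrightarrow> norm z \<le> x / 2 \<Longrightarrow>
      norm (Y z) \<le> exp (3 * (B' + \<epsilon>' * B))"
    using entire_product_bound[OF f_hol a' \<epsilon>'(1) Y V(1) eq] by metis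
  have "grows \<tau> (\<lambda>i. \<epsilon> / 6 * \<Lambda> i) V" using V(2) \<epsilon>'(2) unfolding small_def by blast
  then show "grows (\<tau> / 4) (\<lambda>i. \<epsilon> * \<Lambda> i) Y"
    using rho_ge[of "2 * x0 / \<tau>"] rho_ge[of 0] Lam_ge[of 0] unfolding grows_def
  proof eventually_elim
    case (elim i)
    show ?case
    proof (intro allI impI)
      fix z :: complex assume z: "norm z \<le> \<tau> / 4 * \<rho> i"
      have "norm (Y z) \<le> exp (3 * (\<epsilon> / 6 * \<Lambda> i + \<epsilon>' * (D * \<Lambda> i)))"
      proof (rule x0)
        show "x0 \<le> \<tau> * \<rho> i / 2" using elim(2) \<tau> by (simp add: field_simps)
        show "D * \<Lambda> i \<ge> 0" "\<epsilon> / 6 * \<Lambda> i \<ge> 0" using elim D \<epsilon> by auto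
        show "norm z \<le> \<tau> * \<rho> i / 2 / 2" using z by simp
        fix w :: complex assume w: "norm w \<le> 2 * (\<tau> * \<rho> i / 2)"
        then show "norm (V w) \<le> exp (\<epsilon> / 6 * \<Lambda> i)" using elim(1) by simp
        have "\<tau> * \<rho> i \<le> A * \<rho> i" using \<tau> elim(3) by (intro mult_right_mono) auto
        then show "norm (f w) \<le> exp (D * \<Lambda> i)" using w by (intro f_bound) simp
      qed
      also have "3 * (\<epsilon> / 6 * \<Lambda> i + \<epsilon>' * (D * \<Lambda> i)) = \<epsilon> * \<Lambda> i"
        using D by (simp add: \<epsilon>'_def)
      finally show "norm (Y z) \<le> exp (\<epsilon> * \<Lambda> i)" .
    qed
  qed
qed

text \<open>The modulus of \<open>f\<close> attains \<open>exp (\<Lambda> i)\<close> in the disc of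
  radius \<open>\<rho> i\<close>, which contradicts smallness already for
  \<open>\<epsilon> = 1 / 2\<close>.\<close>

lemma f_not_small:
  assumes "\<tau> \<ge> 1"
  shows "\<not> small \<tau> f"
proof
  assume "small \<tau> f"
  then have "grows \<tau> (\<lambda>i. 1 / 2 * \<Lambda> i) f" unfolding small_def by (auto dest: spec[of _ "1 / 2"])
  then have "\<forall>\<^sub>F i in sequentially. False"
    using Lam_ge[of 1] rho_ge[of 0] unfolding grows_def
  proof eventually_elim
    case (elim i)
    obtain z where z: "norm z \<le> \<rho> i" "norm (f z) = exp (\<Lambda> i)" using f_attained by blast
    have "1 * \<rho> i \<le> \<tau> * \<rho> i" using assms elim by (intro mult_right_mono) auto
    then have "norm (f z) \<le> exp (1 / 2 * \<Lambda> i)" using elim(1) z(1) by auto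
    then show ?case using z(2) elim by simp
  qed
  then show False by simp
qed

end

locale sharing_setting = entire_scales \<rho> \<Lambda> f A D for \<rho> \<Lambda> f A D +
  fixes c :: complex and n m :: nat and a b G W U :: "complex \<Rightarrow> complex" and K :: nat
  assumes nm: "1 \<le> m" "m \<le> n"
    and a_mero: "a meromorphic_on UNIV" and b_hol: "b holomorphic_on UNIV"
    and Lam_rho: "\<And>i. \<Lambda> i \<le> \<rho> i ^ K"
    and a_small: "is_S (nevanlinna_T a) f" and b_small: "is_S (nevanlinna_T b) f"
    and b_shift: "\<And>z. b (z + c) = b z" and b_nz: "\<exists>z. b z \<noteq> 0"
    and a_diff: "countable {z. (fwd_diff c ^^ m) a z \<noteq> 0}"
    and G_eq: "\<And>z. G z = (fwd_diff c ^^ n) f z - b z"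
    and W_hol: "W holomorphic_on UNIV" and W_nz: "\<And>z. W z \<noteq> 0"
    and W_eq: "\<And>z. (fwd_diff c ^^ Suc n) f z - b z = W z * G z"
    and U_hol: "U holomorphic_on UNIV" and U_eq: "countable {z. U z * (f z - a z) \<noteq> G z}"
    and U_zero: "\<And>z. U z = 0 \<Longrightarrow> G z \<noteq> 0"
    and G_nz: "\<exists>z. G z \<noteq> 0" and Df_nz: "\<exists>z. (fwd_diff c ^^ n) f z \<noteq> 0"
begin

lemma G_hol: "G holomorphic_on UNIV"
proof -
  have "G = (\<lambda>z. (fwd_diff c ^^ n) f z - b z)" by (rule ext) (rule G_eq)
  moreover have "(\<lambda>z. (fwd_diff c ^^ n) f z - b z) holomorphic_on UNIV"
    by (intro holomorphic_on_diff entire_fwd_diff f_hol b_hol)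
  ultimately show ?thesis by (simp only:)
qed

lemma G_shift: "G (z + c) = (1 + W z) * G z + b z"
  using W_eq[of z] b_shift[of z] unfolding fwd_diff_Suc G_eq by (simp add: algebra_simps)

text \<open>Closing the exceptional sets under backward shifts makes the complement stable under
  adding \<open>k * c\<close>, so that identities between iterated differences hold pointwise off a
  single countable set.\<close>

definition bad :: "complex set" where
  "bad = {z. \<exists>k::nat. z + of_nat k * c \<in>
     {z. U z * (f z - a z) \<noteq> G z} \<union> {z. (fwd_diff c ^^ m) a z \<noteq> 0} \<union> {z. U z = 0} \<union> {z. G z = 0}
     \<union> {z. (fwd_diff c ^^ n) f z = 0}}"

lemma zeros_countable: "h holomorphic_on UNIV \<Longrightarrow> \<exists>z. h z \<noteq> 0 \<Longrightarrow> countable {z. h z = 0}"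
  using countable_zeros[of h UNIV] by auto

lemma U_nz: "\<exists>z. U z \<noteq> 0"
proof -
  have "countable ({z. U z * (f z - a z) \<noteq> G z} \<union> {z. G z = 0})"
    by (intro countable_Un U_eq zeros_countable G_hol G_nz)
  then obtain z where "z \<notin> {z. U z * (f z - a z) \<noteq> G z} \<union> {z. G z = 0}"
    using ex_not_in_countable by blast
  then show ?thesis by (intro exI[of _ z]) auto
qed

lemma countable_bad: "countable bad"
  unfolding bad_def
  by (intro countable_shift_orbit countable_Un U_eq a_diff zeros_countable U_hol U_nz G_hol G_nz
      entire_fwd_diff f_hol Df_nz)

lemma bad_shift: "z \<notin> bad \<Longrightarrow> z + of_nat k * c \<notin> bad"
proof
  assume z: "z \<notin> bad" and "z + of_nat k * c \<in> bad"
  then obtain l :: nat where l: "z + of_nat k * c + of_nat l * c \<in>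
     {z. U z * (f z - a z) \<noteq> G z} \<union> {z. (fwd_diff c ^^ m) a z \<noteq> 0} \<union> {z. U z = 0} \<union> {z. G z = 0}
     \<union> {z. (fwd_diff c ^^ n) f z = 0}" unfolding bad_def by blast
  have eq: "z + of_nat k * c + of_nat l * c = z + of_nat (k + l) * c" by (simp add: algebra_simps)
  show False using l[unfolded eq] z unfolding bad_def by blast
qed

lemma goodD:
  assumes "z \<notin> bad"
  shows "U z * (f z - a z) = G z" "(fwd_diff c ^^ m) a z = 0" "U z \<noteq> 0" "G z \<noteq> 0" "(fwd_diff c ^^ n) f z \<noteq> 0"
proof -
  have "z + of_nat 0 * c \<notin> {z. U z * (f z - a z) \<noteq> G z} \<union> {z. (fwd_diff c ^^ m) a z \<noteq> 0} \<union> {z. U z = 0}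
     \<union> {z. G z = 0} \<union> {z. (fwd_diff c ^^ n) f z = 0}"
    using assms unfolding bad_def by blast
  then show "U z * (f z - a z) = G z" "(fwd_diff c ^^ m) a z = 0" "U z \<noteq> 0" "G z \<noteq> 0" "(fwd_diff c ^^ n) f z \<noteq> 0"
    by (simp_all only: mem_Collect_eq Un_iff of_nat_0 mult_zero_left add_0_right) blast+
qed

text \<open>Off \<open>bad\<close>, \<open>G / U\<close> equals \<open>f - a\<close> along the whole
  forward orbit, and the differences of \<open>a\<close> of order at least \<open>m\<close> vanish
  there. The use is for \<open>j = n\<close> and \<open>j = n + 1\<close>, both allowed by
  \<open>m \<le> n\<close>.\<close>

lemma fwd_diff_F:
  assumes "z \<notin> bad" "m \<le> j"
  shows "(fwd_diff c ^^ j) (\<lambda>z. G z / U z) z = (fwd_diff c ^^ j) f z"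
proof -
  have "G (z + of_nat k * c) / U (z + of_nat k * c) = f (z + of_nat k * c) - a (z + of_nat k * c)" for k :: nat
    using goodD(1,3)[OF bad_shift[OF assms(1), of k]] by (metis nonzero_mult_div_cancel_left)
  then have "(fwd_diff c ^^ j) (\<lambda>z. G z / U z) z = (fwd_diff c ^^ j) (\<lambda>z. f z - a z) z"
    by (rule fwd_diff_cong)
  also have "\<dots> = (fwd_diff c ^^ j) f z - (fwd_diff c ^^ j) a z" by (rule fwd_diff_diff)
  also have "(fwd_diff c ^^ j) a z = 0"
    using fwd_diff_zero_mono[of m c a z j 0] goodD(2)[OF bad_shift[OF assms(1)]] assms(2) by simp
  finally show ?thesis by simp
qed

lemma small_b: "small (A / 4) b"
proof (rule product_small[OF entire_meromorphic[OF b_hol] b_small b_hol])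
  show "small A (\<lambda>z. 1)" by (rule small_bounded[of _ 1]) simp
qed (use A in auto)

lemma diff_minus_b_grows:
  obtains D1 where "D1 \<ge> 1" "grows (A / 8) (\<lambda>i. D1 * \<Lambda> i) (\<lambda>z. (fwd_diff c ^^ j) f z - b z)"
proof
  have "grows (A / 8) (\<lambda>i. D * \<Lambda> i + real j) ((fwd_diff c ^^ j) f)"
    by (rule grows_fwd_diff[OF f_grows]) (simp add: A)
  then have 1: "grows (A / 8) (\<lambda>i. (D + 1) * \<Lambda> i) ((fwd_diff c ^^ j) f)"
    by (rule grows_mono) (use Lam_ge[of "real j"] in \<open>auto elim!: eventually_mono simp: algebra_simps\<close>)
  have "grows (A / 4) (\<lambda>i. 1 * \<Lambda> i) b" using small_b zero_less_one unfolding small_def by blast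
  then have "grows (A / 8) (\<lambda>i. (D + 1) * \<Lambda> i) b"
    by (rule grows_mono) (use Lam_ge[of 0] D in \<open>auto simp: A mult_le_cancel_right1 elim!: eventually_mono\<close>)
  from grows_add[OF 1 grows_minus[OF this]]
  have "grows (A / 8) (\<lambda>i. (D + 1) * \<Lambda> i + 1) (\<lambda>z. (fwd_diff c ^^ j) f z - b z)" by simp
  then show "grows (A / 8) (\<lambda>i. (D + 2) * \<Lambda> i) (\<lambda>z. (fwd_diff c ^^ j) f z - b z)"
    by (rule grows_mono) (use Lam_ge[of 1] in \<open>auto elim!: eventually_mono simp: algebra_simps\<close>)
  show "D + 2 \<ge> 1" using D by simp
qed

text \<open>A logarithm of \<open>V\<close> has real part at most \<open>r ^ L\<close> on the discs
  of radius \<open>r = \<rho> i\<close>, which is the kind of bound that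
  \<open>entire_polynomial\<close> takes.\<close>

lemma zero_free_exp_poly:
  assumes V: "V holomorphic_on UNIV" and nz: "\<And>z. V z \<noteq> 0" and gr: "grows \<tau> \<phi> V" and "\<tau> \<ge> 1"
    and \<phi>: "\<forall>\<^sub>F i in sequentially. \<phi> i \<le> \<rho> i ^ L"
  obtains P where "\<And>z. V z = exp (poly P z)"
proof -
  obtain w where w: "w holomorphic_on UNIV" "\<And>z. z \<in> UNIV \<Longrightarrow> V z = exp (w z)"
    by (rule contractible_imp_holomorphic_log[OF V convex_imp_contractible[OF convex_UNIV] nz]) blast
  note w = w(1) w(2)[OF UNIV_I]
  have "\<exists>r\<ge>N. \<forall>z. norm z \<le> r \<longrightarrow> Re (w z) \<le> r ^ L" for N
  proof -
    have "\<forall>\<^sub>F i in sequentially. N \<le> \<rho> i \<and> (\<forall>z. norm z \<le> \<rho> i \<longrightarrow> Re (w z) \<le> \<rho> i ^ L)"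
      using gr[unfolded grows_def] \<phi> rho_ge[of N] rho_ge[of 0]
    proof eventually_elim
      case (elim i)
      have "Re (w z) \<le> \<rho> i ^ L" if "norm z \<le> \<rho> i" for z
      proof -
        have "1 * \<rho> i \<le> \<tau> * \<rho> i" using assms(4) elim by (intro mult_right_mono) auto
        then have "norm (V z) \<le> exp (\<phi> i)" using elim(1) that by auto
        then have "Re (w z) \<le> \<phi> i" by (simp add: w(2))
        then show ?thesis using elim by linarith
      qed
      then show ?case using elim by simp
    qed
    then obtain i where "N \<le> \<rho> i \<and> (\<forall>z. norm z \<le> \<rho> i \<longrightarrow> Re (w z) \<le> \<rho> i ^ L)"
      by (auto simp: eventually_sequentially)
    then show ?thesis by blast
  qed
  from entire_polynomial[OF w(1) this] obtain P where "w = poly P" by blast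
  then show thesis using that w(2) by simp
qed

lemma W_exp_poly: obtains P where "\<And>z. W z = exp (poly P z)"
proof -
  obtain D1 where D1: "D1 \<ge> 1" "grows (A / 8) (\<lambda>i. D1 * \<Lambda> i) (\<lambda>z. (fwd_diff c ^^ n) f z - b z)"
    by (rule diff_minus_b_grows)
  obtain D2 where D2: "D2 \<ge> 1" "grows (A / 8) (\<lambda>i. D2 * \<Lambda> i) (\<lambda>z. (fwd_diff c ^^ Suc n) f z - b z)"
    by (rule diff_minus_b_grows)
  define E where "E = D1 + D2"
  have E: "E > 0" using D1 D2 by (simp add: E_def)
  have 1: "grows (A / 8) (\<lambda>i. E * \<Lambda> i) G"
    unfolding G_eq[abs_def] using D1(2)
    by (rule grows_mono) (use Lam_ge[of 0] D2 in \<open>auto simp: E_def elim!: eventually_mono intro!: mult_right_mono\<close>)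
  have 2: "grows (A / 8) (\<lambda>i. E * \<Lambda> i) (\<lambda>z. W z * G z)"
    unfolding W_eq[symmetric] using D2(2)
    by (rule grows_mono) (use Lam_ge[of 0] D1 in \<open>auto simp: E_def elim!: eventually_mono intro!: mult_right_mono\<close>)
  obtain zg where zg: "G zg \<noteq> 0" using G_nz by blast
  have "grows (A / 8 / 16) (\<lambda>i. 21 * (E * \<Lambda> i)) W"
  proof (rule grows_div[OF _ G_hol W_hol 2 1 _ _ zg])
    show "filterlim (\<lambda>i. E * \<Lambda> i) at_top sequentially"
      using eventually_small_le[OF E] by (simp add: filterlim_at_top)
  qed (auto simp: A intro!: holomorphic_intros W_hol G_hol)
  note gr = this
  have le: "\<forall>\<^sub>F i in sequentially. 21 * (E * \<Lambda> i) \<le> \<rho> i ^ Suc K"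
    using rho_ge[of "21 * E"] rho_ge[of 0]
  proof eventually_elim
    case (elim i)
    have "21 * E * \<Lambda> i \<le> 21 * E * \<rho> i ^ K" using E Lam_rho by (intro mult_left_mono) auto
    also have "\<dots> \<le> \<rho> i * \<rho> i ^ K" using elim by (intro mult_right_mono) auto
    finally show ?case by simp
  qed
  have "A / 8 / 16 \<ge> 1" by (simp add: A)
  from zero_free_exp_poly[OF W_hol W_nz gr this le] obtain P where "\<And>z. W z = exp (poly P z)" by blast
  then show thesis by (rule that)
qed

lemma good_exists: "\<exists>z. z \<notin> bad \<and> a analytic_on {z}"
proof -
  have "countable (bad \<union> {z. \<not> a analytic_on {z}})"
    by (intro countable_Un countable_bad countable_not_analytic a_mero)
  then obtain z where "z \<notin> bad \<union> {z. \<not> a analytic_on {z}}"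
    using ex_not_in_countable by blast
  then show ?thesis by blast
qed

text \<open>\<open>U = G / (f - a)\<close> is treated as \<open>q * G / (q * f - A')\<close> with
  the pole polynomial \<open>q\<close>. Its degree may be as large as
  \<open>2 * D * \<Lambda> i\<close>, so the bounds contain \<open>\<Lambda> i\<close> times a
  logarithm of the radius, majorised by a fourth root. The losses of radius are 8 in
  \<open>x\<close>, 4 in the bound for \<open>A'\<close> and 16 in the division; their product is
  512.\<close>

lemma U_grows: "grows (A / 512) (\<lambda>i. \<Lambda> i * sqrt (sqrt (\<rho> i))) U"
proof -
  obtain x0 where x0: "x0 \<ge> 1"
    and ppb: "\<And>x B. x \<ge> x0 \<Longrightarrow> B \<ge> 0 \<Longrightarrow> (\<And>z. norm z \<le> 8 * x \<Longrightarrow> norm (f z) \<le> exp B) \<Longrightarrow>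
      \<exists>q A (N::nat). q holomorphic_on UNIV \<and> A holomorphic_on ball 0 (2 * x) \<and> real N \<le> 2 * B \<and>
        (\<forall>\<delta> z. 0 \<le> \<delta> \<longrightarrow> (\<forall>p. is_pole a p \<longrightarrow> \<delta> \<le> norm (z - p)) \<longrightarrow> \<delta> ^ N \<le> norm (q z)) \<and>
        (\<forall>z. norm z \<le> 2 * x \<longrightarrow> norm (q z) \<le> (4 * x) ^ N) \<and>
        (\<forall>z. norm z < 2 * x \<longrightarrow> a analytic_on {z} \<longrightarrow> A z = q z * a z) \<and>
        (\<forall>z. norm z \<le> x / 4 \<longrightarrow> norm (A z) \<le> exp (3 * (N * ln (4 * x) + B)))"
    by (rule pole_polynomial_bound[OF f_hol a_mero a_small]) blast
  obtain D1 where D1: "D1 \<ge> 1" "grows (A / 8) (\<lambda>i. D1 * \<Lambda> i) (\<lambda>z. (fwd_diff c ^^ n) f z - b z)"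
    by (rule diff_minus_b_grows)
  have GD1: "grows (A / 8) (\<lambda>i. D1 * \<Lambda> i) G" unfolding G_eq[abs_def] by (rule D1(2))
  obtain z0 where z0: "z0 \<notin> bad" "a analytic_on {z0}" using good_exists by blast
  obtain \<delta>0 where \<delta>0: "\<delta>0 > 0" "a holomorphic_on ball z0 \<delta>0" using z0(2) by (auto simp: analytic_on_def)
  \<comment> \<open>No pole of \<open>a\<close> is closer to \<open>z0\<close> than
    \<open>\<delta>\<close>, so \<open>|q z0| >= \<delta> ^ N\<close>;
    \<open>\<delta> \<le> 1\<close> fixes the sign of \<open>ln \<delta>\<close>.\<close>
  define \<delta> where "\<delta> = min \<delta>0 1"
  have \<delta>: "0 < \<delta>" "\<delta> \<le> 1" "\<delta> \<le> \<delta>0" using \<delta>0 by (auto simp: \<delta>_def)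
  have poles: "\<delta> \<le> norm (z0 - p)" if "is_pole a p" for p
  proof (rule ccontr)
    assume "\<not> \<delta> \<le> norm (z0 - p)"
    then have "p \<in> ball z0 \<delta>0" using \<delta> by (simp add: dist_norm)
    then have "a analytic_on {p}" using \<delta>0(2) by (meson holomorphic_on_imp_analytic_at open_ball)
    then show False using that analytic_at_imp_no_pole by blast
  qed
  define \<kappa> where "\<kappa> = norm (f z0 - a z0)"
  have \<kappa>: "\<kappa> > 0" using goodD[OF z0(1)] by (auto simp: \<kappa>_def)
  define L where "L = (\<lambda>i. ln (A / 2 * \<rho> i))"
  \<comment> \<open>Everything except the logarithm of the radius: \<open>ln \<delta>\<close> stems
    from \<open>\<delta> ^ N\<close> and \<open>ln \<kappa>\<close> from the value of
    \<open>f - a\<close> at \<open>z0\<close>. The coefficient \<open>6 * D\<close> below comes from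
    \<open>3 * NL\<close> with \<open>NL <= 2 * D * \<Lambda> i * L i\<close>.\<close>
  define C3 where "C3 = 3 * D + D1 + 1 + 2 * D * \<bar>ln \<delta>\<bar> + \<bar>ln \<kappa>\<bar>"
  have C3: "C3 > 0" using D D1(1) by (auto simp: C3_def intro!: add_pos_nonneg)
  have "\<forall>\<^sub>F i in sequentially. 6 * D * ln (A / 2 * \<rho> i) + C3 \<le> sqrt (sqrt (\<rho> i)) / 21"
    by (rule eventually_compose_filterlim[OF ln_le_fourth_root rho]) (use D C3 A in auto)
  then show ?thesis
    using GD1[unfolded grows_def] rho_ge[of "8 * x0 / A"] rho_ge[of "2 / A"] rho_ge[of 1] rho_ge[of "512 * norm z0 / A"] Lam_ge[of 1]
    unfolding grows_def
  proof eventually_elim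
    case (elim i)
    define x where "x = A * \<rho> i / 8"
    have Apos: "A > 0" by (simp add: A)
    have x: "x \<ge> x0" "x > 0" using elim(3,5) Apos x0 by (auto simp: x_def field_simps)
    have lnx: "ln (4 * x) = L i" by (simp add: x_def L_def)
    have L0: "L i \<ge> 0" using elim(4) Apos by (auto simp: L_def field_simps intro!: ln_ge_zero)
    have Lam0: "\<Lambda> i \<ge> 1" by (rule elim(7))
    have fB: "norm (f z) \<le> exp (D * \<Lambda> i)" if "norm z \<le> 8 * x" for z
      using that by (intro f_bound) (simp add: x_def)
    have DL: "D * \<Lambda> i \<ge> 0" using D Lam0 by simp
    obtain q A' and N :: nat where q: "q holomorphic_on UNIV" and A': "A' holomorphic_on ball 0 (2 * x)"
      and N: "real N \<le> 2 * (D * \<Lambda> i)"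
      and qlow: "\<And>\<delta> z. 0 \<le> \<delta> \<Longrightarrow> (\<And>p. is_pole a p \<Longrightarrow> \<delta> \<le> norm (z - p)) \<Longrightarrow> \<delta> ^ N \<le> norm (q z)"
      and qup: "\<And>z. norm z \<le> 2 * x \<Longrightarrow> norm (q z) \<le> (4 * x) ^ N"
      and A'q: "\<And>z. norm z < 2 * x \<Longrightarrow> a analytic_on {z} \<Longrightarrow> A' z = q z * a z"
      and A'up: "\<And>z. norm z \<le> x / 4 \<Longrightarrow> norm (A' z) \<le> exp (3 * (N * ln (4 * x) + D * \<Lambda> i))"
      using ppb[OF x(1) DL fB] by blast
    define NL where "NL = real N * L i"
    have NL: "0 \<le> NL" "NL \<le> 2 * D * \<Lambda> i * L i"
      using mult_right_mono[OF N L0] L0 by (auto simp: NL_def mult_ac)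
    have qup': "norm (q z) \<le> exp NL" if "norm z \<le> x / 4" for z
    proof -
      have "exp NL = exp (ln (4 * x)) ^ N" unfolding NL_def lnx[symmetric] by (simp add: exp_of_nat_mult[symmetric])
      also have "\<dots> = (4 * x) ^ N" using x by simp
      finally show ?thesis using qup[of z] that x by simp
    qed
    define M where "M = \<Lambda> i * (sqrt (sqrt (\<rho> i)) / 21)"
    have "\<Lambda> i * (6 * D * L i + C3) \<le> M" unfolding M_def L_def
      using elim(1) Lam0 by (intro mult_left_mono) auto
    then have M: "6 * D * \<Lambda> i * L i + C3 * \<Lambda> i \<le> M" by (simp add: algebra_simps)
    define T where "T = 3 * (D * \<Lambda> i) + D1 * \<Lambda> i + \<Lambda> i"
    have C3T: "C3 * \<Lambda> i = T + 2 * D * \<bar>ln \<delta>\<bar> * \<Lambda> i + \<bar>ln \<kappa>\<bar> * \<Lambda> i"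
      by (simp add: C3_def T_def algebra_simps)
    have nn: "2 * D * \<bar>ln \<delta>\<bar> * \<Lambda> i \<ge> 0" "\<bar>ln \<kappa>\<bar> * \<Lambda> i \<ge> 0" "D1 * \<Lambda> i \<ge> 0" using D D1 Lam0 by auto
    have NLM: "3 * NL + T \<le> M" using M NL C3T nn by (simp add: mult_ac)
    have "norm (U z) \<le> exp (21 * M)" if z: "norm z \<le> A / 512 * \<rho> i" for z
    proof (rule quotient_bound[of "\<lambda>z. q z * G z" "ball 0 (2 * x)" "\<lambda>z. q z * f z - A' z" U "x / 4" M z0])
      show hol: "(\<lambda>z. q z * G z) holomorphic_on ball 0 (2 * x)" "U holomorphic_on ball 0 (2 * x)"
        "(\<lambda>z. q z * f z - A' z) holomorphic_on ball 0 (2 * x)"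
        using holomorphic_on_subset[OF q subset_UNIV] holomorphic_on_subset[OF G_hol subset_UNIV]
          holomorphic_on_subset[OF U_hol subset_UNIV] holomorphic_on_subset[OF f_hol subset_UNIV] A'
        by (auto intro!: holomorphic_on_mult holomorphic_on_diff)
      show "open (ball (0::complex) (2 * x))" "connected (ball (0::complex) (2 * x))" by auto
      show "cball 0 (x / 4) \<subseteq> ball (0::complex) (2 * x)" "x / 4 > 0" using x by auto
      show "M > 0" using elim(5) Lam0 by (simp add: M_def)
      show "norm z0 \<le> x / 4 / 16" using elim(6) Apos by (simp add: x_def field_simps)
      show "norm z \<le> x / 4 / 16" using z by (simp add: x_def)
      show "norm (q w * G w) \<le> exp M" if w: "norm w \<le> x / 4" for w
      proof -
        have "norm w \<le> A / 8 * \<rho> i" using w x by (simp add: x_def)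
        then have "norm (G w) \<le> exp (D1 * \<Lambda> i)" using elim(2) by blast
        then have "norm (q w * G w) \<le> exp NL * exp (D1 * \<Lambda> i)"
          unfolding norm_mult using qup'[OF w] by (intro mult_mono) auto
        also have "\<dots> = exp (NL + D1 * \<Lambda> i)" by (simp add: exp_add)
        also have "\<dots> \<le> exp M" using NLM NL nn DL Lam0 by (simp add: T_def)
        finally show ?thesis .
      qed
      show "norm (q w * f w - A' w) \<le> exp M" if w: "norm w \<le> x / 4" for w
      proof -
        have "norm (q w * f w) \<le> exp NL * exp (D * \<Lambda> i)"
          unfolding norm_mult using qup'[OF w] w x by (intro mult_mono fB) auto
        also have "\<dots> = exp (NL + D * \<Lambda> i)" by (simp add: exp_add)
        also have "\<dots> \<le> exp (3 * (NL + D * \<Lambda> i))" using NL DL by simp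
        finally have "norm (q w * f w - A' w) \<le> 2 * exp (3 * (NL + D * \<Lambda> i))"
          using norm_triangle_ineq4[of "q w * f w" "A' w"] A'up[OF w] by (simp add: lnx NL_def)
        also have "\<dots> \<le> exp 1 * exp (3 * (NL + D * \<Lambda> i))"
          using exp_ge_add_one_self[of 1] by (intro mult_right_mono) auto
        also have "\<dots> = exp (1 + 3 * (NL + D * \<Lambda> i))" by (rule exp_add[symmetric])
        also have "\<dots> \<le> exp M" using NLM nn Lam0 by (simp add: T_def)
        finally show ?thesis .
      qed
      show "norm (q z0 * f z0 - A' z0) \<ge> exp (- M)"
      proof -
        have "norm z0 < 2 * x" using elim(6) Apos x by (simp add: x_def field_simps)
        then have eq: "q z0 * f z0 - A' z0 = q z0 * (f z0 - a z0)" using A'q z0(2) by (simp add: algebra_simps)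
        define y where "y = real N * \<bar>ln \<delta>\<bar>"
        have "y \<le> 2 * D * \<bar>ln \<delta>\<bar> * \<Lambda> i"
          using mult_right_mono[OF N, of "\<bar>ln \<delta>\<bar>"] by (simp add: y_def mult_ac)
        moreover have "\<bar>ln \<kappa>\<bar> \<le> \<bar>ln \<kappa>\<bar> * \<Lambda> i" using mult_left_mono[OF Lam0, of "\<bar>ln \<kappa>\<bar>"] by simp
        moreover have "6 * D * \<Lambda> i * L i \<ge> 0" "- \<bar>ln \<kappa>\<bar> \<le> ln \<kappa>" using D Lam0 L0 by auto
        moreover have "T \<ge> 0" using DL nn Lam0 by (simp add: T_def)
        moreover have "real N * ln \<delta> = - y" using \<delta> by (simp add: y_def abs_of_nonpos)
        ultimately have "- M \<le> real N * ln \<delta> + ln \<kappa>"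
          using M C3T nn DL Lam0 by linarith
        then have "exp (- M) \<le> exp (real N * ln \<delta> + ln \<kappa>)" by simp
        also have "\<dots> = \<delta> ^ N * \<kappa>" using \<delta> \<kappa> by (simp add: exp_add exp_of_nat_mult)
        also have "\<dots> \<le> norm (q z0) * \<kappa>" using qlow[of \<delta> z0] \<delta> \<kappa> poles by (intro mult_right_mono) auto
        finally show ?thesis unfolding eq norm_mult \<kappa>_def .
      qed
      show "q w * G w = U w * (q w * f w - A' w)" if "w \<in> ball 0 (2 * x)" for w
      proof (rule eq_off_countable[OF _ _ open_ball _ that])
        show "continuous_on (ball 0 (2 * x)) (\<lambda>w. q w * G w)"
          "continuous_on (ball 0 (2 * x)) (\<lambda>w. U w * (q w * f w - A' w))"
          using holomorphic_on_imp_continuous_on[OF hol(1)]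
            holomorphic_on_imp_continuous_on[OF holomorphic_on_mult[OF hol(2,3)]] by blast+
        have "U w * (f w - a w) \<noteq> G w \<or> \<not> a analytic_on {w}"
          if "w \<in> ball 0 (2 * x)" "q w * G w \<noteq> U w * (q w * f w - A' w)" for w
        proof (rule ccontr)
          assume "\<not> ?thesis"
          then have eqs: "G w = U w * (f w - a w)" "A' w = q w * a w" using A'q[of w] that(1) by auto
          show False using that(2) unfolding eqs by (simp add: algebra_simps)
        qed
        then show "countable {w \<in> ball 0 (2 * x). q w * G w \<noteq> U w * (q w * f w - A' w)}"
          by (intro countable_subset[OF _ countable_Un[OF U_eq countable_not_analytic[OF a_mero]]]) auto
      qed
    qed
    then show ?case by (simp add: M_def)
  qed
qed

text \<open>Lies between two rates: eventually above every multiple of \<open>\<Lambda> i\<close>,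
  yet \<open>o(\<Lambda> i * sqrt (\<rho> i))\<close>, as \<open>small_difference_quotient\<close>
  demands.\<close>

abbreviation \<phi> :: "nat \<Rightarrow> real" where "\<phi> i \<equiv> \<Lambda> i * sqrt (sqrt (\<rho> i))"

lemma root_rho_ge: "\<forall>\<^sub>F i in sequentially. X \<le> sqrt (sqrt (\<rho> i))"
  using filterlim_compose[OF sqrt_at_top filterlim_compose[OF sqrt_at_top rho]]
  unfolding filterlim_at_top by blast

lemma linear_le_phi: "\<forall>\<^sub>F i in sequentially. X * \<Lambda> i \<le> \<phi> i"
  using root_rho_ge[of X] Lam_ge[of 0]
proof eventually_elim
  case (elim i)
  show ?case using mult_right_mono[OF elim] by (simp only: mult.commute[of "\<Lambda> i"])
qed

lemma phi_at_top: "filterlim \<phi> at_top sequentially"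
  unfolding filterlim_at_top
proof
  fix Z :: real
  show "\<forall>\<^sub>F i in sequentially. Z \<le> \<phi> i"
    using linear_le_phi[of 1] Lam_ge[of Z] by eventually_elim simp
qed

lemma phi_le_pow: "\<forall>\<^sub>F i in sequentially. \<phi> i \<le> \<rho> i ^ Suc K"
  using rho_ge[of 1]
proof eventually_elim
  case (elim i)
  have "sqrt (sqrt (\<rho> i)) \<le> sqrt (\<rho> i)" "sqrt (\<rho> i) \<le> \<rho> i"
    using elim by (simp_all add: real_le_lsqrt sqrt_le_D power2_eq_square)
  then have "sqrt (sqrt (\<rho> i)) \<le> \<rho> i" by (rule order.trans)
  then have "\<phi> i \<le> \<rho> i ^ K * \<rho> i" using elim Lam_rho[of i] by (intro mult_mono) auto
  then show ?case by (simp add: mult.commute)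
qed

lemma phi_le_sqrt:
  assumes "\<epsilon> > 0"
  shows "\<forall>\<^sub>F i in sequentially. \<phi> i \<le> \<epsilon> * \<Lambda> i * sqrt (\<rho> i)"
  using root_rho_ge[of "1 / \<epsilon>"] Lam_ge[of 0] rho_ge[of 0]
proof eventually_elim
  case (elim i)
  define t where "t = sqrt (sqrt (\<rho> i))"
  have t: "sqrt (\<rho> i) = t * t" "t \<ge> 0" using elim by (simp_all add: t_def)
  have "1 \<le> \<epsilon> * t" using elim(1) assms by (simp add: t_def field_simps)
  from mult_left_mono[OF mult_left_mono[OF this t(2)] elim(2)]
  have "\<Lambda> i * (t * 1) \<le> \<Lambda> i * (t * (\<epsilon> * t))" .
  then show ?case using t(2) unfolding t(1) by (simp add: mult_ac)
qed

lemma G_grows: "grows (A / 512) \<phi> G"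
proof -
  obtain D1 where "D1 \<ge> 1" "grows (A / 8) (\<lambda>i. D1 * \<Lambda> i) (\<lambda>z. (fwd_diff c ^^ n) f z - b z)"
    by (rule diff_minus_b_grows)
  then have "grows (A / 8) (\<lambda>i. D1 * \<Lambda> i) G" unfolding G_eq[abs_def] by blast
  then show ?thesis by (rule grows_mono) (use linear_le_phi A in auto)
qed

text \<open>Off \<open>bad\<close> both sides equal \<open>(W - 1) * G\<close>, the difference of
  the differences of \<open>f\<close> of orders \<open>n + 1\<close> and \<open>n\<close>.
  Continuity extends this to every point whose shifts avoid the zeros of \<open>U\<close>, which is
  the form required on circles.\<close>

lemma quotient_difference_identity:
  assumes nz: "\<And>k. k \<le> n + 1 \<Longrightarrow> U (z + of_nat k * c) \<noteq> 0"
  shows "(W z - 1) * U z * (G z / U z) =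
    (fwd_diff c ^^ (n + 1)) (\<lambda>z. G z / U z) z - (fwd_diff c ^^ n) (\<lambda>z. G z / U z) z"
proof -
  define V where "V = (\<Inter>k\<in>{..n + 1}. {z. U (z + of_nat k * c) \<noteq> 0})"
  have cont: "continuous_on S (\<lambda>z. h (z + of_nat k * c))" if "h holomorphic_on UNIV" for h :: "complex \<Rightarrow> complex" and k S
    using continuous_on_subset[OF entire_continuous[OF entire_shift[OF that]]] by blast
  have "open V" unfolding V_def
    by (intro open_INT ballI finite_atMost open_Collect_neq cont U_hol continuous_on_const)
  have quot: "continuous_on V (\<lambda>z. G (z + of_nat k * c) / U (z + of_nat k * c))" if "k \<le> n + 1" for k
    using that by (intro continuous_on_divide cont U_hol G_hol) (auto simp: V_def)
  show ?thesis
  proof (rule eq_off_countable[of V "\<lambda>z. (W z - 1) * U z * (G z / U z)"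
        "\<lambda>z. (fwd_diff c ^^ (n + 1)) (\<lambda>z. G z / U z) z - (fwd_diff c ^^ n) (\<lambda>z. G z / U z) z", OF _ _ \<open>open V\<close>])
    show "z \<in> V" using nz by (simp add: V_def)
    have "continuous_on V (\<lambda>z. (W (z + of_nat 0 * c) - 1) * U (z + of_nat 0 * c) * (G (z + of_nat 0 * c) / U (z + of_nat 0 * c)))"
      by (intro continuous_on_mult continuous_on_diff continuous_on_const cont W_hol U_hol quot) simp
    then show "continuous_on V (\<lambda>z. (W z - 1) * U z * (G z / U z))" by simp
    show "continuous_on V (\<lambda>z. (fwd_diff c ^^ (n + 1)) (\<lambda>z. G z / U z) z - (fwd_diff c ^^ n) (\<lambda>z. G z / U z) z)"
      by (intro continuous_on_diff continuous_on_fwd_diff quot) auto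
    have "(W z - 1) * U z * (G z / U z) = (fwd_diff c ^^ (n + 1)) (\<lambda>z. G z / U z) z - (fwd_diff c ^^ n) (\<lambda>z. G z / U z) z"
      if "z \<notin> bad" for z
    proof -
      have "(W z - 1) * U z * (G z / U z) = W z * G z - G z" using goodD(3)[OF that] by (simp add: field_simps)
      also have "\<dots> = (fwd_diff c ^^ Suc n) f z - (fwd_diff c ^^ n) f z"
        unfolding W_eq[symmetric] by (simp add: G_eq)
      also have "\<dots> = (fwd_diff c ^^ Suc n) (\<lambda>z. G z / U z) z - (fwd_diff c ^^ n) (\<lambda>z. G z / U z) z"
        unfolding fwd_diff_F[OF that nm(2)] fwd_diff_F[OF that le_SucI[OF nm(2)]] ..
      finally show ?thesis by (simp only: Suc_eq_plus1)
    qed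
    then show "countable {z \<in> V. (W z - 1) * U z * (G z / U z) \<noteq>
        (fwd_diff c ^^ (n + 1)) (\<lambda>z. G z / U z) z - (fwd_diff c ^^ n) (\<lambda>z. G z / U z) z}"
      by (intro countable_subset[OF _ countable_bad]) blast
  qed
qed

lemma W_eq_1: "W z1 = 1"
proof (rule ccontr)
  assume z1: "W z1 \<noteq> 1"
  obtain P where P: "\<And>z. W z = exp (poly P z)" by (rule W_exp_poly) blast
  define s where "s = (\<lambda>z. (W z - 1) * U z)"
  have s: "s holomorphic_on UNIV" unfolding s_def
    by (intro holomorphic_on_mult holomorphic_on_diff W_hol U_hol holomorphic_on_const)
  have W1: "(\<lambda>z. W z - 1) holomorphic_on UNIV" by (intro holomorphic_on_diff W_hol holomorphic_on_const)
  obtain zu where zu: "U zu \<noteq> 0" using U_nz by blast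
  obtain zg where "zg \<notin> bad" using good_exists by blast
  then have zg: "G zg \<noteq> 0" "U zg \<noteq> 0" using goodD by auto
  have "\<exists>z. s z \<noteq> 0"
  proof (rule ccontr)
    assume "\<nexists>z. s z \<noteq> 0"
    then have "W z1 - 1 = 0" by (intro entire_zero_product[OF W1 U_hol _ zu]) (simp add: s_def)
    then show False using z1 by simp
  qed
  then obtain zs where zs: "s zs \<noteq> 0" by blast
  have sm_s: "small (A / 512 / 100) s"
  proof (rule small_difference_quotient[OF G_hol U_hol s G_grows U_grows _ phi_at_top phi_le_sqrt zg])
    show "A / 512 > 0" by (simp add: A)
    show "s z * (G z / U z) = (fwd_diff c ^^ (n + 1)) (\<lambda>z. G z / U z) z - (fwd_diff c ^^ n) (\<lambda>z. G z / U z) z"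
      if "\<And>k. k \<le> n + 1 \<Longrightarrow> U (z + of_nat k * c) \<noteq> 0" for z
      unfolding s_def by (rule quotient_difference_identity[OF that])
  qed
  have W_small: "small \<tau> W" for \<tau>
  proof -
    have "small \<tau> (\<lambda>z. exp (poly P z))"
    proof (rule small_exp_poly[OF s sm_s _ zs])
      show "A / 512 / 100 > 0" by (simp add: A)
      show "s z = 0" if "exp (poly P z) = 1" for z using that P by (simp add: s_def)
    qed
    then show ?thesis by (simp only: P[symmetric])
  qed
  have one_small: "small \<tau> (\<lambda>z. 1)" for \<tau> by (rule small_bounded[of _ 1]) simp
  have "small (A / 512 / 100 / 16) U"
  proof (rule small_div[OF s W1 U_hol sm_s])
    show "small (A / 512 / 100) (\<lambda>z. W z - 1)" by (rule small_diff[OF W_small one_small])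
    show "A / 512 / 100 > 0" by (simp add: A)
    show "W z1 - 1 \<noteq> 0" using z1 by simp
    show "s z = U z * (W z - 1)" for z by (simp add: s_def)
  qed
  \<comment> \<open>\<open>10 ^ 10 / (512 * 100 * 16)\<close> is more than 12000; the surplus over
    10000 pays for the shift by \<open>d\<close>.\<close>
  then have U_small: "small 10000 (\<lambda>z. U (z + d))" for d by (rule small_shift) (simp add: A)
  have numG_small: "small 10000 (\<lambda>z. num_G c W U j (z + d))" for j d
  proof (induction j arbitrary: d)
    case 0
    show ?case by (simp add: one_small)
  next
    case (Suc j)
    show ?case unfolding num_G.simps add.assoc
      by (intro small_diff small_mult small_add one_small small_shift[OF W_small[of 20000]] U_small Suc) simp
  qed
  have numb_small: "small 10000 (\<lambda>z. num_b c W U j (z + d))" for j d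
  proof (induction j arbitrary: d)
    case 0
    show ?case by (simp add: small_bounded[of _ 0])
  next
    case (Suc j)
    show ?case unfolding num_b.simps add.assoc
      by (intro small_diff small_mult small_add one_small U_small Suc numG_small)
  qed
  have den_small: "small 10000 (den c U j)" for j
    unfolding den_def[abs_def] by (intro small_prod U_small)
  define p where "p = (\<lambda>z. num_G c W U n z - den c U n z)"
  define q where "q = (\<lambda>z. den c U n z - num_b c W U n z)"
  have pq: "p holomorphic_on UNIV" "q holomorphic_on UNIV" unfolding p_def q_def
    by (intro holomorphic_on_diff entire_num[OF W_hol U_hol])+
  have pq_small: "small 10000 p" "small 10000 q" unfolding p_def q_def
    using small_diff[OF numG_small[of n 0, unfolded add_0_right] den_small]
      small_diff[OF den_small numb_small[of n 0, unfolded add_0_right]] by blast+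
  have num_eq: "den c U j z * (fwd_diff c ^^ j) (\<lambda>z. G z / U z) z = num_G c W U j z * G z + num_b c W U j z * b z"
    if "z \<notin> bad" for z j
    by (rule fwd_diff_num[where G = G and W = W and b = b and c = c, OF G_shift b_shift]) (use goodD(3)[OF bad_shift[OF that]] in blast)
  have rel: "p z * G z = q z * b z" for z
  proof (rule entire_eq_off_countable[of "\<lambda>z. p z * G z" "\<lambda>z. q z * b z"])
    show "(\<lambda>z. p z * G z) holomorphic_on UNIV" "(\<lambda>z. q z * b z) holomorphic_on UNIV"
      by (intro holomorphic_on_mult pq G_hol b_hol)+
    have "p z * G z = q z * b z" if "z \<notin> bad" for z
    proof -
      have "(fwd_diff c ^^ n) (\<lambda>z. G z / U z) z = G z + b z"
        using fwd_diff_F[OF that nm(2)] by (simp add: G_eq)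
      then show ?thesis using num_eq[OF that, of n] by (simp add: p_def q_def algebra_simps)
    qed
    then show "countable {z. p z * G z \<noteq> q z * b z}"
      by (intro countable_subset[OF _ countable_bad]) blast
  qed
  show False
  proof (cases "\<exists>z. p z \<noteq> 0")
    case True
    then obtain zp where zp: "p zp \<noteq> 0" by blast
    \<comment> \<open>Here \<open>G = q * b / p\<close> is small. Then so is
      \<open>U * f = Y + G\<close>, because \<open>Y\<close> agrees with \<open>U * a\<close> off a
      countable set, and dividing by \<open>U\<close> makes \<open>f\<close> small.\<close>
    have "small (10000 / 16) G"
    proof (rule small_div[of "\<lambda>z. q z * b z" p G, OF _ pq(1) G_hol _ pq_small(1) _ zp])
      show "(\<lambda>z. q z * b z) holomorphic_on UNIV" by (intro holomorphic_on_mult pq b_hol)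
      have "small 10000 b" using small_b by (rule small_mono) (simp add: A)
      then show "small 10000 (\<lambda>z. q z * b z)" by (intro small_mult pq_small)
      show "q z * b z = G z * p z" for z using rel[of z] by (simp add: mult.commute)
    qed simp
    then have G_small: "small 156 G" by (rule small_mono) simp
    define Y where "Y = (\<lambda>z. U z * f z - G z)"
    have Y: "Y holomorphic_on UNIV" unfolding Y_def
      by (intro holomorphic_on_diff holomorphic_on_mult U_hol f_hol G_hol)
    have U_small': "small \<tau> U" if "\<tau> \<le> 10000" for \<tau> using small_mono[OF U_small[of 0, unfolded add_0_right] that] .
    have "small (10000 / 4) Y"
    proof (rule product_small[OF a_mero a_small Y U_hol U_small'])
      have "U z * (f z - a z) \<noteq> G z" if "Y z \<noteq> U z * a z" for z
        using that by (auto simp: Y_def algebra_simps)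
      then show "countable {z. Y z \<noteq> U z * a z}" by (intro countable_subset[OF _ U_eq]) blast
    qed (simp_all add: A)
    then have "small 156 Y" by (rule small_mono) simp
    then have "small 156 (\<lambda>z. Y z + G z)" by (intro small_add G_small)
    then have "small 156 (\<lambda>z. U z * f z)" by (simp add: Y_def)
    then have "small (156 / 16) f"
      by (intro small_div[of "\<lambda>z. U z * f z" U f, OF _ U_hol f_hol _ _ _ zu] holomorphic_on_mult U_hol f_hol U_small') auto
    then show False using f_not_small[of "156 / 16"] by simp
  next
    case False
    then have Gn: "num_G c W U n z = den c U n z" for z by (auto simp: p_def)
    obtain zb where zb: "b zb \<noteq> 0" using b_nz by blast
    have "q z = 0" for z
      by (rule entire_zero_product[OF pq(2) b_hol _ zb]) (use rel False in force)
    then have bn: "num_b c W U n z = den c U n z" for z by (simp add: q_def)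
    show False
    proof (rule chain_exclude[OF _ countable_bad])
      show "exp (poly P z1) \<noteq> 1" using z1 P by simp
      fix z assume z: "z \<notin> bad"
      have Unz: "U (z + of_nat k * c) \<noteq> 0" for k using goodD(3)[OF bad_shift[OF z]] .
      have Unz': "U (z + of_nat k * c + of_nat l * c) \<noteq> 0" for k l
        using Unz[of "k + l"] by (simp add: algebra_simps)
      have dnz: "den c U j (z + of_nat k * c) \<noteq> 0" for j k using Unz' by (simp add: den_def)
      have sh: "z + of_nat (Suc k) * c = z + of_nat k * c + c" for k by (simp add: algebra_simps)
      \<comment> \<open>Dividing by \<open>den\<close> turns the recurrences for
        \<open>num_G\<close> and \<open>num_b\<close> into those of \<open>difference_chain\<close>;
        the vanishing of \<open>p\<close> and \<open>q\<close> supplies its conditions at level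
        \<open>n\<close>.\<close>
      define al where "al = (\<lambda>j k. num_G c W U j (z + of_nat k * c) / den c U j (z + of_nat k * c))"
      define be where "be = (\<lambda>j k. num_b c W U j (z + of_nat k * c) / den c U j (z + of_nat k * c))"
      have split: "den c U (Suc j) w = den c U j w * U (w + of_nat (Suc j) * c)"
        "den c U j (w + c) \<noteq> 0" "U w \<noteq> 0" "den c U j w \<noteq> 0" "U (w + of_nat (Suc j) * c) \<noteq> 0"
        "den c U j w * U (w + of_nat (Suc j) * c) = U w * den c U j (w + c)"
        if "w = z + of_nat k * c" for w k j
        using dnz[of j "Suc k"] dnz[of j k] Unz[of k] Unz'[of k "Suc j"] den_Suc[of c U j w] den_Suc_shift[of c U j w]
        unfolding that sh by simp_all
      have frac: "(x1 * x2 * u - x3 * v) / dd = x1 * (x2 / d') - x3 / d"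
        if "dd = d * v" "d * v = u * d'" "d \<noteq> 0" "v \<noteq> 0" "u \<noteq> 0" "d' \<noteq> 0" for x1 x2 x3 u v d d' dd :: complex
      proof -
        have 1: "x1 * x2 * u / dd = x1 * (x2 / d')" unfolding that(1,2) using that by simp
        have 2: "x3 * v / dd = x3 / d" unfolding that(1) using that(3,4) by simp
        show ?thesis unfolding diff_divide_distrib 1 2 ..
      qed
      have "difference_chain n al be (\<lambda>k. exp (poly P (z + of_nat k * c)))"
      proof
        show "n \<ge> 1" using nm by simp
        show "al n k = 1" "be n k = 1" for k using dnz by (simp_all add: al_def be_def Gn bn)
        show "be 0 k = 0" for k by (simp add: be_def)
        show "al (Suc j) k = (1 + exp (poly P (z + of_nat k * c))) * al j (Suc k) - al j k" for j k
          unfolding al_def sh num_G.simps P[symmetric]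
          by (rule frac) (use split[OF refl] in auto)
        show "be (Suc j) k = al j (Suc k) + be j (Suc k) - be j k" for j k
        proof -
          define w where "w = z + of_nat k * c"
          have "(1 * (num_G c W U j (w + c) + num_b c W U j (w + c)) * U w - num_b c W U j w * U (w + of_nat (Suc j) * c)) / den c U (Suc j) w
            = 1 * ((num_G c W U j (w + c) + num_b c W U j (w + c)) / den c U j (w + c)) - num_b c W U j w / den c U j w"
            by (rule frac) (use split[OF w_def] in auto)
          then show ?thesis
            unfolding al_def be_def sh num_b.simps w_def[symmetric]
            by (simp only: mult_1_left add_divide_distrib mult.commute[of "U w"])
        qed
      qed
      then show "\<exists>al be. difference_chain n al be (\<lambda>k. exp (poly P (z + of_nat k * c)))" by blast
    qed
  qed
qed

section \<open>The remaining case \<open>W = 1\<close>\<close>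

lemma G_shift_2: "G (z + c) = 2 * G z + b z"
  using G_shift[of z] W_eq_1[of z] by simp

lemma U_shift_near_1:
  obtains \<epsilon> where "\<epsilon> > 0"
    "\<And>\<eta>. \<eta> > 0 \<Longrightarrow> \<forall>\<^sub>F k in sequentially. \<forall>w\<in>cball p \<epsilon>. norm (U (w + of_nat k * c) - 1) \<le> \<eta>"
proof (rule shift_tendsto_one[of U G b "\<lambda>z. G z + b z" c bad n p, OF U_hol G_hol b_hol refl _ b_shift countable_bad])
  show "G (z + c) + b (z + c) = 2 * (G z + b z)" for z
    unfolding G_shift_2 b_shift by (simp add: algebra_simps)
  show "U z \<noteq> 0 \<and> G z + b z \<noteq> 0" if "z \<notin> bad" for z
    using goodD[OF that] by (simp add: G_eq)
  show "(fwd_diff c ^^ n) (\<lambda>z. G z / U z) z = G z + b z" if "\<And>k::nat. z + of_nat k * c \<notin> bad" for z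
    using fwd_diff_F[of z n] that[of 0] nm(2) by (simp add: G_eq)
qed blast

lemma entire_bounded_near:
  assumes "h holomorphic_on UNIV"
  obtains C where "C \<ge> 0" "\<And>w. w \<in> cball p \<epsilon> \<Longrightarrow> norm (h (w + d)) \<le> C"
proof -
  have "continuous_on (cball p \<epsilon>) (\<lambda>w. h (w + d))"
    by (rule continuous_on_subset[OF entire_continuous[OF entire_shift[OF assms]] subset_UNIV])
  then have "bounded ((\<lambda>w. h (w + d)) ` cball p \<epsilon>)"
    by (intro compact_imp_bounded compact_continuous_image compact_cball)
  then obtain C where "\<forall>x \<in> (\<lambda>w. h (w + d)) ` cball p \<epsilon>. norm x \<le> C" by (auto simp: bounded_iff)
  then have "norm (h (w + d)) \<le> max C 0" if "w \<in> cball p \<epsilon>" for w using that by (simp add: le_max_iff_disj)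
  then show thesis by (intro that[of "max C 0"]) auto
qed

text \<open>If \<open>U p = 0\<close>, then \<open>a\<close> must have a pole at \<open>p\<close>. But \<open>a = f - G / U\<close> is bounded near
  \<open>p + k * c\<close> for large \<open>k\<close>, and \<open>(fwd_diff c ^^ m) a = 0\<close> carries this bound back to \<open>p\<close>.\<close>

lemma U_nonzero: "U p \<noteq> 0"
proof
  assume Up: "U p = 0"
  obtain \<epsilon> where \<epsilon>: "\<epsilon> > 0" and near: "\<And>\<eta>. \<eta> > 0 \<Longrightarrow>
      \<forall>\<^sub>F k in sequentially. \<forall>w\<in>cball p \<epsilon>. norm (U (w + of_nat k * c) - 1) \<le> \<eta>"
    by (rule U_shift_near_1[of p]) blast
  have "\<forall>\<^sub>F k in sequentially. \<forall>w\<in>cball p \<epsilon>. norm (U (w + of_nat k * c) - 1) \<le> 1 / 2"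
    by (rule near) simp
  then obtain k0 where k0: "\<And>k w. k \<ge> k0 \<Longrightarrow> w \<in> cball p \<epsilon> \<Longrightarrow> norm (U (w + of_nat k * c) - 1) \<le> 1 / 2"
    unfolding eventually_sequentially by blast
  define S where "S = cball p \<epsilon> - bad"
  define Q where "Q = (\<lambda>j k. \<exists>C. \<forall>w\<in>S. norm ((fwd_diff c ^^ j) a (w + of_nat k * c)) \<le> C)"
  have sh: "w + of_nat k * c + c = w + of_nat (Suc k) * c" for w k by (simp add: algebra_simps)
  have far: "Q j k" if "k \<ge> k0" for j k
    using that
  proof (induction j arbitrary: k)
    case 0
    obtain Cf where Cf: "\<And>w. w \<in> cball p \<epsilon> \<Longrightarrow> norm (f (w + of_nat k * c)) \<le> Cf"
      by (rule entire_bounded_near[OF f_hol]) blast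
    obtain Cg where Cg: "Cg \<ge> 0" "\<And>w. w \<in> cball p \<epsilon> \<Longrightarrow> norm (G (w + of_nat k * c)) \<le> Cg"
      by (rule entire_bounded_near[OF G_hol]) blast
    have "norm (a (w + of_nat k * c)) \<le> Cf + 2 * Cg" if w: "w \<in> S" for w
    proof -
      define v where "v = w + of_nat k * c"
      have "w \<in> cball p \<epsilon>" "w \<notin> bad" using w by (auto simp: S_def)
      note gd = goodD(1,3)[OF bad_shift[OF this(2), of k], folded v_def]
      have U2: "norm (U v) \<ge> 1 / 2"
        using k0[OF 0 \<open>w \<in> cball p \<epsilon>\<close>, folded v_def] norm_triangle_ineq3[of "U v" 1] by simp
      have "a v = f v - G v / U v" using gd by (simp add: field_simps)
      then have "norm (a v) \<le> norm (f v) + norm (G v) / norm (U v)"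
        using norm_triangle_ineq4[of "f v" "G v / U v"] by (simp add: norm_divide)
      also have "norm (f v) \<le> Cf" using Cf[OF \<open>w \<in> cball p \<epsilon>\<close>, folded v_def] .
      also have "norm (G v) / norm (U v) \<le> Cg / (1 / 2)"
        using Cg(2)[OF \<open>w \<in> cball p \<epsilon>\<close>, folded v_def] Cg(1) U2 by (intro frac_le) auto
      finally show ?thesis by (simp add: v_def)
    qed
    then show ?case unfolding Q_def by auto
  next
    case (Suc j)
    from Suc(1)[of k] Suc(1)[of "Suc k"] Suc(2) obtain C1 C2 where
      C: "\<forall>w\<in>S. norm ((fwd_diff c ^^ j) a (w + of_nat k * c)) \<le> C1"
      "\<forall>w\<in>S. norm ((fwd_diff c ^^ j) a (w + of_nat (Suc k) * c)) \<le> C2" unfolding Q_def by (auto simp del: of_nat_Suc)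
    have "norm ((fwd_diff c ^^ Suc j) a (w + of_nat k * c)) \<le> C2 + C1" if "w \<in> S" for w
      unfolding fwd_diff_Suc sh using C that
      by (intro order.trans[OF norm_triangle_ineq4] add_mono) (auto simp del: of_nat_Suc)
    then show ?case unfolding Q_def by blast
  qed
  \<comment> \<open>Descent in \<open>j\<close> from the vanishing \<open>m\<close>-th difference,
    and for each \<open>j\<close> descent in \<open>k\<close> from \<open>k0\<close>: the
    \<open>j\<close>-th difference at \<open>k\<close> is the one at \<open>Suc k\<close> minus the
    difference of order \<open>Suc j\<close> at \<open>k\<close>.\<close>
  have all: "Q j k" if "j \<le> m" for j k
    using that
  proof (induction j arbitrary: k rule: inc_induct)
    case base
    have "(fwd_diff c ^^ m) a (w + of_nat k * c) = 0" if "w \<in> S" for w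
      using goodD(2)[OF bad_shift, of w k] that by (simp add: S_def)
    then show ?case unfolding Q_def by (intro exI[of _ 0]) simp
  next
    case (step j)
    show ?case
    proof (cases "k \<ge> k0")
      case False
      then have "k \<le> k0" by simp
      then show ?thesis
      proof (induction k rule: inc_induct)
        case base
        show ?case by (rule far) simp
      next
        case (step k)
        from step.IH \<open>\<And>k. Q (Suc j) k\<close>[of k] obtain C1 C2 where
          C: "\<forall>w\<in>S. norm ((fwd_diff c ^^ j) a (w + of_nat (Suc k) * c)) \<le> C1"
          "\<forall>w\<in>S. norm ((fwd_diff c ^^ Suc j) a (w + of_nat k * c)) \<le> C2" unfolding Q_def by blast
        have "norm ((fwd_diff c ^^ j) a (w + of_nat k * c)) \<le> C1 + C2" if "w \<in> S" for w
        proof -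
          have "(fwd_diff c ^^ j) a (w + of_nat k * c) =
            (fwd_diff c ^^ j) a (w + of_nat (Suc k) * c) - (fwd_diff c ^^ Suc j) a (w + of_nat k * c)"
            unfolding fwd_diff_Suc sh by simp
          then show ?thesis
            using C that by (simp only:) (intro order.trans[OF norm_triangle_ineq4] add_mono; blast)
        qed
        then show ?case unfolding Q_def by blast
      qed
    qed (rule far)
  qed
  from all[of 0 0] obtain C where C: "\<And>w. w \<in> S \<Longrightarrow> norm (a w) \<le> C" unfolding Q_def by auto
  obtain Cf where Cf: "\<And>w. w \<in> cball p \<epsilon> \<Longrightarrow> norm (f (w + 0)) \<le> Cf"
    by (rule entire_bounded_near[OF f_hol]) blast
  have "norm (G w) \<le> norm (U w) * (Cf + C)" if "w \<in> S" for w
  proof -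
    have w: "w \<in> cball p \<epsilon>" "w \<notin> bad" using that by (auto simp: S_def)
    have "norm (f w - a w) \<le> Cf + C"
      using norm_triangle_ineq4[of "f w" "a w"] Cf[OF w(1)] C[OF that] by simp
    then show ?thesis unfolding goodD(1)[OF w(2), symmetric] norm_mult by (intro mult_left_mono) auto
  qed
  \<comment> \<open>The inequality is known only off \<open>bad\<close>, but the set where it fails
    is open and countable, hence empty. At \<open>p\<close> itself it then forces
    \<open>G p = 0\<close>.\<close>
  then have "ball p \<epsilon> \<inter> {w. norm (U w) * (Cf + C) < norm (G w)} \<subseteq> bad" by (force simp: S_def)
  then have "countable (ball p \<epsilon> \<inter> {w. norm (U w) * (Cf + C) < norm (G w)})"
    by (rule countable_subset[OF _ countable_bad])
  moreover have "open (ball p \<epsilon> \<inter> {w. norm (U w) * (Cf + C) < norm (G w)})"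
    by (intro open_Int open_ball open_Collect_less continuous_intros entire_continuous U_hol G_hol)
  ultimately have "p \<notin> ball p \<epsilon> \<inter> {w. norm (U w) * (Cf + C) < norm (G w)}"
    using open_countable_empty by blast
  then have "G p = 0" using Up \<epsilon> by simp
  then show False using U_zero[OF Up] by simp
qed

text \<open>On every orbit \<open>|U|\<close> tends to 1 while \<open>ln |U|\<close> is a polynomial
  in \<open>k\<close>; so this polynomial is 0, and \<open>Re P = 0\<close> everywhere. A polynomial
  that omits a value is constant, and a constant \<open>U\<close> equals its limit 1 along an
  orbit.\<close>

lemma U_eq_1: "U z = 1"
proof -
  have "A / 512 \<ge> 1" by (simp add: A)
  from zero_free_exp_poly[OF U_hol U_nonzero U_grows this phi_le_pow]
  obtain P where P: "\<And>z. U z = exp (poly P z)" by blast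
  have Re0: "Re (poly P z) = 0" for z
  proof -
    obtain \<epsilon> where \<epsilon>: "\<epsilon> > 0" and near: "\<And>\<eta>. \<eta> > 0 \<Longrightarrow>
        \<forall>\<^sub>F k in sequentially. \<forall>w\<in>cball z \<epsilon>. norm (U (w + of_nat k * c) - 1) \<le> \<eta>"
      by (rule U_shift_near_1[of z]) blast
    obtain q :: "real poly" where q: "\<And>k::nat. poly q (real k) = Re (poly P (z + of_nat k * c))"
      by (rule Re_poly_chain) blast
    have lim: "\<forall>\<^sub>F k in sequentially. \<bar>exp (poly q (real k)) - 1\<bar> \<le> \<eta>" if "\<eta> > 0" for \<eta>
      using near[OF that]
    proof eventually_elim
      case (elim k)
      have "norm (U (z + of_nat k * c) - 1) \<le> \<eta>" using elim \<epsilon> by simp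
      then show ?case using norm_triangle_ineq3[of "U (z + of_nat k * c)" 1] by (simp add: P q)
    qed
    show ?thesis
    proof (cases q rule: real_poly_trichotomy)
      case (const x)
      have "\<bar>exp x - 1\<bar> \<le> \<eta>" if "\<eta> > 0" for \<eta>
        using lim[OF that] const by simp
      then have "exp x = 1" using field_le_epsilon[of "\<bar>exp x - 1\<bar>" 0] by simp
      then show ?thesis using const[of 0] q[of 0] by simp
    next
      case (pos B \<delta>)
      have "\<forall>\<^sub>F k in sequentially. (2 - B) / \<delta> \<le> real k"
        using filterlim_real_sequentially unfolding filterlim_at_top by blast
      with pos(2) lim[OF zero_less_one] have "\<forall>\<^sub>F k in sequentially. False"
      proof eventually_elim
        case (elim k)
        then have "2 \<le> poly q (real k)" using pos(1) by (simp add: pos_divide_le_eq mult.commute)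
        then show ?case using elim(2) exp_ge_add_one_self[of "poly q (real k)"] by simp
      qed
      then show ?thesis by simp
    next
      case (neg B \<delta>)
      have "\<forall>\<^sub>F k in sequentially. (B + 2) / \<delta> \<le> real k"
        using filterlim_real_sequentially unfolding filterlim_at_top by blast
      with neg(2) lim[OF half_gt_zero[OF zero_less_one]] have "\<forall>\<^sub>F k in sequentially. False"
      proof eventually_elim
        case (elim k)
        then have "2 \<le> - poly q (real k)" using neg(1) by (simp add: pos_divide_le_eq mult.commute)
        then have "3 \<le> exp (- poly q (real k))" using exp_ge_add_one_self[of "- poly q (real k)"] by linarith
        then have "exp (poly q (real k)) * 3 \<le> 1"
          by (simp add: exp_minus field_simps)
        moreover have "1 - exp (poly q (real k)) \<le> 1 / 2" using abs_le_D2[OF elim(2)] by simp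
        ultimately show ?case by linarith
      qed
      then show ?thesis by simp
    qed
  qed
  \<comment> \<open>The value 1 is not purely imaginary and is therefore omitted by
    \<open>P\<close>.\<close>
  have "constant (poly (P - [:1:]))"
  proof (rule ccontr)
    assume "\<not> ?thesis"
    then obtain z where "poly (P - [:1:]) z = 0" using fundamental_theorem_of_algebra by blast
    then have "poly P z = 1" by simp
    then show False using Re0[of z] by simp
  qed
  then have const: "U w = U z" for w by (auto simp: constant_def P dest: spec2[of _ w z])
  obtain \<epsilon> where \<epsilon>: "\<epsilon> > 0" and near: "\<And>\<eta>. \<eta> > 0 \<Longrightarrow>
      \<forall>\<^sub>F k in sequentially. \<forall>w\<in>cball z \<epsilon>. norm (U (w + of_nat k * c) - 1) \<le> \<eta>"
    by (rule U_shift_near_1[of z]) blast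
  have "norm (U z - 1) \<le> \<eta>" if "\<eta> > 0" for \<eta>
  proof -
    have "\<forall>\<^sub>F k::nat in sequentially. norm (U z - 1) \<le> \<eta>"
      using near[OF that] by eventually_elim (use \<epsilon> const in \<open>metis centre_in_cball less_imp_le\<close>)
    then show ?thesis by simp
  qed
  then show ?thesis using field_le_epsilon[of "norm (U z - 1)" 0] by simp
qed

lemma difference_identity:
  assumes "z \<notin> bad"
  shows "fwd_diff c f z = f z + b z + fwd_diff c a z - a z"
proof -
  have 1: "f z - a z = G z" using goodD(1)[OF assms] by (simp add: U_eq_1)
  have "f (z + c) - a (z + c) = G (z + c)"
    using goodD(1)[OF bad_shift[OF assms, of 1]] by (simp add: U_eq_1)
  then have "f (z + c) - a (z + c) = 2 * (f z - a z) + b z" unfolding G_shift_2 1 .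
  then show ?thesis by (simp add: fwd_diff_def algebra_simps)
qed

end

theorem theorem1p2:
  fixes c :: complex and n m :: nat and f a b :: "complex \<Rightarrow> complex"
  assumes "1 \<le> m" and "m \<le> n"
    and "f holomorphic_on UNIV" and "\<not> f constant_on UNIV"
    and "nevanlinna_order f < \<infinity>"
    and "\<exists>z. (fwd_diff c ^^ n) f z \<noteq> 0"
    and "a \<in> small_functions f" and "b \<in> small_functions f"
    and "\<exists>z. b z \<noteq> 0"
    and "b holomorphic_on UNIV" and "\<forall>z. b (z + c) = b z"
    and "\<forall>\<^sub>\<approx>z\<in>UNIV. (fwd_diff c ^^ m) a z = 0"
    and "share_zero_CM {\<lambda>z. f z - a z,
                        \<lambda>z. (fwd_diff c ^^ n) f z - b z,
                        \<lambda>z. (fwd_diff c ^^ (n + 1)) f z - b z}"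
  shows "\<forall>\<^sub>\<approx>z\<in>UNIV. fwd_diff c f z = f z + b z + fwd_diff c a z - a z"
proof -
  note f = assms(3) and b = assms(10)
  have a: "a meromorphic_on UNIV" "is_S (nevanlinna_T a) f" and b_small: "is_S (nevanlinna_T b) f"
    using assms(7,8) by (auto simp: small_functions_def)
  define F G H where "F = (\<lambda>z. f z - a z)" and "G = (\<lambda>z. (fwd_diff c ^^ n) f z - b z)"
    and "H = (\<lambda>z. (fwd_diff c ^^ Suc n) f z - b z)"
  have G: "G holomorphic_on UNIV" and H: "H holomorphic_on UNIV"
    unfolding G_def H_def by (intro holomorphic_on_diff entire_fwd_diff f b)+
  have F: "F meromorphic_on UNIV"
    unfolding F_def by (intro meromorphic_on_diff entire_meromorphic f a)
  have share: "zero_mult F z = zero_mult G z" "zero_mult G z = zero_mult H z" for z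
    using assms(13) unfolding share_zero_CM_def F_def G_def H_def Suc_eq_plus1 by blast+
  obtain K0 x0 where "\<And>r. r \<ge> x0 \<Longrightarrow> nevanlinna_T f r \<le> r ^ K0" and x0: "x0 \<ge> 1"
    by (rule finite_order_bound[OF assms(5)]) blast
  then have prox: "\<And>r. r \<ge> x0 \<Longrightarrow> proximity f r \<le> r ^ K0" by (simp add: nevanlinna_T_entire[OF f])
  obtain \<rho> \<Lambda> :: "nat \<Rightarrow> real" and D :: real and K :: nat where
    scale: "filterlim \<rho> at_top sequentially" "filterlim \<Lambda> at_top sequentially" "D \<ge> 1"
    "\<And>i. \<exists>z. norm z \<le> \<rho> i \<and> norm (f z) = exp (\<Lambda> i)"
    "\<And>i z. norm z \<le> 10 ^ 10 * \<rho> i \<Longrightarrow> norm (f z) \<le> exp (D * \<Lambda> i)"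
    and Lam_rho: "\<And>i. \<Lambda> i \<le> \<rho> i ^ K"
    by (rule scales_exist[where A = "10 ^ 10" and K = K0, OF f assms(4) _ x0]) (erule prox, simp, blast)
  interpret E: entire_scales \<rho> \<Lambda> f "10 ^ 10" D
    by unfold_locales (use scale f in auto)
  \<comment> \<open>Otherwise \<open>f\<close> would agree with \<open>a\<close> off a countable set
    and so be small compared with itself.\<close>
  have "\<not> (\<forall>\<^sub>\<approx>z\<in>UNIV. F z = 0)"
  proof
    assume "\<forall>\<^sub>\<approx>z\<in>UNIV. F z = 0"
    from countable_not_cosparse[OF this] have eq: "countable {z. f z \<noteq> 1 * a z}" by (simp add: F_def)
    have "E.small (10 ^ 10 / 4) f"
      by (rule E.product_small[OF a f holomorphic_on_const _ _ _ eq]) (simp_all add: E.small_bounded[of _ 1])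
    then show False using E.f_not_small[of "10 ^ 10 / 4"] by simp
  qed
  then have F0: "\<forall>\<^sub>\<approx>z\<in>UNIV. F z \<noteq> 0"
    using meromorphic_imp_constant_or_avoid[OF F open_UNIV connected_UNIV, of 0] by blast
  \<comment> \<open>Sharing also transfers non-degeneracy: infinite multiplicity is excluded for
    \<open>F\<close>, hence for \<open>G\<close> and \<open>H\<close>.\<close>
  have "zero_mult G z \<noteq> \<infinity>" "zero_mult H z \<noteq> \<infinity>" for z
    unfolding share(2)[symmetric] unfolding share(1)[symmetric] zero_mult_avoid[OF F0] by simp_all
  then have G0: "\<forall>\<^sub>\<approx>z\<in>UNIV. G z \<noteq> 0" and H0: "\<forall>\<^sub>\<approx>z\<in>UNIV. H z \<noteq> 0"
    using meromorphic_zero_mult_finite[OF entire_meromorphic] G H by blast+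
  obtain U where U: "U holomorphic_on UNIV" "\<forall>\<^sub>\<approx>z\<in>UNIV. U z * F z = G z" "\<And>z. U z = 0 \<Longrightarrow> G z \<noteq> 0"
    by (rule share_quotient[OF F F0 G G0 share(1)]) blast
  obtain W where W: "W holomorphic_on UNIV" "\<forall>\<^sub>\<approx>z\<in>UNIV. W z * G z = H z" "\<And>z. W z = 0 \<Longrightarrow> H z \<noteq> 0"
    by (rule share_quotient[OF entire_meromorphic[OF G] G0 H H0 share(2)]) blast
  have WG: "H z = W z * G z" for z
    by (rule entire_eq_off_countable[of H "\<lambda>z. W z * G z", OF H holomorphic_on_mult[OF W(1) G]])
      (use countable_not_cosparse[OF W(2)] in \<open>simp add: eq_commute\<close>)
  obtain zg where "zg \<notin> {z. G z = 0}"
    using ex_not_in_countable[of "{z. G z = 0}"] countable_not_cosparse[OF G0] by auto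
  then have G_nz: "\<exists>z. G z \<noteq> 0" by blast
  interpret S: sharing_setting \<rho> \<Lambda> f "10 ^ 10" D c n m a b G W U K
  proof unfold_locales
    \<comment> \<open>A zero of \<open>W\<close> would give both \<open>H z \<noteq> 0\<close> and
      \<open>H z = W z * G z = 0\<close>.\<close>
    show "W z \<noteq> 0" for z using W(3)[of z] WG[of z] by auto
    show "(fwd_diff c ^^ Suc n) f z - b z = W z * G z" for z using WG[of z] unfolding H_def .
    show "countable {z. U z * (f z - a z) \<noteq> G z}" using countable_not_cosparse[OF U(2)] unfolding F_def .
    show "countable {z. (fwd_diff c ^^ m) a z \<noteq> 0}" by (rule countable_not_cosparse[OF assms(12)])
    show "G z = (fwd_diff c ^^ n) f z - b z" for z by (simp add: G_def)
  qed (use assms a b_small Lam_rho W(1) U(1,3) G_nz in blast)+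
  \<comment> \<open>The set \<open>bad\<close> is known only to be countable, while the claim
    demands an exceptional set without limit points. By the dichotomy for meromorphic functions it
    is enough to refute \<open>R \<noteq> 0\<close> off such a set, and one point outside
    \<open>bad\<close> does that.\<close>
  define R where "R = (\<lambda>z. fwd_diff c f z - (f z + b z + fwd_diff c a z - a z))"
  have "(\<lambda>z. a (z + c)) meromorphic_on UNIV"
    by (rule meromorphic_on_compose[OF a(1)]) (auto intro!: analytic_intros)
  then have "R meromorphic_on UNIV"
    unfolding R_def fwd_diff_def
    by (intro meromorphic_on_diff meromorphic_on_add a(1) entire_meromorphic[OF f] entire_meromorphic[OF b]
        entire_meromorphic[OF entire_shift[OF f]])
  then have "(\<forall>\<^sub>\<approx>z\<in>UNIV. R z = 0) \<or> (\<forall>\<^sub>\<approx>z\<in>UNIV. R z \<noteq> 0)"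
    by (rule meromorphic_imp_constant_or_avoid[OF _ open_UNIV connected_UNIV])
  then show ?thesis
  proof
    assume "\<forall>\<^sub>\<approx>z\<in>UNIV. R z \<noteq> 0"
    from countable_not_cosparse[OF this] have "countable (S.bad \<union> {z. \<not> R z \<noteq> 0})"
      by (intro countable_Un S.countable_bad)
    then obtain z where "z \<notin> S.bad" "R z \<noteq> 0" using ex_not_in_countable by blast
    then show ?thesis using S.difference_identity[of z] by (simp add: R_def)
  qed (simp add: R_def)
qed

end
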